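(* Let $E$ be a directed graph, $\mathbb{K}$ a field, $L_{\mathbb{K}}(E)$ the associated Leavitt path algebra, and $\mathcal{C}(L_{\mathbb{K}}(E))$ its centroid. If $L_{\mathbb{K}}(E)$ is prime, then $\mathcal{C}(L_{\mathbb{K}}(E))\cong \mathbb{K}$ (as $\mathbb{K}$-algebras), except if $E$ is a row-finite comet, in which case $\mathcal{C}(L_{\mathbb{K}}(E))\cong \mathbb{K}[x,x^{-1}]$.
   Context: A directed graph $E=(E^0,E^1,r,s)$ consists of disjoint sets $E^0$ (vertices) and $E^1$ (edges), of arbitrary cardinality, and maps $r,s:E^1\to E^0$ (range and source). A vertex $v$ is a sink if $s^{-1}(v)=\emptyset$, an infinite emitter if $s^{-1}(v)$ is infinite, and regular otherwise. $E$ is row-finite if it has no infinite emitters. A path is a vertex (length $0$) or a finite sequence $e_1\cdots e_n$ ($n\ge 1$) of edges with $r(e_i)=s(e_{i+1})$; its source is $s(e_1)$ and its range is $r(e_n)$. For a vertex $v$, $T(v)$ is the set of vertices $w$ such that there is a path from $v$ to $w$. A cycle is a nontrivial path $c=e_1\cdots e_n$ with $s(c)=r(c)$ and $s(e_i)\neq s(e_j)$ for $i\ne j$; $c^0$ is the set of its vertices. When counting cycles, cyclic rotations of a cycle are regarded as the same cycle. An infinite path is an infinite sequence of edges $f_0f_1\cdots$ with $r(f_i)=s(f_{i+1})$; it ends in the cycle $c$ if from some index on all its edges are edges of $c$. $E$ is a comet if it has exactly one cycle $c$, $T(v)\cap c^0\neq\emptyset$ for every $v\in E^0$, and every infinite path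 ends in the cycle $c$. The Leavitt path algebra $L_{\mathbb{K}}(E)$ is the associative (not necessarily unital) $\mathbb{K}$-algebra generated by $E^0\cup E^1\cup\{e^*: e\in E^1\}$ subject to: $vw=\delta_{v,w}v$ for $v,w\in E^0$; $s(e)e=e=e\,r(e)$ and $r(e)e^*=e^*=e^*s(e)$ for $e\in E^1$; $e^*e'=\delta_{e,e'}r(e)$ for $e,e'\in E^1$; and $v=\sum_{s(e)=v}ee^*$ for every regular vertex $v$. The centroid $\mathcal{C}(A)$ of a $\mathbb{K}$-algebra $A$ is the algebra (under composition) of all $\mathbb{K}$-linear maps $\tau:A\to A$ with $\tau(xy)=\tau(x)y=x\tau(y)$ for all $x,y\in A$. *)

theory Defs
  imports
    "HOL-Library.Poly_Mapping"
    "HOL-Library.FuncSet"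
    "HOL-Algebra.QuotRing"
    "HOL-Algebra.Module"
    "Graph_Theory.Arc_Walk"
begin

section \<open>Directed graphs\<close>

text \<open>
  A directed graph is a \<^typ>\<open>('v, 'e) pre_digraph\<close> satisfying \<^locale>\<open>wf_digraph\<close>:
  multiple arcs, loops and infinite vertex and arc sets are allowed. The source map is
  \<^const>\<open>tail\<close>, the range map is \<^const>\<open>head\<close>, and \<^term>\<open>out_arcs E v\<close> is the
  set of arcs with source \<^term>\<open>v\<close>.
\<close>

definition sink :: "('v, 'e) pre_digraph \<Rightarrow> 'v \<Rightarrow> bool" where
  "sink E v \<longleftrightarrow> v \<in> verts E \<and> out_arcs E v = {}"

definition infinite_emitter :: "('v, 'e) pre_digraph \<Rightarrow> 'v \<Rightarrow> bool" where
  "infinite_emitter E v \<longleftrightarrow> v \<in> verts E \<and> infinite (out_arcs E v)"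

definition regular_vertex :: "('v, 'e) pre_digraph \<Rightarrow> 'v \<Rightarrow> bool" where
  "regular_vertex E v \<longleftrightarrow> v \<in> verts E \<and> \<not> sink E v \<and> \<not> infinite_emitter E v"

definition row_finite :: "('v, 'e) pre_digraph \<Rightarrow> bool" where
  "row_finite E \<longleftrightarrow> (\<forall>v \<in> verts E. \<not> infinite_emitter E v)"

definition tree :: "('v, 'e) pre_digraph \<Rightarrow> 'v \<Rightarrow> 'v set" where
  "tree E v = {w. v \<rightarrow>\<^sup>*\<^bsub>E\<^esub> w}"

definition cycle_verts :: "('v, 'e) pre_digraph \<Rightarrow> 'e list \<Rightarrow> 'v set" where
  "cycle_verts E c = tail E ` set c"

definition infinite_path :: "('v, 'e) pre_digraph \<Rightarrow> (nat \<Rightarrow> 'e) \<Rightarrow> bool" where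
  "infinite_path E f \<longleftrightarrow> (\<forall>i. f i \<in> arcs E \<and> head E (f i) = tail E (f (Suc i)))"

definition ends_in_cycle :: "(nat \<Rightarrow> 'e) \<Rightarrow> 'e list \<Rightarrow> bool" where
  "ends_in_cycle f c \<longleftrightarrow> (\<exists>N. \<forall>n \<ge> N. f n \<in> set c)"

text \<open>
  \<^const>\<open>pre_digraph.cycle\<close> admits loops and fixes the starting point of a cycle, so
  uniqueness of the cycle is uniqueness up to rotation.
\<close>

definition comet :: "('v, 'e) pre_digraph \<Rightarrow> bool" where
  "comet E \<longleftrightarrow>
    (\<exists>c. pre_digraph.cycle E c \<and>
         (\<forall>c'. pre_digraph.cycle E c' \<longrightarrow> (\<exists>n. c' = rotate n c)) \<and>
         (\<forall>v \<in> verts E. tree E v \<inter> cycle_verts E c \<noteq> {}) \<and>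
         (\<forall>f. infinite_path E f \<longrightarrow> ends_in_cycle f c))"


section \<open>Associative algebras, not necessarily unital\<close>

text \<open>
  The ring and algebra records of HOL-Algebra carry a unit, which Leavitt path algebras of
  graphs with infinitely many vertices do not have.
\<close>

record ('k, 'a) nu_algebra = "'a partial_object" +
  nu_zero :: 'a
  nu_add :: "'a \<Rightarrow> 'a \<Rightarrow> 'a"
  nu_mult :: "'a \<Rightarrow> 'a \<Rightarrow> 'a"
  nu_scale :: "'k \<Rightarrow> 'a \<Rightarrow> 'a"

definition nu_ideal :: "('k, 'a) nu_algebra \<Rightarrow> 'a set \<Rightarrow> bool" where
  "nu_ideal A I \<longleftrightarrow>
    I \<subseteq> carrier A \<and> nu_zero A \<in> I \<and>
    (\<forall>x \<in> I. \<forall>y \<in> I. nu_add A x y \<in> I) \<and>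
    (\<forall>k. \<forall>x \<in> I. nu_scale A k x \<in> I) \<and>
    (\<forall>a \<in> carrier A. \<forall>x \<in> I. nu_mult A a x \<in> I \<and> nu_mult A x a \<in> I)"

definition nu_ideal_generated :: "('k, 'a) nu_algebra \<Rightarrow> 'a set \<Rightarrow> 'a set" where
  "nu_ideal_generated A S = \<Inter>{I. nu_ideal A I \<and> S \<subseteq> I}"

definition nu_coset :: "('k, 'a) nu_algebra \<Rightarrow> 'a set \<Rightarrow> 'a \<Rightarrow> 'a set" where
  "nu_coset A I a = {nu_add A a i | i. i \<in> I}"

text \<open>
  As in \<^const>\<open>rcoset_mult\<close>, the operations are unions over all representatives; for an ideal
  \<^term>\<open>I\<close> all members of such a union are the same coset.
\<close>

definition nu_quotient :: "('k, 'a) nu_algebra \<Rightarrow> 'a set \<Rightarrow> ('k, 'a set) nu_algebra" where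
  "nu_quotient A I =
    \<lparr> carrier = nu_coset A I ` carrier A,
      nu_zero = nu_coset A I (nu_zero A),
      nu_add = (\<lambda>X Y. \<Union>x \<in> X. \<Union>y \<in> Y. nu_coset A I (nu_add A x y)),
      nu_mult = (\<lambda>X Y. \<Union>x \<in> X. \<Union>y \<in> Y. nu_coset A I (nu_mult A x y)),
      nu_scale = (\<lambda>k X. \<Union>x \<in> X. nu_coset A I (nu_scale A k x)) \<rparr>"

text \<open>By convention, the zero algebra is not prime.\<close>

definition prime_algebra :: "('k, 'a) nu_algebra \<Rightarrow> bool" where
  "prime_algebra A \<longleftrightarrow>
    carrier A \<noteq> {nu_zero A} \<and>
    (\<forall>I J. nu_ideal A I \<longrightarrow> nu_ideal A J \<longrightarrow>
       (\<forall>x \<in> I. \<forall>y \<in> J. nu_mult A x y = nu_zero A) \<longrightarrow>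
       I = {nu_zero A} \<or> J = {nu_zero A})"

text \<open>
  The members of the centroid are extensional functions, so that equality of functions is
  equality on \<^term>\<open>carrier A\<close>.
\<close>

definition centroid :: "('k, 'a) nu_algebra \<Rightarrow> ('k, 'a \<Rightarrow> 'a) module" where
  "centroid A =
    \<lparr> carrier =
        {\<tau> \<in> carrier A \<rightarrow>\<^sub>E carrier A.
           (\<forall>x \<in> carrier A. \<forall>y \<in> carrier A. \<tau> (nu_add A x y) = nu_add A (\<tau> x) (\<tau> y)) \<and>
           (\<forall>k. \<forall>x \<in> carrier A. \<tau> (nu_scale A k x) = nu_scale A k (\<tau> x)) \<and>
           (\<forall>x \<in> carrier A. \<forall>y \<in> carrier A.
              \<tau> (nu_mult A x y) = nu_mult A (\<tau> x) y \<and>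
              \<tau> (nu_mult A x y) = nu_mult A x (\<tau> y))},
      mult = compose (carrier A),
      one = (\<lambda>x \<in> carrier A. x),
      zero = (\<lambda>x \<in> carrier A. nu_zero A),
      add = (\<lambda>\<sigma> \<tau>. \<lambda>x \<in> carrier A. nu_add A (\<sigma> x) (\<tau> x)),
      smult = (\<lambda>k \<tau>. \<lambda>x \<in> carrier A. nu_scale A k (\<tau> x)) \<rparr>"


section \<open>The free algebra on a set of generators\<close>

datatype 'g free_word = Word "'g list"

instantiation free_word :: (type) monoid_add
begin

definition zero_free_word where
  "0 = Word []"

fun plus_free_word where
  "Word u + Word w = Word (u @ w)"

instance
proof
  fix a b c :: "'a free_word"
  show "a + b + c = a + (b + c)"
    by (cases a; cases b; cases c) simp
  show "0 + a = a" "a + 0 = a"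
    by (cases a; simp add: zero_free_word_def)+
qed

end

text \<open>
  With the free monoid as index type, \<^typ>\<open>'g free_word \<Rightarrow>\<^sub>0 'k\<close> with its convolution product
  is the free unital algebra on the type \<^typ>\<open>'g\<close>. Admitting only nonempty words, with letters
  from \<^term>\<open>X\<close>, gives the free associative non-unital algebra on \<^term>\<open>X\<close>.
\<close>

definition free_algebra :: "'g set \<Rightarrow> ('k :: field, 'g free_word \<Rightarrow>\<^sub>0 'k) nu_algebra" where
  "free_algebra X =
    \<lparr> carrier = {p. Poly_Mapping.keys p \<subseteq> {Word w | w. w \<noteq> [] \<and> set w \<subseteq> X}},
      nu_zero = 0,
      nu_add = (+),
      nu_mult = (*),
      nu_scale = (\<lambda>k. Poly_Mapping.map ((*) k)) \<rparr>"


section \<open>Leavitt path algebras\<close>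

datatype ('v, 'e) generator = Vertex 'v | Edge 'e | Ghost 'e

definition generators :: "('v, 'e) pre_digraph \<Rightarrow> ('v, 'e) generator set" where
  "generators E = Vertex ` verts E \<union> Edge ` arcs E \<union> Ghost ` arcs E"

definition gen :: "'g \<Rightarrow> ('g free_word \<Rightarrow>\<^sub>0 'k :: field)" where
  "gen g = Poly_Mapping.single (Word [g]) 1"

definition leavitt_relators ::
    "('v, 'e) pre_digraph \<Rightarrow> (('v, 'e) generator free_word \<Rightarrow>\<^sub>0 'k :: field) set" where
  "leavitt_relators E =
     {gen (Vertex v) * gen (Vertex w) - (if v = w then gen (Vertex v) else 0) | v w.
        v \<in> verts E \<and> w \<in> verts E} \<union>
     {gen (Vertex (tail E e)) * gen (Edge e) - gen (Edge e) | e. e \<in> arcs E} \<union>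
     {gen (Edge e) * gen (Vertex (head E e)) - gen (Edge e) | e. e \<in> arcs E} \<union>
     {gen (Vertex (head E e)) * gen (Ghost e) - gen (Ghost e) | e. e \<in> arcs E} \<union>
     {gen (Ghost e) * gen (Vertex (tail E e)) - gen (Ghost e) | e. e \<in> arcs E} \<union>
     {gen (Ghost e) * gen (Edge e') - (if e = e' then gen (Vertex (head E e)) else 0) | e e'.
        e \<in> arcs E \<and> e' \<in> arcs E} \<union>
     {gen (Vertex v) - (\<Sum>e \<in> out_arcs E v. gen (Edge e) * gen (Ghost e)) | v.
        regular_vertex E v}"

text \<open>The first argument only determines the coefficient field.\<close>

definition leavitt_path_algebra ::
    "'k :: field itself \<Rightarrow> ('v, 'e) pre_digraph \<Rightarrow>
     ('k, (('v, 'e) generator free_word \<Rightarrow>\<^sub>0 'k) set) nu_algebra" where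
  "leavitt_path_algebra K E =
     nu_quotient (free_algebra (generators E))
       (nu_ideal_generated (free_algebra (generators E)) (leavitt_relators E))"


section \<open>The two unital algebras and isomorphism\<close>

definition field_algebra :: "'k :: field itself \<Rightarrow> ('k, 'k) module" where
  "field_algebra K =
    \<lparr> carrier = UNIV, mult = (*), one = 1, zero = 0, add = (+), smult = (*) \<rparr>"

text \<open>
  Laurent polynomials are the finitely supported families of coefficients indexed by the
  exponents in \<^typ>\<open>int\<close>, with convolution as product.
\<close>

definition laurent_polynomial_algebra :: "'k :: field itself \<Rightarrow> ('k, int \<Rightarrow>\<^sub>0 'k) module" where
  "laurent_polynomial_algebra K =
    \<lparr> carrier = UNIV, mult = (*), one = 1, zero = 0, add = (+),
      smult = (\<lambda>k. Poly_Mapping.map ((*) k)) \<rparr>"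

definition algebra_isomorphic :: "('k, 'a) module \<Rightarrow> ('k, 'b) module \<Rightarrow> bool" where
  "algebra_isomorphic A B \<longleftrightarrow>
    (\<exists>h \<in> ring_iso A B. \<forall>k. \<forall>x \<in> carrier A. h (k \<odot>\<^bsub>A\<^esub> x) = k \<odot>\<^bsub>B\<^esub> h x)"

end

theory Submission
  imports Defs
begin

text \<open>
  An element \<open>\<tau>\<close> of the centroid of a prime algebra vanishes as soon as it kills one nonzero
  element, because its kernel and its image are ideals with product zero. Hence \<open>\<tau>\<close> is determined
  by the value \<open>\<tau>(v)\<close> at any vertex \<open>v\<close>, and it is a scalar if some \<open>\<tau>(v)\<close> is a multiple
  of \<open>v\<close>. Now \<open>\<tau>(v)\<close> is a finite combination of elements \<open>pq\<^sup>*\<close>, and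
  \<open>\<nu>\<^sup>*\<tau>(v)\<nu> = \<tau>(w)\<close> for every path \<open>\<nu>\<close> from \<open>v\<close> to \<open>w\<close>. If \<open>\<nu>\<close> is long and its last edge
  does not occur among the many edges before it, then \<open>\<nu>\<^sup>*pq\<^sup>*\<nu>\<close> is \<open>0\<close> or \<open>w\<close>, so \<open>\<tau>\<close> is a
  scalar. Such paths exist if there is a cycle with an exit or an infinite path with pairwise
  distinct edges; sinks and infinite emitters are dealt with in the same way. If none of these
  exist, then \<open>E\<close> is a row-finite comet, the cycle being unique because primeness makes any two
  vertices have a common descendant.

  For a row-finite comet with cycle \<open>c\<close> through \<open>v\<close>, the element \<open>\<tau>(v)\<close> lies in
  \<open>v L v = K[c, c\<^sup>*]\<close>. Conversely, \<open>c\<close> and \<open>c\<^sup>*\<close> extend to central families \<open>(z\<^sub>u)\<close>, and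
  thereby to elements of the centroid, via \<open>z\<^sub>u = \<Sum> e z e\<^sup>*\<close> (sum over the edges \<open>e\<close> leaving \<open>u\<close>,
  with \<open>z\<close> taken at the range of \<open>e\<close>); this recursion is well-founded since every infinite path
  ends in \<open>c\<close>.
\<close>

section \<open>Finitely supported families\<close>

text \<open>Two obstacles shape the development. The algebra is a set of cosets without a unit, so
  neither rewriting in a ring type nor evaluation of \<open>\<tau>\<close> at 1 is available. All
  computations therefore take place in an arbitrary ring with elements \<open>G g\<close> that
  satisfy the relations, where vertices and finite sums of vertices replace the unit; the true
  algebra is identified with such a copy only at the end.

  The relations alone do not exclude a collapse of the algebra. What is used beyond them is little:
  for each vertex and each degree, one functional that detects the length of closed paths at that
  vertex. These functionals come from a graded action on the states of a branching system, so that a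
  basis of the algebra never has to be determined.\<close>

lemma poly_mapping_sum_singles: "(\<Sum>k\<in>Poly_Mapping.keys p. Poly_Mapping.single k (Poly_Mapping.lookup
    p k)) = p"
  by (rule poly_mapping_eqI) (auto simp: lookup_sum lookup_single when_def in_keys_iff)

lemma poly_mapping_additive_induct [case_names zero add single]:
  fixes P :: "('a \<Rightarrow>\<^sub>0 'b::comm_monoid_add) \<Rightarrow> bool"
  assumes "P 0" "\<And>p q. \<lbrakk>P p; P q\<rbrakk> \<Longrightarrow> P (p + q)" "\<And>k a. P (Poly_Mapping.single k a)"
  shows "P p"
proof -
  have "P (\<Sum>k\<in>K. Poly_Mapping.single k (Poly_Mapping.lookup p k))" for K
    by (induction K rule: infinite_finite_induct) (auto simp: assms)
  then show ?thesis
    by (metis poly_mapping_sum_singles)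
qed

text \<open>Laurent polynomials are generated as an algebra by \<open>x\<close> and its inverse. A
  property stable under the operations, such as being the value of a centroid element, thus needs
  checking only for the unit, the cycle and its ghost.\<close>

lemma single_power_induct:
  fixes P :: "(int \<Rightarrow>\<^sub>0 'a::field) \<Rightarrow> bool"
  assumes "P (Poly_Mapping.single 0 1)" "P (Poly_Mapping.single 1 1)"
      "P (Poly_Mapping.single (-1) 1)"
    and add: "\<And>f g. \<lbrakk>P f; P g\<rbrakk> \<Longrightarrow> P (f + g)" and mult: "\<And>f g. \<lbrakk>P f; P g\<rbrakk> \<Longrightarrow> P (f * g)"
    and scale: "\<And>k f. P f \<Longrightarrow> P (Poly_Mapping.map ((*) k) f)"
  shows "P f"
proof -
  have power: "P (Poly_Mapping.single n 1)" for n :: int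
  proof (induction n rule: int_induct[where k = 0])
    case (step1 n)
    have "Poly_Mapping.single (n + 1) 1 = Poly_Mapping.single n 1 * (Poly_Mapping.single 1 1 :: int
        \<Rightarrow>\<^sub>0 'a)"
      by (simp add: mult_single)
    then show ?case
      using assms(2) step1 mult by simp
  next
    case (step2 n)
    have "Poly_Mapping.single (n - 1) 1 = Poly_Mapping.single n 1 * (Poly_Mapping.single (-1) 1 ::
        int \<Rightarrow>\<^sub>0 'a)"
      by (simp add: mult_single)
    then show ?case
      using assms(3) step2 mult by simp
  qed (rule assms(1))
  have single: "P (Poly_Mapping.single n a)" for n a
    using scale[OF power[of n], of a] by simp
  from single[of 0 0] single show ?thesis
    by (induction f rule: poly_mapping_additive_induct) (auto intro: add)
qed

section \<open>The Leavitt relations in a ring\<close>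

text \<open>The class \<open>ring\<close> has no unit, and the algebra is only the subset
  \<open>A\<close> of the ring. Any ring containing a copy of the algebra is therefore admissible,
  in particular a ring of operators.\<close>

locale leavitt_relations = wf_digraph E + vector_space sc
  for E :: "('v, 'e) pre_digraph" and sc :: "'k :: field \<Rightarrow> 'r :: ring \<Rightarrow> 'r" +
  fixes G :: "('v, 'e) generator \<Rightarrow> 'r"
  assumes scale_mult_left: "sc k x * y = sc k (x * y)"
    and scale_mult_right: "x * sc k y = sc k (x * y)"
    and vertex_mult_vertex:
      "\<lbrakk>v \<in> verts E; w \<in> verts E\<rbrakk> \<Longrightarrow> G (Vertex v) * G (Vertex w) = (if v
          = w then G (Vertex v) else 0)"
    and tail_mult_edge: "e \<in> arcs E \<Longrightarrow> G (Vertex (tail E e)) * G (Edge e) = G (Edge e)"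
    and edge_mult_head: "e \<in> arcs E \<Longrightarrow> G (Edge e) * G (Vertex (head E e)) = G (Edge e)"
    and head_mult_ghost: "e \<in> arcs E \<Longrightarrow> G (Vertex (head E e)) * G (Ghost e) = G (Ghost e)"
    and ghost_mult_tail: "e \<in> arcs E \<Longrightarrow> G (Ghost e) * G (Vertex (tail E e)) = G (Ghost e)"
    and ghost_mult_edge:
      "\<lbrakk>e \<in> arcs E; e' \<in> arcs E\<rbrakk> \<Longrightarrow>
        G (Ghost e) * G (Edge e') = (if e = e' then G (Vertex (head E e)) else 0)"
    and vertex_eq_sum:
      "regular_vertex E v \<Longrightarrow> G (Vertex v) = (\<Sum>e\<in>out_arcs E v. G (Edge e) * G (Ghost e))"
begin

section \<open>Products of paths and ghost paths\<close>

abbreviation V :: "'v \<Rightarrow> 'r" where "V v \<equiv> G (Vertex v)"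
abbreviation Ed :: "'e \<Rightarrow> 'r" where "Ed e \<equiv> G (Edge e)"
abbreviation Gh :: "'e \<Rightarrow> 'r" where "Gh e \<equiv> G (Ghost e)"

text \<open>Without a unit the empty word has no meaning; 0 is a dummy value, and \<open>A\<close>
  admits nonempty words only.\<close>

fun word :: "('v, 'e) generator list \<Rightarrow> 'r" where
  "word [] = 0"
| "word [g] = G g"
| "word (g # h # w) = G g * word (h # w)"

definition A :: "'r set" where
  "A = span (word ` {w. w \<noteq> [] \<and> set w \<subseteq> generators E})"

text \<open>An empty edge list does not know its vertex, so the start is an argument. The recursion
  closes with a vertex element, so that \<open>pth v [e]\<close> is
  \<open>Ed e * V (head E e)\<close>; \<open>gst\<close> is the ghost of \<open>pth\<close>, with
  the factors in reverse order.\<close>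

primrec pth :: "'v \<Rightarrow> 'e list \<Rightarrow> 'r" where
  "pth v [] = V v"
| "pth v (e # p) = Ed e * pth (head E e) p"

primrec gst :: "'v \<Rightarrow> 'e list \<Rightarrow> 'r" where
  "gst v [] = V v"
| "gst v (e # p) = gst (head E e) p * Gh e"

lemma V_idem: "v \<in> verts E \<Longrightarrow> V v * V v = V v"
  by (simp add: vertex_mult_vertex)

lemma V_mult_pth: "awalk v p w \<Longrightarrow> V v * pth v p = pth v p"
  by (cases p) (auto simp: awalk_simps V_idem tail_mult_edge simp flip: mult.assoc)

lemma gst_mult_V: "awalk v p w \<Longrightarrow> gst v p * V v = gst v p"
  by (cases p) (auto simp: awalk_simps V_idem ghost_mult_tail mult.assoc)

lemma pth_mult_V: "awalk v p w \<Longrightarrow> pth v p * V w = pth v p"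
  by (induction p arbitrary: v) (auto simp: awalk_simps V_idem mult.assoc)

lemma V_mult_gst: "awalk v p w \<Longrightarrow> V w * gst v p = gst v p"
  by (induction p arbitrary: v) (auto simp: awalk_simps V_idem simp flip: mult.assoc)

lemma V_mult_pth_other:
  assumes "awalk v p w" "u \<in> verts E" "u \<noteq> v"
  shows "V u * pth v p = 0"
proof -
  have "V u * pth v p = V u * V v * pth v p"
    by (metis V_mult_pth assms(1) mult.assoc)
  then show ?thesis
    using assms by (auto simp: vertex_mult_vertex)
qed

lemma gst_mult_V_other:
  assumes "awalk v p w" "u \<in> verts E" "u \<noteq> v"
  shows "gst v p * V u = 0"
proof -
  have "gst v p * V u = gst v p * (V v * V u)"
    by (metis gst_mult_V assms(1) mult.assoc)
  then show ?thesis
    using assms by (auto simp: vertex_mult_vertex)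
qed

lemma pth_append: "\<lbrakk>awalk v p w; awalk w q x\<rbrakk> \<Longrightarrow> pth v (p @ q) = pth v p * pth w q"
  by (induction p arbitrary: v) (auto simp: awalk_simps V_mult_pth mult.assoc)

lemma gst_append: "\<lbrakk>awalk v p w; awalk w q x\<rbrakk> \<Longrightarrow> gst v (p @ q) = gst w q * gst v p"
  by (induction p arbitrary: v) (auto simp: awalk_simps gst_mult_V mult.assoc)

lemma gst_mult_pth: "awalk v p w \<Longrightarrow> gst v p * pth v p = V w"
proof (induction p arbitrary: v)
  case (Cons e p)
  have "gst v (e # p) * pth v (e # p) = gst (head E e) p * (Gh e * Ed e) * pth (head E e) p"
    by (simp add: mult.assoc)
  also have "\<dots> = gst (head E e) p * pth (head E e) p"
    using Cons.prems by (auto simp: awalk_simps ghost_mult_edge gst_mult_V)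
  finally show ?case
    using Cons by (auto simp: awalk_simps)
qed (auto simp: awalk_simps V_idem)

lemma gst_mult_pth_append:
  assumes "awalk v p w" "awalk w q x"
  shows "gst v p * pth v (p @ q) = pth w q" "gst v (p @ q) * pth v p = gst w q"
proof -
  have "gst v p * pth v (p @ q) = gst v p * pth v p * pth w q"
    using assms by (simp add: pth_append mult.assoc)
  then show "gst v p * pth v (p @ q) = pth w q"
    using assms by (simp add: gst_mult_pth V_mult_pth)
  have "gst v (p @ q) * pth v p = gst w q * (gst v p * pth v p)"
    using assms by (simp add: gst_append mult.assoc)
  then show "gst v (p @ q) * pth v p = gst w q"
    using assms by (simp add: gst_mult_pth gst_mult_V)
qed

text \<open>At the first edge where the two walks part, \<open>Gh e * Ed f\<close> with
  \<open>e \<noteq> f\<close> appears in the middle of the product.\<close>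

lemma gst_mult_pth_eq_0:
  assumes "awalk v p w" "awalk v q x" "\<nexists>r. q = p @ r" "\<nexists>r. p = q @ r"
  shows "gst v p * pth v q = 0"
  using assms
proof (induction p arbitrary: v q)
  case (Cons e p)
  then obtain f q' where q: "q = f # q'"
    by (cases q) auto
  have *: "gst v (e # p) * pth v q = gst (head E e) p * (Gh e * Ed f) * pth (head E f) q'"
    by (simp add: mult.assoc q)
  show ?case
  proof (cases "e = f")
    case True
    then have "gst (head E e) p * pth (head E e) q' = 0"
      using Cons.prems by (intro Cons.IH) (auto simp: awalk_simps q)
    then show ?thesis
      using * True Cons.prems by (auto simp: q awalk_simps ghost_mult_edge gst_mult_V)
  next
    case False
    then show ?thesis
      using * Cons.prems by (auto simp: q awalk_simps ghost_mult_edge)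
  qed
qed auto

section \<open>The spanning monomials\<close>

definition mon :: "'v \<Rightarrow> 'e list \<Rightarrow> 'v \<Rightarrow> 'e list \<Rightarrow> 'r" where
  "mon u p v q = pth u p * gst v q"

definition monomials :: "'r set" where
  "monomials = {mon u p v q | u p v q w. awalk u p w \<and> awalk v q w}"

text \<open>A generator only meets the left end of \<open>p q\<^sup>*\<close>: an edge lengthens
  \<open>p\<close>, and a ghost edge cancels the first edge of \<open>p\<close> or, if
  \<open>p\<close> is empty, lengthens \<open>q\<close> at its far end. This is the whole normal
  form argument, since words are built by multiplication from the left.\<close>

lemma generator_mult_monomial:
  assumes g: "g \<in> generators E" and m: "m \<in> monomials"
  shows "G g * m \<in> insert 0 monomials"
proof -
  obtain u p v q w where m_eq: "m = mon u p v q" and p: "awalk u p w" and q: "awalk v q w"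
    using m by (auto simp: monomials_def)
  have in_verts: "u \<in> verts E" "v \<in> verts E" "w \<in> verts E"
    using p q by auto
  consider a where "g = Vertex a" "a \<in> verts E" | e where "g = Edge e" "e \<in> arcs E"
    | e where "g = Ghost e" "e \<in> arcs E"
    using g by (auto simp: generators_def)
  then show ?thesis
  proof cases
    case 1
    have "V a * m = (if a = u then m else 0)"
      using 1 p by (simp add: m_eq mon_def V_mult_pth V_mult_pth_other flip: mult.assoc)
    then show ?thesis
      using 1 m by auto
  next
    case 2
    have "Ed e * m = Ed e * (V (head E e) * pth u p) * gst v q"
      using 2 by (simp add: m_eq mon_def edge_mult_head flip: mult.assoc)
    also have "V (head E e) * pth u p = (if head E e = u then pth u p else 0)"
      using 2 p by (auto simp: V_mult_pth V_mult_pth_other)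
    also have "Ed e * (if head E e = u then pth u p else 0) * gst v q =
        (if head E e = u then mon (tail E e) (e # p) v q else 0)"
      by (auto simp: mon_def mult.assoc)
    finally show ?thesis
      using 2 p q by (auto simp: monomials_def awalk_simps)
  next
    case 3
    show ?thesis
    proof (cases p)
      case Nil
      then have "u = w" using p by (simp add: awalk_simps)
      have "m = gst v q"
        using Nil q \<open>u = w\<close> by (simp add: m_eq mon_def V_mult_gst)
      then have "Gh e * m = Gh e * (V (tail E e) * gst v q)"
        using 3 by (simp add: ghost_mult_tail flip: mult.assoc)
      also have "\<dots> = (if tail E e = w then V (head E e) * (Gh e * gst v q) else 0)"
      proof -
        have "V (tail E e) * gst v q = V (tail E e) * V w * gst v q"
          using q by (simp add: V_mult_gst mult.assoc)
        then have "V (tail E e) * gst v q = (if tail E e = w then gst v q else 0)"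
          using 3 q in_verts by (auto simp: V_mult_gst vertex_mult_vertex)
        moreover have "V (head E e) * (Gh e * gst v q) = Gh e * gst v q"
          using 3 by (simp add: head_mult_ghost flip: mult.assoc)
        ultimately show ?thesis
          by auto
      qed
      also have "\<dots> = (if tail E e = w then mon (head E e) [] v (q @ [e]) else 0)"
      proof -
        have "gst v (q @ [e]) = V (head E e) * (Gh e * gst v q)" if "tail E e = w"
          using gst_append[OF q, of "[e]"] 3 that arc_implies_awalk[of e]
          by (auto simp: mult.assoc)
        moreover have "V (head E e) * gst v (q @ [e]) = gst v (q @ [e])" if "tail E e = w"
          using that 3 q by (intro V_mult_gst) (auto intro: awalk_appendI arc_implies_awalk)
        ultimately show ?thesis
          using 3 by (auto simp: mon_def)
      qed
      finally show ?thesis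
        using 3 q by (auto simp: monomials_def awalk_simps dest!: arc_implies_awalk intro!: exI
            awalk_appendI)
    next
      case (Cons f p')
      then have f: "f \<in> arcs E" "tail E f = u" "awalk (head E f) p' w"
        using p by (auto simp: awalk_simps)
      have "Gh e * m = (Gh e * Ed f) * pth (head E f) p' * gst v q"
        by (simp add: m_eq mon_def Cons mult.assoc)
      also have "\<dots> = (if e = f then mon (head E f) p' v q else 0)"
        using 3 f by (auto simp: ghost_mult_edge V_mult_pth mon_def)
      finally show ?thesis
        using 3 f q by (auto simp: monomials_def)
    qed
  qed
qed

lemma generator_monomial: "g \<in> generators E \<Longrightarrow> G g \<in> insert 0 monomials"
proof -
  assume g: "g \<in> generators E"
  have V: "V v \<in> monomials" if "v \<in> verts E" for v
    using that V_idem[OF that] by (force simp: monomials_def mon_def awalk_simps intro!: exI[of _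
        "[]"] exI[of _ v])
  consider a where "g = Vertex a" "a \<in> verts E" | e where "g = Edge e" "e \<in> arcs E"
    | e where "g = Ghost e" "e \<in> arcs E"
    using g by (auto simp: generators_def)
  then show ?thesis
  proof cases
    case 1
    then show ?thesis using V by simp
  next
    case 2
    then show ?thesis
      using generator_mult_monomial[OF g V[of "head E e"]] by (simp add: edge_mult_head)
  next
    case 3
    then show ?thesis
      using generator_mult_monomial[OF g V[of "tail E e"]] by (simp add: ghost_mult_tail)
  qed
qed

lemma word_monomial: "\<lbrakk>w \<noteq> []; set w \<subseteq> generators E\<rbrakk> \<Longrightarrow> word w \<in> insert 0 monomials"
proof (induction w rule: word.induct)
  case (3 g h w)
  then have "word (h # w) \<in> insert 0 monomials" and g: "g \<in> generators E"
    by auto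
  then show ?case
    using generator_mult_monomial[OF g] by auto
qed (use generator_monomial in auto)

lemma word_append: "\<lbrakk>u \<noteq> []; w \<noteq> []\<rbrakk> \<Longrightarrow> word (u @ w) = word u * word w"
  by (induction u rule: word.induct) (auto simp: mult.assoc neq_Nil_conv)

lemma word_in_A: "\<lbrakk>w \<noteq> []; set w \<subseteq> generators E\<rbrakk> \<Longrightarrow> word w \<in> A"
  unfolding A_def by (intro span_base) auto

lemma A_mult: assumes "x \<in> A" "y \<in> A" shows "x * y \<in> A"
proof -
  have *: "word u * y \<in> A" if "u \<noteq> []" "set u \<subseteq> generators E" for u
    using assms(2) unfolding A_def
  proof (induction rule: span_induct_alt)
    case (step c x y)
    then obtain w where w: "x = word w" "w \<noteq> []" "set w \<subseteq> generators E"
      by auto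
    then have "word u * x \<in> A"
      using that word_in_A[of "u @ w"] by (simp add: word_append)
    then show ?case
      using step.IH by (simp add: distrib_left scale_mult_right A_def span_add span_scale)
  qed (auto simp: span_zero)
  show ?thesis
    using assms(1) unfolding A_def
  proof (induction rule: span_induct_alt)
    case (step c x z)
    then show ?case
      using * by (auto simp: distrib_right scale_mult_left A_def intro!: span_add span_scale)
  qed (auto simp: span_zero)
qed

lemma A_0: "0 \<in> A" and A_add: "\<lbrakk>x \<in> A; y \<in> A\<rbrakk> \<Longrightarrow> x + y \<in> A" and A_scale: "x \<in> A \<Longrightarrow> sc k x \<in> A"
  and A_diff: "\<lbrakk>x \<in> A; y \<in> A\<rbrakk> \<Longrightarrow> x - y \<in> A"
  and A_sum: "(\<And>i. i \<in> I \<Longrightarrow> f i \<in> A) \<Longrightarrow> sum f I \<in> A"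
  unfolding A_def by (auto simp: span_zero span_add span_scale span_diff span_sum)

lemma G_in_A: "g \<in> generators E \<Longrightarrow> G g \<in> A"
  using word_in_A[of "[g]"] by simp

lemma V_in_A: "v \<in> verts E \<Longrightarrow> V v \<in> A" and Ed_in_A: "e \<in> arcs E \<Longrightarrow> Ed e \<in> A"
  and Gh_in_A: "e \<in> arcs E \<Longrightarrow> Gh e \<in> A"
  by (auto intro!: G_in_A simp: generators_def)

lemma pth_in_A: "awalk v p w \<Longrightarrow> pth v p \<in> A"
  by (induction p arbitrary: v) (auto simp: awalk_simps V_in_A Ed_in_A A_mult)

lemma gst_in_A: "awalk v p w \<Longrightarrow> gst v p \<in> A"
  by (induction p arbitrary: v) (auto simp: awalk_simps V_in_A Gh_in_A A_mult)

text \<open>Only spanning is claimed: the relation at a regular vertex makes the monomials linearly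
  dependent in general.\<close>

lemma A_eq_span_monomials: "A = span monomials"
proof
  show "A \<subseteq> span monomials"
    unfolding A_def
    by (rule span_minimal) (use word_monomial span_base span_zero in \<open>fastforce+\<close>)
  show "span monomials \<subseteq> A"
  proof (rule span_minimal)
    show "monomials \<subseteq> A"
      by (auto simp: monomials_def mon_def pth_in_A gst_in_A A_mult)
    show "subspace A"
      by (simp add: A_def)
  qed
qed

section \<open>Elements of the centroid\<close>

definition alg :: "('k, 'r) nu_algebra" where
  "alg = \<lparr>carrier = A, nu_zero = 0, nu_add = (+), nu_mult = (*), nu_scale = sc\<rparr>"

definition cent :: "('r \<Rightarrow> 'r) \<Rightarrow> bool" where
  "cent \<tau> \<longleftrightarrow> \<tau> \<in> A \<rightarrow>\<^sub>E A \<and> (\<forall>x\<in>A. \<forall>y\<in>A. \<tau> (x + y) = \<tau> x + \<tau> y) \<and>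
     (\<forall>k. \<forall>x\<in>A. \<tau> (sc k x) = sc k (\<tau> x)) \<and>
     (\<forall>x\<in>A. \<forall>y\<in>A. \<tau> (x * y) = \<tau> x * y \<and> \<tau> (x * y) = x * \<tau> y)"

lemma carrier_centroid_alg: "carrier (centroid alg) = Collect cent"
  by (simp only: centroid_def alg_def cent_def[abs_def] partial_object.simps nu_algebra.simps)

lemma centI:
  assumes "\<tau> \<in> extensional A" "\<And>x. x \<in> A \<Longrightarrow> \<tau> x \<in> A"
    and "\<And>x y. \<lbrakk>x \<in> A; y \<in> A\<rbrakk> \<Longrightarrow> \<tau> (x + y) = \<tau> x + \<tau> y" "\<And>k x. x \<in> A \<Longrightarrow> \<tau> (sc k x) = sc k (\<tau> x)"
    and "\<And>x y. \<lbrakk>x \<in> A; y \<in> A\<rbrakk> \<Longrightarrow> \<tau> (x * y) = \<tau> x * y" "\<And>x y. \<lbrakk>x \<in> A; y \<in> A\<rbrakk> \<Longrightarrow> \<tau> (x * y) = x * \<tau> y"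
  shows "cent \<tau>"
  using assms unfolding cent_def PiE_def Pi_def by blast

lemma cent_in: "\<lbrakk>cent \<tau>; x \<in> A\<rbrakk> \<Longrightarrow> \<tau> x \<in> A"
  and cent_add: "\<lbrakk>cent \<tau>; x \<in> A; y \<in> A\<rbrakk> \<Longrightarrow> \<tau> (x + y) = \<tau> x + \<tau> y"
  and cent_scale: "\<lbrakk>cent \<tau>; x \<in> A\<rbrakk> \<Longrightarrow> \<tau> (sc k x) = sc k (\<tau> x)"
  by (auto simp: cent_def)

lemma cent_mult_left: "\<lbrakk>cent \<tau>; x \<in> A; y \<in> A\<rbrakk> \<Longrightarrow> \<tau> (x * y) = \<tau> x * y"
  and cent_mult_right: "\<lbrakk>cent \<tau>; x \<in> A; y \<in> A\<rbrakk> \<Longrightarrow> \<tau> (x * y) = x * \<tau> y"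
  unfolding cent_def by blast+

lemma cent_extensional: "cent \<tau> \<Longrightarrow> \<tau> \<in> extensional A"
  by (auto simp: cent_def PiE_def)

lemma cent_0: "cent \<tau> \<Longrightarrow> \<tau> 0 = 0"
  using cent_add[of \<tau> 0 0] A_0 by simp

lemma cent_diff:
  assumes "cent \<sigma>" "cent \<tau>"
  shows "cent (\<lambda>x\<in>A. \<sigma> x - \<tau> x)"
proof (rule centI; simp add: assms A_add A_diff A_scale A_mult cent_in cent_add cent_scale
    scale_right_diff_distrib)
  fix x y assume xy: "x \<in> A" "y \<in> A"
  show "\<sigma> (x * y) - \<tau> (x * y) = (\<sigma> x - \<tau> x) * y"
    by (simp only: cent_mult_left[OF assms(1) xy] cent_mult_left[OF assms(2) xy] left_diff_distrib)
  show "\<sigma> (x * y) - \<tau> (x * y) = x * (\<sigma> y - \<tau> y)"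
    by (simp only: cent_mult_right[OF assms(1) xy] cent_mult_right[OF assms(2) xy]
        right_diff_distrib)
qed

lemma cent_scalar: "cent (\<lambda>x\<in>A. sc k x)"
  by (auto simp: cent_def A_add A_scale A_mult scale_right_distrib scale_mult_left
      scale_mult_right mult.commute)

text \<open>Factors can be moved into the argument of \<open>\<tau>\<close> from both sides, where
  \<open>gst v p * pth v p\<close> collapses to the range. In this way values of
  \<open>\<tau>\<close> travel along paths.\<close>

lemma cent_conjugate:
  assumes \<tau>: "cent \<tau>" and p: "awalk v p w"
  shows "gst v p * \<tau> (V v) * pth v p = \<tau> (V w)"
proof -
  have v: "v \<in> verts E"
    using p by auto
  have "gst v p * \<tau> (V v) * pth v p = \<tau> (gst v p * V v) * pth v p"
    using \<tau> gst_in_A[OF p] V_in_A[OF v] by (simp only: cent_mult_right)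
  also have "\<dots> = \<tau> (gst v p * pth v p)"
    using \<tau> gst_in_A[OF p] pth_in_A[OF p] p by (simp add: gst_mult_V cent_mult_left)
  finally show ?thesis
    using p by (simp add: gst_mult_pth)
qed

lemma cent_corner:
  assumes "cent \<tau>" "v \<in> verts E"
  shows "V v * \<tau> (V v) * V v = \<tau> (V v)"
  using cent_conjugate[of \<tau> v "[]" v] assms by (simp add: awalk_simps)

lemma V_mon_V:
  assumes "awalk u p z" "awalk v q z" "a \<in> verts E" "b \<in> verts E"
  shows "V a * mon u p v q * V b = (if a = u \<and> b = v then mon u p v q else 0)"
proof -
  have "V a * mon u p v q * V b = (V a * pth u p) * (gst v q * V b)"
    by (simp add: mon_def mult.assoc)
  then show ?thesis
    using assms by (auto simp: V_mult_pth V_mult_pth_other gst_mult_V gst_mult_V_other mon_def)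
qed

text \<open>A monomial survives multiplication by \<open>V a\<close> and \<open>V b\<close> only if
  it starts at \<open>a\<close> and ends at \<open>b\<close>. Finiteness of \<open>P\<close>, which
  holds because a span consists of finite combinations, later provides a bound for the lengths of
  all paths involved.\<close>

lemma corner_span:
  assumes "x \<in> A" and verts: "a \<in> verts E" "b \<in> verts E"
  obtains P where "finite P" "\<forall>(p, q) \<in> P. \<exists>z. awalk a p z \<and> awalk b q z"
    "V a * x * V b \<in> span ((\<lambda>(p, q). mon a p b q) ` P)"
proof -
  have "x \<in> span monomials"
    using assms by (simp add: A_eq_span_monomials)
  then have "\<exists>P. finite P \<and> (\<forall>(p, q) \<in> P. \<exists>z. awalk a p z \<and> awalk b q z) \<and>
    V a * x * V b \<in> span ((\<lambda>(p, q). mon a p b q) ` P)"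
  proof (induction rule: span_induct_alt)
    case base
    then show ?case
      by (intro exI[of _ "{}"]) auto
  next
    case (step c m y)
    then obtain P where P: "finite P" "\<forall>(p, q) \<in> P. \<exists>z. awalk a p z \<and> awalk b q z"
      "V a * y * V b \<in> span ((\<lambda>(p, q). mon a p b q) ` P)"
      by auto
    obtain u p v q z where m: "m = mon u p v q" "awalk u p z" "awalk v q z"
      using step by (auto simp: monomials_def)
    have eq: "V a * (sc c m + y) * V b = sc c (V a * m * V b) + V a * y * V b"
      by (simp add: distrib_left distrib_right scale_mult_left scale_mult_right)
    show ?case
    proof (cases "a = u \<and> b = v")
      case True
      show ?thesis
      proof (intro exI conjI)
        show "V a * (sc c m + y) * V b \<in> span ((\<lambda>(p, q). mon a p b q) ` insert (p, q) P)"
          unfolding eq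
        proof (intro span_add span_scale)
          show "V a * m * V b \<in> span ((\<lambda>(p, q). mon a p b q) ` insert (p, q) P)"
            using True verts m by (intro span_base) (simp add: V_mon_V)
          show "V a * y * V b \<in> span ((\<lambda>(p, q). mon a p b q) ` insert (p, q) P)"
            by (rule subsetD[OF span_mono P(3)]) auto
        qed
      qed (use P m True in auto)
    next
      case False
      then have "V a * m * V b = 0"
        using V_mon_V[OF m(2,3) verts] unfolding m(1) by argo
      then show ?thesis
        using P by (intro exI[of _ P]) (simp add: eq)
    qed
  qed
  then show thesis
    using that by blast
qed

lemma nu_ideal_algI:
  assumes "I \<subseteq> A" "0 \<in> I" "\<And>x y. \<lbrakk>x \<in> I; y \<in> I\<rbrakk> \<Longrightarrow> x + y \<in> I" "\<And>k x. x \<in> I \<Longrightarrow> sc k x \<in> I"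
    and "\<And>a x. \<lbrakk>a \<in> A; x \<in> I\<rbrakk> \<Longrightarrow> a * x \<in> I" "\<And>a x. \<lbrakk>a \<in> A; x \<in> I\<rbrakk> \<Longrightarrow> x * a \<in> I"
  shows "nu_ideal alg I"
  using assms by (auto simp: nu_ideal_def alg_def)

lemma prime_cent_eq_0:
  assumes prime: "prime_algebra alg" and \<sigma>: "cent \<sigma>" and x: "x \<in> A" "x \<noteq> 0" "\<sigma> x = 0" and y: "y \<in> A"
  shows "\<sigma> y = 0"
proof -
  let ?I = "{z \<in> A. \<sigma> z = 0}" and ?J = "\<sigma> ` A"
  have I: "nu_ideal alg ?I"
  proof (rule nu_ideal_algI)
    show "a * b \<in> ?I" if "a \<in> A" "b \<in> ?I" for a b
      using that \<sigma> A_mult by (simp add: cent_mult_right[OF \<sigma> that(1)])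
    show "b * a \<in> ?I" if "a \<in> A" "b \<in> ?I" for a b
      using that \<sigma> A_mult by (simp add: cent_mult_left[OF \<sigma> _ that(1)])
  qed (use \<sigma> in \<open>auto simp: A_0 A_add A_scale cent_0 cent_add cent_scale\<close>)
  have J: "nu_ideal alg ?J"
  proof (rule nu_ideal_algI)
    show "\<sigma> ` A \<subseteq> A"
      using \<sigma> by (auto simp: cent_in)
    show "0 \<in> \<sigma> ` A"
      using cent_0[OF \<sigma>] A_0 by (metis imageI)
    show "a + b \<in> ?J" if "a \<in> ?J" "b \<in> ?J" for a b
      using \<sigma> that by (auto simp: A_add simp flip: cent_add)
    show "sc k a \<in> ?J" if "a \<in> ?J" for k a
      using \<sigma> that by (auto simp: A_scale simp flip: cent_scale)
    show "a * b \<in> ?J" if "a \<in> A" "b \<in> ?J" for a b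
      using \<sigma> that by (auto simp: A_mult simp flip: cent_mult_right)
    show "b * a \<in> ?J" if "a \<in> A" "b \<in> ?J" for a b
      using \<sigma> that by (auto simp: A_mult simp flip: cent_mult_left)
  qed
  have zero: "z * \<sigma> w = 0" if "z \<in> ?I" "w \<in> A" for z w
    using that cent_mult_left[OF \<sigma>, of z w] cent_mult_right[OF \<sigma>, of z w] by simp
  have "\<forall>z\<in>?I. \<forall>w\<in>?J. nu_mult alg z w = nu_zero alg"
    using zero by (auto simp: alg_def)
  then have "?I = {nu_zero alg} \<or> ?J = {nu_zero alg}"
    using prime I J unfolding prime_algebra_def by blast
  then have "?I = {0} \<or> ?J = {0}"
    by (simp add: alg_def)
  then show ?thesis
    using x y by auto
qed

lemma conjugate_span:
  assumes "x \<in> span ((\<lambda>(p, q). mon v p v q) ` P)"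
    and "\<And>p q. (p, q) \<in> P \<Longrightarrow> l * mon v p v q * r \<in> span S"
  shows "l * x * r \<in> span S"
  using assms(1)
proof (induction rule: span_induct_alt)
  case (step c m y)
  have "l * (sc c m + y) * r = sc c (l * m * r) + l * y * r"
    by (simp add: distrib_left distrib_right scale_mult_left scale_mult_right)
  then show ?case
    using step assms(2) by (auto intro: span_add span_scale)
qed (simp add: span_zero)

text \<open>The product vanishes unless \<open>\<nu>\<close> extends both \<open>p\<close> and
  \<open>q\<close>. Then \<open>p\<close> and \<open>q\<close> are cut off, and a ghost tail of
  \<open>\<nu>\<close> meets a tail of \<open>\<nu>\<close>. Freshness of the last edge forces these
  two tails to be equal or incomparable, so that the result is \<open>w\<close> or 0.\<close>

lemma gst_mon_pth_fresh:
  assumes \<nu>: "awalk v \<nu> w" "\<nu> = \<alpha> @ \<beta> @ [f]" "f \<notin> set \<beta>"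
    and p: "awalk v p z" "length p \<le> length \<beta>" and q: "awalk v q z" "length q \<le> length \<beta>"
  shows "gst v \<nu> * mon v p v q * pth v \<nu> \<in> span {V w}"
proof -
  have eq: "gst v \<nu> * mon v p v q * pth v \<nu> = (gst v \<nu> * pth v p) * (gst v q * pth v \<nu>)"
    by (simp add: mon_def mult.assoc)
  have long: "length p < length \<nu>" "length q < length \<nu>"
    using p q \<nu> by auto
  \<comment> \<open>If one tail were a proper prefix of the other, the edge \<open>f\<close> at its
    end would stand between 1 and \<open>length \<beta>\<close> places before the end of
    \<open>\<nu>\<close>, that is, inside \<open>\<beta>\<close>.\<close>
  have aux: False if h: "\<nu> = s @ a @ r" "a \<noteq> []" "r \<noteq> []" "length r \<le> length \<beta>" "last a = last \<nu>"
      for s a r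
  proof -
    obtain a' where a: "a = a' @ [f]"
      using h(2,5) \<nu>(2) by (cases a rule: rev_cases) auto
    obtain r' g where r: "r = r' @ [g]"
      using h(3) by (cases r rule: rev_cases) auto
    have "\<alpha> @ \<beta> = (s @ a' @ [f]) @ r'"
      using h \<nu> a r by simp
    moreover have "length r' < length \<beta>"
      using h r by simp
    ultimately have "f \<in> set \<beta>"
      by (auto simp: append_eq_append_conv2 append_eq_Cons_conv)
    then show False
      using \<nu> by simp
  qed
  show ?thesis
  proof (cases "(\<exists>a. \<nu> = p @ a) \<and> (\<exists>b. \<nu> = q @ b)")
    case False
    then have "gst v \<nu> * pth v p = 0 \<or> gst v q * pth v \<nu> = 0"
      using gst_mult_pth_eq_0[OF \<nu>(1) p(1)] gst_mult_pth_eq_0[OF q(1) \<nu>(1)] long by fastforce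
    then show ?thesis
      unfolding eq by (auto simp: span_zero)
  next
    case True
    then obtain a b where a: "\<nu> = p @ a" and b: "\<nu> = q @ b"
      by metis
    have "awalk v (p @ a) w" "awalk v (q @ b) w"
      using \<nu>(1) a b by metis+
    then have wa: "awalk z a w" and wb: "awalk z b w"
      using p(1) q(1) by auto
    have ne: "a \<noteq> []" "b \<noteq> []"
      using long a b by auto
    \<comment> \<open>The surplus of one tail over the other is the difference of the lengths of
      \<open>p\<close> and \<open>q\<close>, hence at most \<open>length \<beta>\<close>.\<close>
    have len: "length p + length a = length q + length b"
      using arg_cong[OF trans[OF a[symmetric] b], of length] by simp
    have last_\<nu>: "last a = last \<nu>" "last b = last \<nu>"
      using a b ne by (metis last_appendR)+
    have "gst v \<nu> * mon v p v q * pth v \<nu> = gst z a * pth z b"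
      unfolding eq using gst_mult_pth_append[OF p(1) wa] gst_mult_pth_append[OF q(1) wb] a b by simp
    also have "\<dots> \<in> span {V w}"
    proof (cases "(\<exists>r. b = a @ r) \<or> (\<exists>r. a = b @ r)")
      case False
      then show ?thesis
        using gst_mult_pth_eq_0[OF wa wb] by (simp add: span_zero)
    next
      case True
      then have "a = b"
      proof (elim disjE exE)
        fix r assume r: "b = a @ r"
        show ?thesis
        proof (rule ccontr)
          assume "a \<noteq> b"
          then show False
            using r ne b len last_\<nu> p(2) by (intro aux[of q a r]) auto
        qed
      next
        fix r assume r: "a = b @ r"
        show ?thesis
        proof (rule ccontr)
          assume "a \<noteq> b"
          then show False
            using r ne a len last_\<nu> q(2) by (intro aux[of p b r]) auto
        qed
      qed
      then show ?thesis
        using wa by (simp add: gst_mult_pth span_base)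
    qed
    finally show ?thesis .
  qed
qed

text \<open>Without vertices there are no edges either, so the algebra is zero, and the zero algebra
  is not prime by convention.\<close>

lemma verts_nonempty: "prime_algebra alg \<Longrightarrow> \<exists>v. v \<in> verts E"
proof (rule ccontr)
  assume prime: "prime_algebra alg" and "\<nexists>v. v \<in> verts E"
  then have "generators E = {}"
    by (auto simp: generators_def dest: tail_in_verts)
  then have "A = {0}"
    by (simp add: A_def)
  then show False
    using prime by (simp add: prime_algebra_def alg_def)
qed

end

text \<open>
  The functionals express that the elements given by closed paths of different lengths at a vertex
  are nonzero and linearly independent, which does not follow from the relations.
\<close>

locale leavitt = leavitt_relations E sc G
  for E :: "('v, 'e) pre_digraph" and sc :: "'k :: field \<Rightarrow> 'r :: ring \<Rightarrow> 'r" and G ::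
      "('v, 'e) generator \<Rightarrow> 'r" +
  assumes functional: "v \<in> verts E \<Longrightarrow> \<exists>\<phi>. (\<forall>x\<in>A. \<forall>y\<in>A. \<phi> (x + y) = \<phi> x + \<phi> y) \<and>
    (\<forall>k. \<forall>x\<in>A. \<phi> (sc k x) = k * \<phi> x) \<and>
    (\<forall>p. awalk v p v \<longrightarrow> \<phi> (pth v p) = (if length p = m then 1 else 0))"
begin

text \<open>The functional of degree 0 is 1 at the empty path, whereas homogeneity makes it vanish
  at 0.\<close>

lemma V_neq_0: "v \<in> verts E \<Longrightarrow> V v \<noteq> 0"
proof
  assume v: "v \<in> verts E" "V v = 0"
  obtain \<phi> where "\<forall>k. \<forall>x\<in>A. \<phi> (sc k x) = k * \<phi> x"
    "\<forall>p. awalk v p v \<longrightarrow> \<phi> (pth v p) = (if length p = 0 then 1 else 0)"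
    using functional[OF v(1)] by metis
  then have "\<phi> (sc 0 0) = 0 * \<phi> 0" "\<phi> (pth v []) = 1"
    using A_0 v by (auto simp: awalk_simps simp del: pth.simps scale_zero_left scale_zero_right)
  then show False
    using v by simp
qed

section \<open>Criteria for an element of the centroid to be scalar\<close>

lemma scalarI:
  assumes prime: "prime_algebra alg" and \<tau>: "cent \<tau>" and p: "awalk v p w"
    and "gst v p * \<tau> (V v) * pth v p \<in> span {V w}"
  shows "\<exists>k. \<forall>x\<in>A. \<tau> x = sc k x"
proof -
  have w: "w \<in> verts E"
    using p by auto
  obtain k where k: "\<tau> (V w) = sc k (V w)"
    using assms by (auto simp: cent_conjugate span_singleton)
  have "\<tau> x = sc k x" if "x \<in> A" for x
    using prime_cent_eq_0[OF prime cent_diff[OF \<tau> cent_scalar[of k]] V_in_A[OF w] V_neq_0[OF w] _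
        that]
      that V_in_A[OF w] k by simp
  then show ?thesis
    by blast
qed

text \<open>The path \<open>\<nu>\<close> may be chosen after the monomials that occur in
  \<open>\<tau> (V v)\<close>, so it can be made long, or made to avoid their edges, depending on
  \<open>\<tau>\<close>.\<close>

lemma scalarI_corner:
  assumes prime: "prime_algebra alg" and \<tau>: "cent \<tau>" and v: "v \<in> verts E"
    and *: "\<And>P. \<lbrakk>finite P; \<forall>(p, q) \<in> P. \<exists>z. awalk v p z \<and> awalk v q z\<rbrakk> \<Longrightarrow>
      \<exists>\<nu> w. awalk v \<nu> w \<and> (\<forall>(p, q) \<in> P. gst v \<nu> * mon v p v q * pth v \<nu> \<in> span {V w})"
  shows "\<exists>k. \<forall>x\<in>A. \<tau> x = sc k x"
proof -
  obtain P where P: "finite P" "\<forall>(p, q) \<in> P. \<exists>z. awalk v p z \<and> awalk v q z"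
    "V v * \<tau> (V v) * V v \<in> span ((\<lambda>(p, q). mon v p v q) ` P)"
    using corner_span[OF cent_in[OF \<tau> V_in_A[OF v]] v v] .
  then have mem: "\<tau> (V v) \<in> span ((\<lambda>(p, q). mon v p v q) ` P)"
    using \<tau> v by (simp add: cent_corner)
  obtain \<nu> w where "awalk v \<nu> w" "\<forall>(p, q) \<in> P. gst v \<nu> * mon v p v q * pth v \<nu> \<in> span {V w}"
    using *[OF P(1,2)] by auto
  then show ?thesis
    using mem by (intro scalarI[OF prime \<tau>, of v \<nu> w] conjugate_span[OF mem]) auto
qed

text \<open>Only the trivial path leaves a sink, so the corner at a sink consists of the multiples
  of the vertex.\<close>

lemma scalar_sink:
  assumes "prime_algebra alg" "cent \<tau>" and v: "sink E v"
  shows "\<exists>k. \<forall>x\<in>A. \<tau> x = sc k x"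
proof (rule scalarI_corner[OF assms(1,2)])
  show "v \<in> verts E"
    using v by (simp add: sink_def)
  fix P assume P: "\<forall>(p, q) \<in> P. \<exists>z. awalk v p z \<and> awalk v q z"
  have "p = []" if "awalk v p z" for p z
    using that v by (cases p) (auto simp: awalk_simps sink_def out_arcs_def)
  then have "P \<subseteq> {([], [])}"
    using P by blast
  then show "\<exists>\<nu> w. awalk v \<nu> w \<and> (\<forall>(p, q) \<in> P. gst v \<nu> * mon v p v q * pth v \<nu> \<in> span {V w})"
    using v by (intro exI[of _ "[]"] exI[of _ v])
      (auto simp: awalk_simps sink_def mon_def V_idem span_base)
qed

lemma scalar_infinite_emitter:
  assumes "prime_algebra alg" "cent \<tau>" and v: "infinite_emitter E v"
  shows "\<exists>k. \<forall>x\<in>A. \<tau> x = sc k x"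
proof (rule scalarI_corner[OF assms(1,2)])
  show v': "v \<in> verts E"
    using v by (simp add: infinite_emitter_def)
  fix P assume P: "finite P" "\<forall>(p, q) \<in> P. \<exists>z. awalk v p z \<and> awalk v q z"
  \<comment> \<open>The monomials involve finitely many edges, so some edge \<open>f\<close> leaving
    \<open>v\<close> avoids them all. Conjugation by \<open>f\<close> kills every monomial except
    the vertex itself.\<close>
  have "infinite (out_arcs E v - (\<Union>(p, q)\<in>P. set p \<union> set q))"
    using v P by (intro Diff_infinite_finite) (auto simp: infinite_emitter_def)
  then obtain f where f: "f \<in> arcs E" "tail E f = v" "\<And>p q. (p, q) \<in> P \<Longrightarrow> f \<notin> set p \<and> f \<notin> set q"
    by (auto dest!: infinite_imp_nonempty simp: out_arcs_def)
  have w: "awalk v [f] (head E f)"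
    using f by (auto simp: awalk_simps)
  have "gst v [f] * mon v p v q * pth v [f] \<in> span {V (head E f)}" if "(p, q) \<in> P" for p q
  proof -
    obtain z where z: "awalk v p z" "awalk v q z"
      using P \<open>(p, q) \<in> P\<close> by auto
    have eq: "gst v [f] * mon v p v q * pth v [f] = (gst v [f] * pth v p) * (gst v q * pth v [f])"
      by (simp only: mon_def mult.assoc)
    show ?thesis
    proof (cases "p = [] \<and> q = []")
      case True
      then have "gst v [f] * mon v p v q * pth v [f] = (gst v [f] * V v) * (V v * pth v [f])"
        unfolding eq by simp
      also have "\<dots> = V (head E f)"
        by (simp only: gst_mult_V[OF w] V_mult_pth[OF w] gst_mult_pth[OF w])
      finally show ?thesis
        by (simp add: span_base)
    next
      case False
      then have "gst v [f] * pth v p = 0 \<or> gst v q * pth v [f] = 0"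
        using gst_mult_pth_eq_0[OF w z(1)] gst_mult_pth_eq_0[OF z(2) w] f(3)[OF that]
        by (cases p; cases q) (auto simp: Cons_eq_append_conv)
      then show ?thesis
        unfolding eq by (auto simp: span_zero)
    qed
  qed
  then show "\<exists>\<nu> w. awalk v \<nu> w \<and> (\<forall>(p, q) \<in> P. gst v \<nu> * mon v p v q * pth v \<nu> \<in> span {V w})"
    using w by blast
qed

lemma scalar_fresh:
  assumes "prime_algebra alg" "cent \<tau>" and "v \<in> verts E"
    and *: "\<And>D. \<exists>\<alpha> \<beta> f w. awalk v (\<alpha> @ \<beta> @ [f]) w \<and> D \<le> length \<beta> \<and> f \<notin> set \<beta>"
  shows "\<exists>k. \<forall>x\<in>A. \<tau> x = sc k x"
proof (rule scalarI_corner[OF assms(1-3)])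
  fix P :: "('e list \<times> 'e list) set"
  assume P: "finite P" "\<forall>(p, q) \<in> P. \<exists>z. awalk v p z \<and> awalk v q z"
  \<comment> \<open>The sum of all lengths serves as a crude bound for each of them.\<close>
  define D where "D = (\<Sum>x\<in>P. length (fst x) + length (snd x))"
  obtain \<alpha> \<beta> f w where w: "awalk v (\<alpha> @ \<beta> @ [f]) w" "D \<le> length \<beta>" "f \<notin> set \<beta>"
    using * by metis
  have "length p + length q \<le> D" if "(p, q) \<in> P" for p q
    using member_le_sum[OF that, of "\<lambda>x. length (fst x) + length (snd x)"] P by (simp add: D_def)
  then have D: "length p \<le> length \<beta>" "length q \<le> length \<beta>" if "(p, q) \<in> P" for p q
    using w(2) that by fastforce+
  have "gst v (\<alpha> @ \<beta> @ [f]) * mon v p v q * pth v (\<alpha> @ \<beta> @ [f]) \<in> span {V w}" if pq: "(p, q) \<in> P"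
      for p q
  proof -
    obtain z where "awalk v p z" "awalk v q z"
      using bspec[OF P(2) pq] by auto
    then show ?thesis
      by (intro gst_mon_pth_fresh[OF w(1) refl w(3)] D[OF pq])
  qed
  then show "\<exists>\<nu> w. awalk v \<nu> w \<and> (\<forall>(p, q) \<in> P. gst v \<nu> * mon v p v q * pth v \<nu> \<in> span {V w})"
    using w(1) by blast
qed

lemma centroid_field:
  fixes K :: "'k itself"
  assumes prime: "prime_algebra alg" and scalar: "\<And>\<tau>. cent \<tau> \<Longrightarrow> \<exists>k. \<forall>x\<in>A. \<tau> x = sc k x"
  shows "algebra_isomorphic (centroid alg) (field_algebra K)"
proof -
  obtain v where v: "v \<in> verts E"
    using verts_nonempty[OF prime] by auto
  \<comment> \<open>The scalar is read off at a single vertex; it is unique because that vertex is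
    nonzero.\<close>
  define h where "h \<tau> = (THE k. \<tau> (V v) = sc k (V v))" for \<tau>
  have inj: "k = l" if "sc k (V v) = sc l (V v)" for k l
    using that V_neq_0[OF v] by simp
  have h: "h \<tau> = k" if "\<tau> (V v) = sc k (V v)" for \<tau> k
    unfolding h_def using that inj by (intro the_equality) auto
  have h': "\<tau> x = sc (h \<tau>) x" if "cent \<tau>" "x \<in> A" for \<tau> x
    using scalar[OF that(1)] that(2) h[of \<tau>] V_in_A[OF v] by metis
  have "bij_betw h (Collect cent) UNIV"
  proof (rule bij_betwI[where g = "\<lambda>k. \<lambda>x\<in>A. sc k x"])
    show "(\<lambda>x\<in>A. sc (h \<tau>) x) = \<tau>" if "\<tau> \<in> Collect cent" for \<tau>
      using that h'[of \<tau>] by (intro extensionalityI[of _ A]) (auto simp: cent_extensional)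
  qed (auto simp: cent_scalar V_in_A v intro!: h)
  moreover have "h (\<lambda>x\<in>A. \<sigma> x + \<tau> x) = h \<sigma> + h \<tau>" "h (compose A \<sigma> \<tau>) = h \<sigma> * h \<tau>"
    "h (\<lambda>x\<in>A. sc k (\<tau> x)) = k * h \<tau>"
    if "cent \<sigma>" "cent \<tau>" for \<sigma> \<tau> k
    using that V_in_A[OF v] h'[of \<sigma>] h'[of \<tau>] by (auto intro!: h simp: compose_def cent_in
        scale_left_distrib A_scale)
  moreover have "h (\<lambda>x\<in>A. x) = 1"
    using V_in_A[OF v] by (intro h) simp
  ultimately have "h \<in> ring_iso (centroid alg) (field_algebra K) \<and>
    (\<forall>k. \<forall>x\<in>carrier (centroid alg). h (k \<odot>\<^bsub>centroid alg\<^esub> x) = k \<odot>\<^bsub>field_algebra K\<^esub> h x)"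
    unfolding ring_iso_def ring_hom_def carrier_centroid_alg
    by (simp add: field_algebra_def centroid_def alg_def)
  then show ?thesis
    unfolding algebra_isomorphic_def by blast
qed

end

section \<open>Cycles and infinite paths\<close>

context wf_digraph
begin

lemma awalk_infinite_path:
  assumes "infinite_path G f"
  shows "awalk (tail G (f i)) (map f [i..<i + n]) (tail G (f (i + n)))"
proof (induction n)
  case 0
  then show ?case
    using assms by (auto simp: awalk_simps infinite_path_def)
next
  case (Suc n)
  have "awalk (tail G (f (i + n))) [f (i + n)] (tail G (f (Suc (i + n))))"
    using assms by (auto simp: awalk_simps infinite_path_def)
  then show ?case
    using Suc awalk_appendI by fastforce
qed

lemma tl_awalk_verts: "awalk u p v \<Longrightarrow> tl (awalk_verts u p) = map (head G) p"
  by (auto simp: awalk_verts_conv')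

text \<open>Unfolded, the distinctness in \<open>cycle_def\<close> concerns the ranges of the edges;
  \<open>cycle_distinct_tails\<close> passes to the sources.\<close>

lemma cycle_iff: "cycle c \<longleftrightarrow> (\<exists>u. awalk u c u \<and> distinct (map (head G) c) \<and> c \<noteq> [])"
  unfolding cycle_def using tl_awalk_verts by metis

text \<open>Both sides list the visited vertices: all sources followed by the end, or the start
  followed by all ranges.\<close>

lemma closed_awalk_tails:
  assumes "awalk u c u"
  shows "map (tail G) c @ [u] = u # map (head G) c"
proof (cases "c = []")
  case False
  then have "awalk_verts u c = map (tail G) c @ [head G (last c)]"
    by (simp add: awalk_verts_conv)
  moreover have "awalk_verts u c = tail G (hd c) # map (head G) c"
    using False assms by (auto simp: awalk_verts_conv')
  moreover have "hd (awalk_verts u c) = u" "last (awalk_verts u c) = u"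
    using assms by auto
  ultimately show ?thesis
    by (metis last_snoc list.sel(1))
qed auto

lemma cycle_verts_heads:
  assumes "cycle c"
  shows "cycle_verts G c = head G ` set c"
proof -
  obtain u where u: "map (tail G) c @ [u] = u # map (head G) c" and "c \<noteq> []"
    using assms closed_awalk_tails by (auto simp: cycle_iff)
  have "tail G (hd c) = u" "head G (last c) = u"
    using arg_cong[OF u, of hd] arg_cong[OF u, of last] \<open>c \<noteq> []\<close>
    by (simp_all add: hd_append hd_map last_map)
  then have "u \<in> tail G ` set c" "u \<in> head G ` set c"
    using \<open>c \<noteq> []\<close> by (auto intro: rev_image_eqI[of "hd c"] rev_image_eqI[of "last c"])
  moreover have "insert u (tail G ` set c) = insert u (head G ` set c)"
    using arg_cong[OF u, of set] by simp
  ultimately show ?thesis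
    by (simp add: insert_absorb cycle_verts_def)
qed

text \<open>By counting: sources and ranges form the same set, and the ranges are distinct.\<close>

lemma cycle_distinct_tails:
  assumes "cycle c"
  shows "distinct (map (tail G) c)"
proof (rule card_distinct)
  have "distinct (map (head G) c)"
    using assms by (auto simp: cycle_iff)
  then show "card (set (map (tail G) c)) = length (map (tail G) c)"
    using cycle_verts_heads[OF assms] distinct_card by (fastforce simp: cycle_verts_def)
qed

lemma cycle_rotate: "cycle c \<Longrightarrow> v \<in> cycle_verts G c \<Longrightarrow> \<exists>n. awalk v (rotate n c) v"
proof -
  assume "cycle c" "v \<in> cycle_verts G c"
  then obtain u e where u: "awalk u c u" and e: "e \<in> set c" "tail G e = v"
    by (auto simp: cycle_iff cycle_verts_def)
  moreover obtain a b where c: "c = a @ e # b"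
    using split_list[OF e(1)] by auto
  ultimately have "awalk u (a @ e # b) u"
    by simp
  then have "awalk u a v" "awalk v (e # b) u"
    using e(2) by (auto simp: awalk_Cons_iff)
  then have "awalk v ((e # b) @ a) v"
    by (rule awalk_appendI[rotated])
  moreover have "rotate (length a) c = (e # b) @ a"
    by (simp only: c rotate_append)
  ultimately show ?thesis
    by metis
qed

lemma cycle_infinite_path:
  assumes f: "infinite_path G f" "\<not> inj f"
  obtains c k where "cycle c" "tail G (f k) \<in> cycle_verts G c"
proof -
  \<comment> \<open>\<open>P d\<close> says that some vertex recurs after \<open>d\<close> steps.
    For the least such \<open>d\<close>, the edges between the two visits form a cycle.\<close>
  define P where "P d \<longleftrightarrow> d > 0 \<and> (\<exists>i. tail G (f i) = tail G (f (i + d)))" for d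
  have "\<exists>d. P d"
  proof -
    obtain i j where "f i = f j" "i < j"
      using f(2) by (metis injI linorder_neqE_nat)
    then have "P (j - i)"
      by (auto simp: P_def intro!: exI[of _ i])
    then show ?thesis ..
  qed
  then obtain d where d: "P d" "\<And>d'. d' < d \<Longrightarrow> \<not> P d'"
    using exists_least_iff[of P] by metis
  then obtain i where i: "tail G (f i) = tail G (f (i + d))" and "d > 0"
    by (auto simp: P_def)
  define c where "c = map f [i..<i + d]"
  \<comment> \<open>The shift by \<open>Suc\<close> turns ranges into sources of the next edge. A
    repetition within the window would be a return in fewer than \<open>d\<close> steps.\<close>
  have "inj_on (\<lambda>k. tail G (f (Suc k))) {i..<i + d}"
  proof (rule linorder_inj_onI)
    fix a b assume ab: "a < b" "a \<in> {i..<i + d}" "b \<in> {i..<i + d}"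
    then have "\<not> P (b - a)"
      by (intro d(2)) auto
    then show "tail G (f (Suc a)) \<noteq> tail G (f (Suc b))"
      using ab by (auto simp: P_def dest: spec[of _ "Suc a"])
  qed auto
  then have "distinct (map (head G) c)"
    using f(1) by (auto simp: c_def distinct_map comp_def infinite_path_def)
  then have "cycle c"
    unfolding cycle_iff using awalk_infinite_path[OF f(1), of i d] i \<open>d > 0\<close> by (auto simp: c_def)
  moreover have "tail G (f i) \<in> cycle_verts G c"
    using \<open>d > 0\<close> by (auto simp: c_def cycle_verts_def)
  ultimately show thesis
    using that by blast
qed

section \<open>Cycles without exits\<close>

definition exit_free :: "'b list \<Rightarrow> bool" where
  "exit_free c \<longleftrightarrow> (\<forall>e\<in>arcs G. tail G e \<in> cycle_verts G c \<longrightarrow> e \<in> set c)"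

context
  fixes c assumes c: "cycle c" "exit_free c"
begin

lemma exit_free_head: "\<lbrakk>e \<in> arcs G; tail G e \<in> cycle_verts G c\<rbrakk> \<Longrightarrow> head G e \<in> cycle_verts G c"
  using c by (auto simp: exit_free_def cycle_verts_heads[OF c(1)])

lemma exit_free_arc_unique:
  "\<lbrakk>e \<in> arcs G; f \<in> arcs G; tail G e \<in> cycle_verts G c; tail G f = tail G e\<rbrakk> \<Longrightarrow> f = e"
  using c cycle_distinct_tails[OF c(1)]
  by (auto simp: exit_free_def distinct_map) (metis inj_onD)

lemma exit_free_awalk_end: "\<lbrakk>awalk v p x; v \<in> cycle_verts G c\<rbrakk> \<Longrightarrow> x \<in> cycle_verts G c"
  by (induction p arbitrary: v) (auto simp: awalk_simps exit_free_head)

text \<open>A vertex of such a cycle emits a single edge whose range is again on the cycle, so a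
  walk from there is determined by its length.\<close>

lemma exit_free_awalk_prefix:
  "\<lbrakk>v \<in> cycle_verts G c; awalk v p x; awalk v q y; length p \<le> length q\<rbrakk> \<Longrightarrow> \<exists>r. q = p @ r"
proof (induction p arbitrary: v q)
  case (Cons e p)
  then obtain f q' where q: "q = f # q'"
    by (cases q) auto
  have arcs: "e \<in> arcs G" "f \<in> arcs G" and tails: "tail G e = v" "tail G f = v"
    and e: "awalk (head G e) p x" and f: "awalk (head G f) q' y"
    using Cons.prems(2,3) by (auto simp: awalk_Cons_iff q)
  then have "e = f"
    using exit_free_arc_unique[OF arcs(2,1)] Cons.prems(1) by simp
  moreover have "head G e \<in> cycle_verts G c"
    using exit_free_head[OF arcs(1)] tails Cons.prems(1) by simp
  ultimately show ?case
    using Cons.IH[of "head G e" q'] Cons.prems(4) e f q by auto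
qed simp

lemma exit_free_infinite_path:
  assumes f: "infinite_path G f" "tail G (f k) \<in> cycle_verts G c"
  shows "ends_in_cycle f c"
proof -
  have "tail G (f (k + n)) \<in> cycle_verts G c" for n
  proof (induction n)
    case (Suc n)
    then show ?case
      using f exit_free_head[of "f (k + n)"] by (auto simp: infinite_path_def)
  qed (use f in simp)
  then have "f n \<in> set c" if "n \<ge> k" for n
    using that f c by (metis exit_free_def infinite_path_def le_add_diff_inverse)
  then show ?thesis
    unfolding ends_in_cycle_def by blast
qed

lemma exit_free_cycle_unique:
  assumes c': "cycle c'" and u: "u \<in> cycle_verts G c" "u \<in> cycle_verts G c'"
  shows "\<exists>n. c' = rotate n c"
proof -
  obtain n m where n: "awalk u (rotate n c) u" and m: "awalk u (rotate m c') u"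
    using cycle_rotate c c' u by metis
  \<comment> \<open>If one closed walk at \<open>u\<close> properly extended the other, then both
    the shorter walk and the surplus would end at \<open>u\<close>, and the range \<open>u\<close>
    would occur twice.\<close>
  have False if "awalk u p u" "awalk u (p @ r) u" "p \<noteq> []" "r \<noteq> []"
      "distinct (map (head G) (p @ r))" for p r
  proof -
    have "awalk u r u"
      using that by auto
    then have "head G (last p) = u" "head G (last r) = u"
      using that awlast_of_awalk[of u p u] awlast_of_awalk[of u r u]
      by (auto simp: awalk_verts_conv split: if_splits)
    then show False
      using that(3-5) imageI[OF last_in_set[of p], of "head G"] imageI[OF last_in_set[of r], of
          "head G"]
      by auto
  qed
  note no_ext = this
  have ne: "rotate n c \<noteq> []" "rotate m c' \<noteq> []"
    using c c' by (auto simp: cycle_iff)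
  have dist: "distinct (map (head G) (rotate n c))" "distinct (map (head G) (rotate m c'))"
    using c c' by (auto simp: cycle_iff rotate_map[symmetric])
  have "rotate m c' = rotate n c"
  proof (cases "length (rotate n c) \<le> length (rotate m c')")
    case True
    then obtain r where "rotate m c' = rotate n c @ r"
      using exit_free_awalk_prefix[OF u(1) n m] by auto
    then show ?thesis
      using no_ext[OF n, of r] m ne dist by auto
  next
    case False
    then obtain r where "rotate n c = rotate m c' @ r"
      using exit_free_awalk_prefix[OF u(1) m n] by auto
    then show ?thesis
      using no_ext[OF m, of r] n ne dist by auto
  qed
  \<comment> \<open>The rotation by \<open>m\<close> is undone by completing it to
    \<open>length c' * m\<close>, a multiple of the length.\<close>
  moreover have "c' = rotate (length c' * m - m) (rotate m c')"
  proof -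
    have "length c' * m - m + m = length c' * m"
      using ne by (cases "length c'") auto
    then show ?thesis
      by (simp add: rotate_rotate rotate_id)
  qed
  ultimately have "c' = rotate (length c' * m - m) (rotate n c)"
    by simp
  then show ?thesis
    unfolding rotate_rotate ..
qed

end

lemma rotate_cycle_verts: "cycle_verts G (rotate n c) = cycle_verts G c"
  by (simp add: cycle_verts_def)

lemma cycle_vertices_connected:
  assumes "cycle c" "u \<in> cycle_verts G c" "v \<in> cycle_verts G c"
  shows "\<exists>p. awalk u p v"
proof -
  obtain n where n: "awalk u (rotate n c) u"
    using cycle_rotate[OF assms(1,2)] by auto
  have "v \<in> set (awalk_verts u (rotate n c))"
    using n assms(3) by (auto simp: set_awalk_verts cycle_verts_def)
  then show ?thesis
    using awalk_decomp[OF n] by auto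
qed

text \<open>From the range of an edge that starts on \<open>c\<close> one can return to
  \<open>c\<close> and along it to the source of that edge. Once the return walk is shortened to one
  without repeated vertices, it forms a cycle together with the edge; this cycle is a rotation of
  \<open>c\<close>, so the edge belongs to \<open>c\<close>.\<close>

lemma unique_cycle_exit_free:
  assumes c: "cycle c" and unique: "\<forall>c'. cycle c' \<longrightarrow> (\<exists>n. c' = rotate n c)"
    and reach: "\<forall>v\<in>verts G. tree G v \<inter> cycle_verts G c \<noteq> {}"
  shows "exit_free c"
  unfolding exit_free_def
proof (intro ballI impI)
  fix e assume e: "e \<in> arcs G" "tail G e \<in> cycle_verts G c"
  then obtain w q where "awalk (head G e) q w" "w \<in> cycle_verts G c"
    using reach head_in_verts[of e] by (fastforce simp: tree_def reachable_awalk)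
  moreover from this obtain r where "awalk w r (tail G e)"
    using cycle_vertices_connected c e by blast
  ultimately have "awalk (head G e) (q @ r) (tail G e)"
    using awalk_appendI by blast
  then have p: "apath (head G e) (awalk_to_apath (q @ r)) (tail G e)"
    by (rule apath_awalk_to_apath)
  then have "cycle (e # awalk_to_apath (q @ r))"
    using e by (auto simp: cycle_def awalk_simps apath_def)
  then obtain n where "e # awalk_to_apath (q @ r) = rotate n c"
    using unique by auto
  then show "e \<in> set c"
    by (metis list.set_intros(1) set_rotate)
qed

lemma infinite_path_from:
  assumes "\<forall>v\<in>verts G. \<not> sink G v" "v \<in> verts G"
  obtains f where "infinite_path G f" "tail G (f 0) = v"
proof -
  obtain nxt where nxt: "\<And>v. v \<in> verts G \<Longrightarrow> nxt v \<in> arcs G \<and> tail G (nxt v) = v"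
    using assms(1) by (simp add: sink_def out_arcs_def) metis
  define f where "f = rec_nat (nxt v) (\<lambda>_ e. nxt (head G e))"
  have "f i \<in> arcs G" for i
    by (induction i) (auto simp: f_def assms nxt)
  moreover have "tail G (f (Suc i)) = head G (f i)" for i
    using \<open>f i \<in> arcs G\<close> by (simp add: f_def nxt)
  ultimately show thesis
    using that[of f] assms nxt by (auto simp: infinite_path_def f_def)
qed

text \<open>In the absence of sinks every vertex starts an infinite path, which repeats an edge and
  hence meets a cycle. A walk cannot leave a cycle without exits, so a common descendant of vertices
  on two cycles lies on both, and the cycles agree up to rotation.\<close>

lemma cometI:
  assumes no_sink: "\<forall>v\<in>verts G. \<not> sink G v"
    and exit_free: "\<And>c. cycle c \<Longrightarrow> exit_free c"
    and not_inj: "\<And>f. infinite_path G f \<Longrightarrow> \<not> inj f"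
    and confluent: "\<And>v w. \<lbrakk>v \<in> verts G; w \<in> verts G\<rbrakk> \<Longrightarrow> \<exists>z p q. awalk v p z \<and> awalk w q z"
    and "v \<in> verts G"
  shows "comet G"
proof -
  have reach: "\<exists>c u p. cycle c \<and> u \<in> cycle_verts G c \<and> awalk v p u" if v: "v \<in> verts G" for v
  proof -
    obtain f where f: "infinite_path G f" "tail G (f 0) = v"
      using infinite_path_from[OF no_sink v] .
    obtain c k where "cycle c" "tail G (f k) \<in> cycle_verts G c"
      using cycle_infinite_path[OF f(1) not_inj[OF f(1)]] .
    then show ?thesis
      using awalk_infinite_path[OF f(1), of 0 k] f(2) by auto
  qed
  obtain c where c: "cycle c"
    using reach[OF \<open>v \<in> verts G\<close>] by auto
  have verts: "cycle_verts G d \<subseteq> verts G" "cycle_verts G d \<noteq> {}" if "cycle d" for d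
    using that by (auto simp: cycle_verts_def cycle_iff awalk_def)
  have unique: "\<exists>n. c' = rotate n c" if c': "cycle c'" for c'
  proof -
    obtain v w where v: "v \<in> cycle_verts G c" and w: "w \<in> cycle_verts G c'"
      using verts(2)[OF c] verts(2)[OF c'] by auto
    then obtain z p q where "awalk v p z" "awalk w q z"
      using confluent[OF subsetD[OF verts(1)[OF c] v] subsetD[OF verts(1)[OF c'] w]] by auto
    then have "z \<in> cycle_verts G c" "z \<in> cycle_verts G c'"
      using exit_free_awalk_end[OF c exit_free[OF c] _ v] exit_free_awalk_end[OF c' exit_free[OF c']
          _ w] by auto
    then show ?thesis
      by (rule exit_free_cycle_unique[OF c exit_free[OF c] c'])
  qed
  have same: "cycle_verts G c' = cycle_verts G c" if "cycle c'" for c'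
    using unique[OF that] by (auto simp: rotate_cycle_verts)
  have "tree G v \<inter> cycle_verts G c \<noteq> {}" if v: "v \<in> verts G" for v
  proof -
    obtain c' u p where "cycle c'" "u \<in> cycle_verts G c'" "awalk v p u"
      using reach[OF v] by auto
    then show ?thesis
      using same by (auto simp: tree_def reachable_awalk)
  qed
  moreover have "ends_in_cycle f c" if f: "infinite_path G f" for f
  proof -
    obtain c' k where "cycle c'" "tail G (f k) \<in> cycle_verts G c'"
      using cycle_infinite_path[OF f not_inj[OF f]] .
    then show ?thesis
      using exit_free_infinite_path[OF c exit_free[OF c] f, of k] same by auto
  qed
  ultimately show ?thesis
    unfolding comet_def using c unique by blast
qed

end

section \<open>Scalar centroids\<close>

context leavitt
begin

text \<open>Without a common descendant no monomial starts at \<open>v\<close> and ends at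
  \<open>w\<close>, so \<open>V v * A * V w\<close> is 0. Annihilators are taken instead of the
  ideals generated by \<open>v\<close> and \<open>w\<close>: \<open>I\<close> consists of the
  \<open>x\<close> with \<open>x * A * V w = 0\<close> and \<open>J\<close> is the right annihilator
  of \<open>I\<close>. Their product is 0 by definition, and they contain \<open>V v\<close> and
  \<open>V w\<close>.\<close>

lemma prime_confluent:
  assumes prime: "prime_algebra alg" and v: "v \<in> verts E" and w: "w \<in> verts E"
  shows "\<exists>z p q. awalk v p z \<and> awalk w q z"
proof (rule ccontr)
  assume none: "\<nexists>z p q. awalk v p z \<and> awalk w q z"
  have zero: "V v * x * V w = 0" if x: "x \<in> A" for x
  proof -
    obtain P where P: "finite P" "\<forall>(p, q) \<in> P. \<exists>z. awalk v p z \<and> awalk w q z"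
      "V v * x * V w \<in> span ((\<lambda>(p, q). mon v p w q) ` P)"
      using corner_span[OF x v w] .
    moreover have "P = {}"
    proof (rule ccontr)
      assume "P \<noteq> {}"
      then obtain p q where "(p, q) \<in> P"
        by auto
      then show False
        using bspec[OF P(2)] none by auto
    qed
    ultimately show ?thesis
      by simp
  qed
  define I where "I = {x \<in> A. \<forall>a\<in>A. x * a * V w = 0}"
  define J where "J = {y \<in> A. \<forall>x\<in>I. x * y = 0}"
  have I: "nu_ideal alg I"
  proof (rule nu_ideal_algI)
    show "x * b \<in> I" if "b \<in> A" "x \<in> I" for b x
    proof -
      have "x * (b * a) * V w = 0" if "a \<in> A" for a
        using \<open>x \<in> I\<close> A_mult[OF \<open>b \<in> A\<close> that] unfolding I_def by blast
      then have "x * b * a * V w = 0" if "a \<in> A" for a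
        using that by (simp only: mult.assoc)
      then show ?thesis
        using that by (simp add: I_def A_mult)
    qed
  qed (auto simp: I_def A_0 A_add A_scale A_mult distrib_right scale_mult_left mult.assoc)
  have J: "nu_ideal alg J"
  proof (rule nu_ideal_algI)
    show "a * y \<in> J" if "a \<in> A" "y \<in> J" for a y
    proof -
      have "x * a \<in> I" if "x \<in> I" for x
        using I \<open>a \<in> A\<close> that by (auto simp: nu_ideal_def alg_def)
      then show ?thesis
        using that by (auto simp: J_def A_mult simp flip: mult.assoc)
    qed
  qed (auto simp: J_def A_0 A_add A_scale A_mult distrib_left scale_mult_right simp flip:
      mult.assoc)
  have "\<forall>x\<in>I. \<forall>y\<in>J. nu_mult alg x y = nu_zero alg"
    by (auto simp: alg_def J_def)
  then have "I = {nu_zero alg} \<or> J = {nu_zero alg}"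
    using prime I J unfolding prime_algebra_def by blast
  moreover have "V v \<in> I"
    using zero V_in_A[OF v] by (simp add: I_def)
  moreover have "V w \<in> J"
  proof -
    have "x * V w = 0" if "x \<in> I" for x
    proof -
      have "x * V w * V w = 0"
        using that V_in_A[OF w] unfolding I_def by blast
      then show ?thesis
        using w by (simp add: V_idem mult.assoc)
    qed
    then show ?thesis
      using V_in_A[OF w] by (simp add: J_def)
  qed
  ultimately show False
    using V_neq_0[OF v] V_neq_0[OF w] by (auto simp: alg_def)
qed

text \<open>The long path goes \<open>D\<close> times round the cycle and then leaves through
  \<open>f\<close>, an edge that the rounds do not contain.\<close>

lemma scalar_exit:
  assumes prime: "prime_algebra alg" and \<tau>: "cent \<tau>"
    and c: "cycle c" and f: "f \<in> arcs E" "tail E f \<in> cycle_verts E c" "f \<notin> set c"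
  shows "\<exists>k. \<forall>x\<in>A. \<tau> x = sc k x"
proof (rule scalar_fresh[OF prime \<tau>])
  show v: "tail E f \<in> verts E"
    using f by auto
  fix D
  obtain n where n: "awalk (tail E f) (rotate n c) (tail E f)"
    using cycle_rotate[OF c f(2)] by auto
  let ?\<beta> = "concat (replicate D (rotate n c))"
  have "awalk (tail E f) ?\<beta> (tail E f)"
    using n v by (induction D) (auto simp: awalk_simps intro: awalk_appendI simp del:
        awalk_append_iff)
  then have "awalk (tail E f) ([] @ ?\<beta> @ [f]) (head E f)"
    using f(1) by (auto intro: awalk_appendI arc_implies_awalk simp del: awalk_append_iff)
  moreover have "f \<notin> set ?\<beta>"
    using f(3) by simp
  moreover have "D \<le> length ?\<beta>"
  proof -
    have "c \<noteq> []"
      using c by (auto simp: cycle_iff)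
    then show ?thesis
      by (induction D) (auto simp: Suc_le_eq intro: le_less_trans)
  qed
  ultimately show "\<exists>\<alpha> \<beta> f' w. awalk (tail E f) (\<alpha> @ \<beta> @ [f']) w \<and> D \<le> length \<beta> \<and> f' \<notin> set \<beta>"
    by blast
qed

lemma scalar_injective_path:
  assumes prime: "prime_algebra alg" and \<tau>: "cent \<tau>" and f: "infinite_path E f" "inj f"
  shows "\<exists>k. \<forall>x\<in>A. \<tau> x = sc k x"
proof (rule scalar_fresh[OF prime \<tau>])
  show "tail E (f 0) \<in> verts E"
    using f(1) by (auto simp: infinite_path_def)
  fix D
  have "awalk (tail E (f 0)) ([] @ map f [0..<D] @ [f D]) (tail E (f (Suc D)))"
    using awalk_infinite_path[OF f(1), of 0 "Suc D"] by simp
  moreover have "f D \<notin> set (map f [0..<D])"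
    using f(2) by (auto dest: injD)
  moreover have "D \<le> length (map f [0..<D])"
    by simp
  ultimately show "\<exists>\<alpha> \<beta> f' w. awalk (tail E (f 0)) (\<alpha> @ \<beta> @ [f']) w \<and> D \<le> length \<beta> \<and> f' \<notin> set \<beta>"
    by blast
qed

text \<open>By contraposition: a single non-scalar \<open>\<tau>\<close> excludes infinite emitters,
  sinks, exits and injective infinite paths, which are the hypotheses of
  \<open>cometI\<close>.\<close>

theorem centroid_not_row_finite_comet:
  fixes K :: "'k itself"
  assumes prime: "prime_algebra alg" and not_comet: "\<not> (row_finite E \<and> comet E)"
  shows "algebra_isomorphic (centroid alg) (field_algebra K)"
proof (rule centroid_field[OF prime], rule ccontr)
  fix \<tau> assume \<tau>: "cent \<tau>" and not_scalar: "\<not> (\<exists>k. \<forall>x\<in>A. \<tau> x = sc k x)"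
  obtain v where v: "v \<in> verts E"
    using verts_nonempty[OF prime] ..
  have "row_finite E"
    unfolding row_finite_def using scalar_infinite_emitter[OF prime \<tau>] not_scalar by blast
  moreover have "comet E"
  proof (rule cometI[OF _ _ _ _ v])
    show "\<forall>v\<in>verts E. \<not> sink E v"
      using scalar_sink[OF prime \<tau>] not_scalar by blast
    show "exit_free c" if "cycle c" for c
      unfolding exit_free_def using scalar_exit[OF prime \<tau> that] not_scalar by blast
    show "\<not> inj f" if "infinite_path E f" for f
      using scalar_injective_path[OF prime \<tau> that] not_scalar by blast
  qed (rule prime_confluent[OF prime])
  ultimately show False
    using not_comet by blast
qed

end

section \<open>Row-finite comets\<close>

context leavitt_relations
begin

text \<open>Each generator has a left and a right vertex; naming them allows the three kinds of
  generators to be treated at once when a central family is moved past a generator.\<close>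

lemma generator_ends:
  assumes "g \<in> generators E"
  obtains a b where "a \<in> verts E" "b \<in> verts E" "V a * G g = G g" "G g * V b = G g"
    "g = Vertex a \<and> b = a \<or> (\<exists>e\<in>arcs E. g = Edge e \<and> a = tail E e \<and> b = head E e \<or>
        g = Ghost e \<and> a = head E e \<and> b = tail E e)"
  using assms unfolding generators_def
  by (elim UnE imageE)
    (metis V_idem, metis tail_mult_edge edge_mult_head tail_in_verts head_in_verts,
     metis head_mult_ghost ghost_mult_tail tail_in_verts head_in_verts)

lemma mon_mult_V:
  assumes "awalk v q z" "w \<in> verts E"
  shows "mon u p v q * V w = (if w = v then mon u p v q else 0)"
  using assms gst_mult_V[of v q z] gst_mult_V_other[of v q z w] by (simp add: mon_def mult.assoc)

text \<open>Sums of vertices are local units. The claim covers every larger finite set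
  \<open>U'\<close>, so that two elements can share one.\<close>

lemma local_unit:
  assumes "x \<in> A"
  shows "\<exists>U. finite U \<and> U \<subseteq> verts E \<and>
    (\<forall>U'. finite U' \<longrightarrow> U \<subseteq> U' \<longrightarrow> U' \<subseteq> verts E \<longrightarrow> (\<Sum>u\<in>U'. x * V u) = x)"
  using assms unfolding A_eq_span_monomials
proof (induction rule: span_induct_alt)
  case base
  then show ?case
    by (intro exI[of _ "{}"]) simp
next
  case (step k m y)
  then obtain u p v q z where m: "m = mon u p v q" "awalk v q z"
    by (auto simp: monomials_def)
  obtain U where U: "finite U" "U \<subseteq> verts E"
    "\<And>U'. \<lbrakk>finite U'; U \<subseteq> U'; U' \<subseteq> verts E\<rbrakk> \<Longrightarrow> (\<Sum>u\<in>U'. y * V u) = y"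
    using step.IH by auto
  have "(\<Sum>w\<in>U'. (sc k m + y) * V w) = sc k m + y"
    if "finite U'" "insert v U \<subseteq> U'" "U' \<subseteq> verts E" for U'
  proof -
    have "(\<Sum>w\<in>U'. m * V w) = (\<Sum>w\<in>U'. if w = v then m else 0)"
      using that m by (intro sum.cong) (auto simp: mon_mult_V)
    then have "(\<Sum>w\<in>U'. m * V w) = m"
      using that by simp
    moreover have "(\<Sum>w\<in>U'. (sc k m + y) * V w) = sc k (\<Sum>w\<in>U'. m * V w) + (\<Sum>w\<in>U'. y * V w)"
      by (simp add: distrib_right scale_mult_left sum.distrib scale_sum_right)
    ultimately show ?thesis
      using U(3) that by simp
  qed
  then show ?case
    using U m(2) by (intro exI[of _ "insert v U"]) auto
qed

lemma eq_by_vertices: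
  assumes "x \<in> A" "y \<in> A" and eq: "\<And>u. u \<in> verts E \<Longrightarrow> x * V u = y * V u"
  shows "x = y"
proof -
  obtain U where U: "finite U" "U \<subseteq> verts E"
    "\<And>U'. \<lbrakk>finite U'; U \<subseteq> U'; U' \<subseteq> verts E\<rbrakk> \<Longrightarrow> (\<Sum>u\<in>U'. x * V u) = x"
    using local_unit[OF assms(1)] by auto
  obtain W where W: "finite W" "W \<subseteq> verts E"
    "\<And>U'. \<lbrakk>finite U'; W \<subseteq> U'; U' \<subseteq> verts E\<rbrakk> \<Longrightarrow> (\<Sum>u\<in>U'. y * V u) = y"
    using local_unit[OF assms(2)] by auto
  have "x = (\<Sum>u\<in>U \<union> W. x * V u)"
    using U W by (intro U(3)[symmetric]) auto
  also have "\<dots> = (\<Sum>u\<in>U \<union> W. y * V u)"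
    using U W eq by (intro sum.cong) auto
  also have "\<dots> = y"
    using U W by (intro W(3)) auto
  finally show ?thesis .
qed

text \<open>Formally, \<open>\<tau>\<close> is multiplication by the possibly infinite sum of the
  \<open>z u\<close>. It makes sense because \<open>x * V u\<close> vanishes for all but finitely
  many \<open>u\<close>; accordingly \<open>\<tau> x\<close> is characterised by
  \<open>\<tau> x * V u = x * z u\<close> for all vertices \<open>u\<close>.\<close>

lemma central_family_cent:
  assumes z: "\<And>u. u \<in> verts E \<Longrightarrow> z u \<in> A"
    and Vz: "\<And>u. u \<in> verts E \<Longrightarrow> V u * z u = z u" and zV: "\<And>u. u \<in> verts E \<Longrightarrow> z u * V u = z u"
    and z_edge: "\<And>e. e \<in> arcs E \<Longrightarrow> z (tail E e) * Ed e = Ed e * z (head E e)"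
    and z_ghost: "\<And>e. e \<in> arcs E \<Longrightarrow> z (head E e) * Gh e = Gh e * z (tail E e)"
  shows "\<exists>\<tau>. cent \<tau> \<and> (\<forall>u\<in>verts E. \<tau> (V u) = z u)"
proof -
  have z_V: "z a * V u = (if a = u then z a else 0)" if "a \<in> verts E" "u \<in> verts E" for a u
  proof -
    have "z a * V u = z a * (V a * V u)"
      using zV[OF that(1)] by (simp flip: mult.assoc)
    then show ?thesis
      using that by (simp add: vertex_mult_vertex zV)
  qed
  have V_z: "V a * z u = (if a = u then z a else 0)" if "a \<in> verts E" "u \<in> verts E" for a u
  proof -
    have "V a * z u = V a * V u * z u"
      using Vz[OF that(2)] by (simp add: mult.assoc)
    then show ?thesis
      using that by (simp add: vertex_mult_vertex Vz)
  qed
  have "\<exists>y\<in>A. \<forall>u\<in>verts E. y * V u = x * z u" if "x \<in> A" for x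
    using that unfolding A_eq_span_monomials
  proof (induction rule: span_induct_alt)
    case base
    then show ?case
      by (intro bexI[of _ 0]) (simp_all add: span_zero)
  next
    case (step k m x)
    then obtain y where y: "y \<in> A" "\<And>u. u \<in> verts E \<Longrightarrow> y * V u = x * z u"
      unfolding A_eq_span_monomials by blast
    obtain a p v q w where m: "m = mon a p v q" "awalk v q w"
      using step by (auto simp: monomials_def)
    have mA: "m \<in> A"
      unfolding A_eq_span_monomials by (rule span_base) (use step in auto)
    have v: "v \<in> verts E"
      using m by auto
    have "m * z v * V u = m * z u" if "u \<in> verts E" for u
    proof -
      have "m * z u = m * V v * z u"
        using m by (simp add: mon_mult_V v)
      then show ?thesis
        using that v by (auto simp: z_V V_z mult.assoc)
    qed
    then have "(sc k (m * z v) + y) * V u = (sc k m + x) * z u" if "u \<in> verts E" for u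
      using that y by (simp add: distrib_right scale_mult_left)
    moreover have "sc k (m * z v) + y \<in> A"
      using mA v z y by (intro A_add A_scale A_mult)
    ultimately show ?case
      unfolding A_eq_span_monomials by blast
  qed
  \<comment> \<open>Any choice will do: by \<open>eq_by_vertices\<close> the property determines
    \<open>t x\<close>, and linearity and both multiplication laws follow by comparing products with
    vertices.\<close>
  then obtain t where t: "\<And>x. x \<in> A \<Longrightarrow> t x \<in> A" "\<And>x u. \<lbrakk>x \<in> A; u \<in> verts E\<rbrakk> \<Longrightarrow> t x * V u = x * z u"
    by metis
  \<comment> \<open>\<open>x'\<close> is arbitrary rather than \<open>t x\<close>, because the
    induction over words below replaces \<open>x'\<close> and \<open>x\<close> by
    \<open>x' * G g\<close> and \<open>x * G g\<close>.\<close>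
  have gen: "x' * G g * V u = x * G g * z u"
    if x: "\<And>u. u \<in> verts E \<Longrightarrow> x' * V u = x * z u" and g: "g \<in> generators E" and u: "u \<in> verts E"
        for x x' g u
  proof -
    obtain a b where ab: "a \<in> verts E" "b \<in> verts E" "V a * G g = G g" "G g * V b = G g"
      and *: "g = Vertex a \<and> b = a \<or> (\<exists>e\<in>arcs E. g = Edge e \<and> a = tail E e \<and> b = head E e \<or>
        g = Ghost e \<and> a = head E e \<and> b = tail E e)"
      using generator_ends[OF g] .
    have zG: "z a * G g = G g * z b"
      using * z_edge z_ghost Vz zV ab by auto
    have "x' * G g * V u = x' * V a * G g * V u"
      using ab by (simp add: mult.assoc)
    also have "\<dots> = x * (z a * G g) * V u"
      using x ab by (simp add: mult.assoc)
    also have "\<dots> = x * G g * (z b * V u)"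
      unfolding zG by (simp add: mult.assoc)
    also have "\<dots> = x * G g * (V b * z u)"
      using ab u by (simp add: z_V V_z)
    also have "\<dots> = x * G g * z u"
      using ab by (simp add: mult.assoc flip: mult.assoc[of "G g" "V b"])
    finally show ?thesis .
  qed
  have wrd: "x' * word w * V u = x * word w * z u"
    if "\<And>u. u \<in> verts E \<Longrightarrow> x' * V u = x * z u" "w \<noteq> []" "set w \<subseteq> generators E" "u \<in> verts E"
        for x x' w u
    using that
  proof (induction w arbitrary: x x' rule: word.induct)
    case (2 g)
    then show ?case
      using gen by simp
  next
    case (3 g h w)
    have "x' * G g * word (h # w) * V u = x * G g * word (h # w) * z u"
      using 3 gen[OF 3(2)] by (intro "3.IH") auto
    then show ?case
      by (simp add: mult.assoc)
  qed simp
  have left: "t x * y * V u = x * y * z u" if x: "x \<in> A" and y: "y \<in> A" and u: "u \<in> verts E"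
      for x y u
    using y unfolding A_def
  proof (induction rule: span_induct_alt)
    case (step k m y)
    then obtain w where "m = word w" "w \<noteq> []" "set w \<subseteq> generators E"
      by auto
    then have "t x * m * V u = x * m * z u"
      using wrd[OF t(2)[OF x]] u by simp
    then show ?case
      using step.IH by (simp add: distrib_left distrib_right scale_mult_left scale_mult_right)
  qed simp
  have "cent (restrict t A)"
  proof (rule centI; simp add: A_add A_scale A_mult t(1))
    fix x y k assume x: "x \<in> A"
    show "t (sc k x) = sc k (t x)"
      by (rule eq_by_vertices) (use x in \<open>auto simp: t A_scale scale_mult_left\<close>)
    assume y: "y \<in> A"
    show "t (x + y) = t x + t y"
      by (rule eq_by_vertices) (use x y in \<open>auto simp: t A_add distrib_right\<close>)
    show "t (x * y) = t x * y"
      by (rule eq_by_vertices) (use x y in \<open>auto simp: t A_mult left\<close>)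
    show "t (x * y) = x * t y"
      by (rule eq_by_vertices) (use x y in \<open>auto simp: t A_mult mult.assoc\<close>)
  qed
  moreover have "restrict t A (V u) = z u" if "u \<in> verts E" for u
    by (rule eq_by_vertices) (use that in \<open>auto simp: t V_in_A z z_V V_z\<close>)
  ultimately show ?thesis
    by blast
qed

end

text \<open>Uniqueness of the cycle and reachability enter only through \<open>exit_free\<close>,
  which \<open>unique_cycle_exit_free\<close> derives from them. The vertex \<open>v\<close> is the
  one at which the list \<open>c\<close> starts.\<close>

locale leavitt_comet = leavitt E sc G
  for E :: "('v, 'e) pre_digraph" and sc :: "'k :: field \<Rightarrow> 'r :: ring \<Rightarrow> 'r" and G ::
      "('v, 'e) generator \<Rightarrow> 'r" +
  fixes c :: "'e list" and v :: 'v
  assumes row_finite: "row_finite E" and cycle: "cycle c" and exit_free: "exit_free c"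
    and closed: "awalk v c v" and ends: "infinite_path E f \<Longrightarrow> ends_in_cycle f c"
begin

section \<open>Extending the cycle to central families\<close>

abbreviation C where "C \<equiv> cycle_verts E c"

lemma C_verts: "C \<subseteq> verts E"
  using cycle by (auto simp: cycle_verts_def cycle_iff awalk_def)

lemma c_not_Nil: "c \<noteq> []"
  using cycle by (auto simp: cycle_iff)

lemma v_in_C: "v \<in> C"
  using closed c_not_Nil by (cases c) (auto simp: cycle_verts_def awalk_simps)

lemma finite_out_arcs: "u \<in> verts E \<Longrightarrow> finite (out_arcs E u)"
  using row_finite by (auto simp: row_finite_def infinite_emitter_def)

text \<open>A vertex of the cycle emits a single edge, so its relation
  \<open>v = \<Sum> e e\<^sup>*\<close> has one summand. Hence edges on the cycle are invertible
  from both sides.\<close>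

lemma edge_mult_ghost:
  assumes e: "e \<in> arcs E" "tail E e \<in> C"
  shows "Ed e * Gh e = V (tail E e)"
proof -
  have "out_arcs E (tail E e) = {e}"
    using exit_free_arc_unique[OF cycle exit_free e(1) _ e(2)] e by (auto simp: out_arcs_def)
  moreover from this have "regular_vertex E (tail E e)"
    using e by (auto simp: regular_vertex_def sink_def infinite_emitter_def)
  ultimately show ?thesis
    using vertex_eq_sum[of "tail E e"] by simp
qed

lemma pth_mult_gst: "\<lbrakk>awalk u p w; u \<in> C\<rbrakk> \<Longrightarrow> pth u p * gst u p = V u"
proof (induction p arbitrary: u)
  case Nil
  then show ?case
    by (auto simp: awalk_simps V_idem)
next
  case (Cons e p)
  then have e: "e \<in> arcs E" "tail E e = u" "awalk (head E e) p w"
    by (auto simp: awalk_simps)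
  have "pth u (e # p) * gst u (e # p) = Ed e * (pth (head E e) p * gst (head E e) p) * Gh e"
    by (simp add: mult.assoc)
  also have "\<dots> = Ed e * V (head E e) * Gh e"
    using Cons e exit_free_head[OF cycle exit_free] by simp
  also have "\<dots> = V u"
    using e Cons.prems edge_mult_ghost[of e] by (simp add: edge_mult_head)
  finally show ?case .
qed

lemma awalk_unique: "\<lbrakk>u \<in> C; awalk u p x; awalk u q y; length p = length q\<rbrakk> \<Longrightarrow> p = q"
  using exit_free_awalk_prefix[OF cycle exit_free, of u p x q y] by auto

text \<open>For \<open>u\<close> on the cycle this is the rotation of \<open>c\<close> that starts
  at \<open>u\<close>; by \<open>awalk_unique\<close> there is no other choice.\<close>

definition cyc :: "'v \<Rightarrow> 'e list" where
  "cyc u = (SOME p. awalk u p u \<and> length p = length c)"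

lemma cyc: assumes "u \<in> C" shows "awalk u (cyc u) u" "length (cyc u) = length c"
proof -
  have "\<exists>p. awalk u p u \<and> length p = length c"
    using cycle_rotate[OF cycle assms] length_rotate by metis
  from someI_ex[OF this] show "awalk u (cyc u) u" "length (cyc u) = length c"
    by (auto simp: cyc_def)
qed

text \<open>Advancing the base point along \<open>e\<close> moves \<open>e\<close> from the front of
  the cycle to its end. This is what makes the cycles at the various vertices commute with the edges
  of \<open>c\<close>.\<close>

lemma cyc_Cons:
  assumes e: "e \<in> arcs E" "tail E e \<in> C"
  obtains p where "cyc (tail E e) = e # p" "cyc (head E e) = p @ [e]"
      "awalk (head E e) p (tail E e)"
proof -
  have ne: "cyc (tail E e) \<noteq> []"
    using cyc[OF e(2)] c_not_Nil by auto
  then obtain f p where fp: "cyc (tail E e) = f # p"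
    by (cases "cyc (tail E e)") auto
  then have f: "f \<in> arcs E" "tail E f = tail E e" "awalk (head E f) p (tail E e)"
    using cyc(1)[OF e(2)] by (auto simp: awalk_simps)
  then have "f = e"
    using exit_free_arc_unique[OF cycle exit_free e(1) _ e(2)] by auto
  have "cyc (head E e) = p @ [e]"
  proof (rule awalk_unique)
    show h: "head E e \<in> C"
      using exit_free_head[OF cycle exit_free] e by auto
    show "awalk (head E e) (cyc (head E e)) (head E e)"
      by (rule cyc[OF h])
    show "awalk (head E e) (p @ [e]) (head E e)"
      using f e \<open>f = e\<close> by (auto intro: awalk_appendI arc_implies_awalk simp del: awalk_append_iff)
    show "length (cyc (head E e)) = length (p @ [e])"
      using cyc(2)[OF h] cyc(2)[OF e(2)] fp by simp
  qed
  then show thesis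
    using that fp f \<open>f = e\<close> by auto
qed

definition descent :: "('v \<times> 'v) set" where
  "descent = {(head E e, tail E e) | e. e \<in> arcs E \<and> tail E e \<notin> C}"

text \<open>An infinite descending chain is an infinite path none of whose edges starts on the
  cycle.\<close>

lemma wf_descent: "wf descent"
  unfolding wf_iff_no_infinite_down_chain
proof
  assume "\<exists>g. \<forall>i. (g (Suc i), g i) \<in> descent"
  then obtain g where g: "\<And>i. (g (Suc i), g i) \<in> descent"
    by auto
  have "\<exists>e. e \<in> arcs E \<and> tail E e \<notin> C \<and> head E e = g (Suc i) \<and> tail E e = g i" for i
  proof -
    obtain e where "e \<in> arcs E" "tail E e \<notin> C" "(g (Suc i), g i) = (head E e, tail E e)"
      using g[of i] unfolding descent_def by blast
    then show ?thesis
      by (intro exI[of _ e]) simp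
  qed
  then obtain f where f: "\<And>i. f i \<in> arcs E \<and> tail E (f i) \<notin> C \<and> head E (f i) = g (Suc i) \<and>
      tail E (f i) = g i"
    by metis
  then have "ends_in_cycle f c"
    by (intro ends) (simp add: infinite_path_def)
  then obtain i where "f i \<in> set c"
    by (auto simp: ends_in_cycle_def)
  then show False
    using f by (auto simp: cycle_verts_def)
qed

text \<open>The recursion off the cycle is forced: commutation with the edges gives \<open>z\<^sub>u
  = z\<^sub>u \<Sum> e e\<^sup>* = \<Sum> e z e\<^sup>*\<close> at a regular vertex. Conversely,
  multiplication by an edge or a ghost edge selects one summand, by
  \<open>ghost_mult_edge\<close>.\<close>

lemma extend_central_family:
  assumes z0: "\<And>u. u \<in> C \<Longrightarrow> z0 u \<in> A"
    "\<And>u. u \<in> C \<Longrightarrow> V u * z0 u = z0 u" "\<And>u. u \<in> C \<Longrightarrow> z0 u * V u = z0 u"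
    and z0_edge: "\<And>e. \<lbrakk>e \<in> arcs E; tail E e \<in> C\<rbrakk> \<Longrightarrow> z0 (tail E e) * Ed e = Ed e * z0 (head E e)"
    and z0_ghost: "\<And>e. \<lbrakk>e \<in> arcs E; tail E e \<in> C\<rbrakk> \<Longrightarrow> z0 (head E e) * Gh e = Gh e * z0 (tail E e)"
  shows "\<exists>\<tau>. cent \<tau> \<and> (\<forall>u\<in>C. \<tau> (V u) = z0 u)"
proof -
  define F where "F z u = (if u \<in> C then z0 u else \<Sum>e\<in>out_arcs E u. Ed e * z (head E e) * Gh e)"
      for z u
  define z where "z = wfrec descent F"
  have z_rec: "z u = F (cut z descent u) u" for u
    unfolding z_def by (rule wfrec[OF wf_descent])
  have z_C: "z u = z0 u" if "u \<in> C" for u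
    using z_rec[of u] that by (simp add: F_def)
  have z_not_C: "z u = (\<Sum>e\<in>out_arcs E u. Ed e * z (head E e) * Gh e)" if "u \<notin> C" for u
  proof -
    have "cut z descent u (head E e) = z (head E e)" if "e \<in> out_arcs E u" for e
      using that \<open>u \<notin> C\<close> by (intro cut_apply) (auto simp: descent_def out_arcs_def)
    then show ?thesis
      using z_rec[of u] that by (simp add: F_def)
  qed
  have z: "u \<in> verts E \<longrightarrow> z u \<in> A \<and> V u * z u = z u \<and> z u * V u = z u" for u
  proof (induction u rule: wf_induct_rule[OF wf_descent])
    case (1 u)
    show ?case
    proof (cases "u \<in> C")
      case False
      have IH: "z (head E e) \<in> A" if "e \<in> out_arcs E u" for e
        using 1[of "head E e"] that False by (auto simp: descent_def out_arcs_def)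
      have "V u * (Ed e * z (head E e) * Gh e) = Ed e * z (head E e) * Gh e"
        "Ed e * z (head E e) * Gh e * V u = Ed e * z (head E e) * Gh e" if "e \<in> out_arcs E u" for e
        using that tail_mult_edge[of e] ghost_mult_tail[of e]
        by (simp_all add: out_arcs_def flip: mult.assoc) (simp add: mult.assoc)
      then show ?thesis
        using IH unfolding z_not_C[OF False]
        by (auto simp: sum_distrib_left sum_distrib_right out_arcs_def
            intro!: A_sum A_mult Ed_in_A Gh_in_A sum.cong)
    qed (simp add: z_C z0)
  qed
  have "\<exists>\<tau>. cent \<tau> \<and> (\<forall>u\<in>verts E. \<tau> (V u) = z u)"
  proof (rule central_family_cent)
    fix e assume e: "e \<in> arcs E"
    have heads: "Gh e' * Ed e = (if e' = e then V (head E e) else 0)"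
        "Gh e * Ed e' = (if e' = e then V (head E e) else 0)"
      if "e' \<in> out_arcs E (tail E e)" for e'
      using that e by (auto simp: ghost_mult_edge out_arcs_def)
    have out: "e \<in> out_arcs E (tail E e)" and fin: "finite (out_arcs E (tail E e))"
      using e finite_out_arcs by (auto simp: out_arcs_def)
    have zh: "z (head E e) * V (head E e) = z (head E e)"
        "V (head E e) * z (head E e) = z (head E e)"
      using z e by auto
    show "z (tail E e) * Ed e = Ed e * z (head E e)"
    proof (cases "tail E e \<in> C")
      case True
      then show ?thesis
        using z0_edge e exit_free_head[OF cycle exit_free e] by (simp add: z_C)
    next
      case False
      have "z (tail E e) * Ed e = (\<Sum>e'\<in>out_arcs E (tail E e). Ed e' * z (head E e') * (Gh e' * Ed
          e))"
        by (simp add: z_not_C[OF False] sum_distrib_right mult.assoc)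
      also have "\<dots> = (\<Sum>e'\<in>out_arcs E (tail E e). if e' = e then Ed e * z (head E e) else 0)"
        using zh by (intro sum.cong) (auto simp: heads mult.assoc)
      finally show ?thesis
        using out fin by simp
    qed
    show "z (head E e) * Gh e = Gh e * z (tail E e)"
    proof (cases "tail E e \<in> C")
      case True
      then show ?thesis
        using z0_ghost e exit_free_head[OF cycle exit_free e] by (simp add: z_C)
    next
      case False
      have "Gh e * z (tail E e) = (\<Sum>e'\<in>out_arcs E (tail E e). Gh e * Ed e' * (z (head E e') * Gh
          e'))"
        by (simp add: z_not_C[OF False] sum_distrib_left mult.assoc)
      also have "\<dots> = (\<Sum>e'\<in>out_arcs E (tail E e). if e' = e then z (head E e) * Gh e else 0)"
        using zh by (intro sum.cong) (auto simp: heads simp flip: mult.assoc)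
      finally show ?thesis
        using out fin by simp
    qed
  qed (use z in auto)
  then show ?thesis
    using z_C C_verts by (metis subsetD)
qed

lemma cent_cycle: "\<exists>\<tau>. cent \<tau> \<and> \<tau> (V v) = pth v c"
proof -
  have "\<exists>\<tau>. cent \<tau> \<and> (\<forall>u\<in>C. \<tau> (V u) = pth u (cyc u))"
  proof (rule extend_central_family)
    show "pth u (cyc u) \<in> A" "V u * pth u (cyc u) = pth u (cyc u)"
        "pth u (cyc u) * V u = pth u (cyc u)"
      if "u \<in> C" for u
      using cyc(1)[OF that] by (auto intro: pth_in_A V_mult_pth pth_mult_V)
    fix e assume e: "e \<in> arcs E" "tail E e \<in> C"
    obtain p where p: "cyc (tail E e) = e # p" "cyc (head E e) = p @ [e]"
        "awalk (head E e) p (tail E e)"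
      using cyc_Cons[OF e] .
    have pe: "pth (head E e) (p @ [e]) = pth (head E e) p * Ed e"
      using pth_append[OF p(3) arc_implies_awalk[OF e(1)]] e by (simp add: edge_mult_head)
    show "pth (tail E e) (cyc (tail E e)) * Ed e = Ed e * pth (head E e) (cyc (head E e))"
      by (simp add: p(1,2) pe mult.assoc)
    have "Gh e * pth (tail E e) (cyc (tail E e)) = Gh e * Ed e * pth (head E e) p"
      by (simp add: p(1) mult.assoc)
    also have "\<dots> = pth (head E e) p"
      using e p by (simp add: ghost_mult_edge V_mult_pth)
    also have "\<dots> = pth (head E e) p * (Ed e * Gh e)"
      using e p by (simp add: edge_mult_ghost pth_mult_V)
    finally show "pth (head E e) (cyc (head E e)) * Gh e = Gh e * pth (tail E e) (cyc (tail E e))"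
      by (simp add: p(2) pe mult.assoc)
  qed
  moreover have "cyc v = c"
    using awalk_unique[OF v_in_C cyc(1)[OF v_in_C] closed] cyc(2)[OF v_in_C] by simp
  ultimately show ?thesis
    using v_in_C by auto
qed

lemma cent_cycle_inverse: "\<exists>\<tau>. cent \<tau> \<and> \<tau> (V v) = gst v c"
proof -
  have "\<exists>\<tau>. cent \<tau> \<and> (\<forall>u\<in>C. \<tau> (V u) = gst u (cyc u))"
  proof (rule extend_central_family)
    show "gst u (cyc u) \<in> A" "V u * gst u (cyc u) = gst u (cyc u)"
        "gst u (cyc u) * V u = gst u (cyc u)"
      if "u \<in> C" for u
      using cyc(1)[OF that] by (auto intro: gst_in_A V_mult_gst gst_mult_V)
    fix e assume e: "e \<in> arcs E" "tail E e \<in> C"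
    obtain p where p: "cyc (tail E e) = e # p" "cyc (head E e) = p @ [e]"
        "awalk (head E e) p (tail E e)"
      using cyc_Cons[OF e] .
    have pe: "gst (head E e) (p @ [e]) = Gh e * gst (head E e) p"
      using gst_append[OF p(3) arc_implies_awalk[OF e(1)]] e by (simp add: head_mult_ghost)
    have "gst (tail E e) (cyc (tail E e)) * Ed e = gst (head E e) p * (Gh e * Ed e)"
      by (simp add: p(1) mult.assoc)
    also have "\<dots> = gst (head E e) p"
      using e p by (simp add: ghost_mult_edge gst_mult_V)
    also have "\<dots> = (Ed e * Gh e) * gst (head E e) p"
      using e p by (simp add: edge_mult_ghost V_mult_gst)
    finally show "gst (tail E e) (cyc (tail E e)) * Ed e = Ed e * gst (head E e) (cyc (head E e))"
      by (simp add: p(2) pe mult.assoc)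
    show "gst (head E e) (cyc (head E e)) * Gh e = Gh e * gst (tail E e) (cyc (tail E e))"
      by (simp add: p(1,2) pe mult.assoc)
  qed
  moreover have "cyc v = c"
    using awalk_unique[OF v_in_C cyc(1)[OF v_in_C] closed] cyc(2)[OF v_in_C] by simp
  ultimately show ?thesis
    using v_in_C by auto
qed

section \<open>Laurent polynomials in the cycle\<close>

definition cpow :: "nat \<Rightarrow> 'e list" where
  "cpow n = concat (replicate n c)"

lemma cpow_Suc: "cpow (Suc n) = c @ cpow n" and cpow_Suc': "cpow (Suc n) = cpow n @ c"
  and cpow_0: "cpow 0 = []"
proof -
  show "cpow (Suc n) = c @ cpow n" for n
    by (simp add: cpow_def)
  then show "cpow (Suc n) = cpow n @ c"
    by (induction n) (simp_all add: cpow_def)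
qed (simp add: cpow_def)

lemma v_in_verts: "v \<in> verts E"
  using closed by auto

lemma awalk_cpow: "awalk v (cpow n) v"
  by (induction n) (auto simp: cpow_Suc cpow_0 awalk_simps v_in_verts intro: awalk_appendI[OF
      closed] simp del: awalk_append_iff)

lemma length_cpow: "length (cpow n) = n * length c"
  by (induction n) (auto simp: cpow_Suc cpow_0)

text \<open>In the corner at \<open>v\<close> the cycle is invertible with its ghost as inverse:
  \<open>c\<^sup>* c = v\<close> holds for every closed path, and \<open>c c\<^sup>* = v\<close>
  because the cycle has no exit.\<close>

definition zpow :: "int \<Rightarrow> 'r" where
  "zpow n = (if n \<ge> 0 then pth v (cpow (nat n)) else gst v (cpow (nat (- n))))"

lemma zpow_of_nat: "zpow (int n) = pth v (cpow n)"
  by (simp add: zpow_def)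

lemma zpow_minus_nat: "zpow (- int n) = gst v (cpow n)"
  by (cases "n = 0") (simp_all add: zpow_def cpow_0)

lemma V_mult_zpow: "V v * zpow n = zpow n"
  by (simp add: zpow_def V_mult_pth[OF awalk_cpow] V_mult_gst[OF awalk_cpow])

lemma zpow_in_A: "zpow n \<in> A"
  using awalk_cpow by (auto simp: zpow_def intro: pth_in_A gst_in_A)

lemma zpow_succ: "zpow (n + 1) = pth v c * zpow n"
proof (cases n rule: int_cases2)
  case (nonneg k)
  then show ?thesis
    using pth_append[OF closed awalk_cpow] zpow_of_nat[of "Suc k"]
    by (simp add: zpow_of_nat cpow_Suc add.commute)
next
  case (nonpos k)
  show ?thesis
  proof (cases k)
    case 0
    then show ?thesis
      using nonpos zpow_of_nat[of 1] closed by (simp add: zpow_def cpow_Suc cpow_0 pth_mult_V)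
  next
    case (Suc m)
    have "pth v c * zpow n = pth v c * gst v c * gst v (cpow m)"
      using gst_append[OF awalk_cpow closed] Suc nonpos zpow_minus_nat[of k]
      by (simp add: cpow_Suc' mult.assoc)
    also have "\<dots> = zpow (- int m)"
      using closed v_in_C awalk_cpow by (simp add: pth_mult_gst V_mult_gst zpow_minus_nat)
    finally show ?thesis
      using nonpos Suc by simp
  qed
qed

lemma zpow_pred: "zpow (n - 1) = gst v c * zpow n"
proof -
  have "gst v c * zpow n = gst v c * pth v c * zpow (n - 1)"
    using zpow_succ[of "n - 1"] by (simp add: mult.assoc)
  then show ?thesis
    using closed by (simp add: gst_mult_pth V_mult_zpow)
qed

lemma zpow_add: "zpow (m + n) = zpow m * zpow n"
proof (induction m rule: int_induct[where k = 0])
  case base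
  then show ?case
    using V_mult_zpow by (simp add: zpow_def[of 0] cpow_0)
next
  case (step1 m)
  then show ?case
    using zpow_succ[of "m + n"] zpow_succ[of m] by (simp add: algebra_simps)
next
  case (step2 m)
  then show ?case
    using zpow_pred[of "m + n"] zpow_pred[of m] by (simp add: algebra_simps)
qed

definition ev :: "(int \<Rightarrow>\<^sub>0 'k) \<Rightarrow> 'r" where
  "ev f = (\<Sum>n\<in>Poly_Mapping.keys f. sc (Poly_Mapping.lookup f n) (zpow n))"

lemma ev_add: "ev (f + g) = ev f + ev g"
  unfolding ev_def by (rule setsum_keys_plus_distrib) (simp_all add: scale_left_distrib)

lemma ev_single: "ev (Poly_Mapping.single n a) = sc a (zpow n)"
  by (simp add: ev_def)

lemma ev_1: "ev 1 = V v"
  using ev_single[of 0 1] by (simp add: zpow_def cpow_0)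

lemma ev_0: "ev 0 = 0"
  by (simp add: ev_def)

lemma ev_diff: "ev (f - g) = ev f - ev g"
  using ev_add[of "f - g" g] by simp

lemma ev_scale: "ev (Poly_Mapping.map ((*) k) f) = sc k (ev f)"
proof (induction f rule: poly_mapping_additive_induct)
  case (add p q)
  then show ?case
    by (simp add: mult_map_scale_conv_mult distrib_left ev_add scale_right_distrib)
qed (simp_all add: ev_0 ev_single scale_scale mult_map_scale_conv_mult[of k 0])

lemma ev_mult: "ev (f * g) = ev f * ev g"
proof (induction f rule: poly_mapping_additive_induct)
  case (single m a)
  show ?case
  proof (induction g rule: poly_mapping_additive_induct)
    case (single n b)
    then show ?case
      by (simp add: mult_single ev_single zpow_add scale_mult_left scale_mult_right mult.commute)
  qed (simp_all add: ev_0 ev_add distrib_left)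
qed (simp_all add: ev_0 ev_add distrib_right)

lemma ev_in_A: "ev f \<in> A"
  unfolding ev_def by (intro A_sum A_scale zpow_in_A)

text \<open>The functionals only know paths, so \<open>ev f\<close> is first multiplied by the
  \<open>N\<close>-th power of the cycle, which makes all exponents in question nonnegative. The
  functional of degree \<open>(m + N) * length c\<close> then reads off the coefficient at
  \<open>m\<close>.\<close>

lemma ev_eq_0:
  assumes "ev f = 0"
  shows "f = 0"
proof (rule poly_mapping_eqI)
  fix m
  define N where "N = (\<Sum>n\<in>insert m (Poly_Mapping.keys f). nat \<bar>n\<bar>)"
  have N: "n + int N \<ge> 0" if "n \<in> insert m (Poly_Mapping.keys f)" for n
  proof -
    have "nat \<bar>n\<bar> \<le> N"
      unfolding N_def by (rule member_le_sum[OF that]) auto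
    then show ?thesis
      by linarith
  qed
  obtain \<phi> where "(\<forall>x\<in>A. \<forall>y\<in>A. \<phi> (x + y) = \<phi> x + \<phi> y) \<and> (\<forall>k. \<forall>x\<in>A. \<phi> (sc k x) = k * \<phi> x) \<and>
    (\<forall>p. awalk v p v \<longrightarrow> \<phi> (pth v p) = (if length p = nat (m + int N) * length c then 1 else 0))"
    using functional[OF v_in_verts, of "nat (m + int N) * length c"] ..
  then have \<phi>: "\<And>x y. \<lbrakk>x \<in> A; y \<in> A\<rbrakk> \<Longrightarrow> \<phi> (x + y) = \<phi> x + \<phi> y"
    "\<And>k x. x \<in> A \<Longrightarrow> \<phi> (sc k x) = k * \<phi> x"
    "\<And>p. awalk v p v \<Longrightarrow> \<phi> (pth v p) = (if length p = nat (m + int N) * length c then 1 else 0)"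
    by auto
  have \<phi>_0: "\<phi> 0 = 0"
    using \<phi>(2)[of 0 0] A_0 by simp
  have \<phi>_zpow: "\<phi> (zpow (n + int N)) = (if n = m then 1 else 0)"
      if "n \<in> insert m (Poly_Mapping.keys f)" for n
    using N[OF that] N[of m] awalk_cpow c_not_Nil by (auto simp: zpow_def \<phi> length_cpow)
  have \<phi>_sum: "\<phi> (\<Sum>n\<in>S. sc (Poly_Mapping.lookup f n) (zpow (n + int N)))
      = (\<Sum>n\<in>S. Poly_Mapping.lookup f n * \<phi> (zpow (n + int N)))"
    if "finite S" for S
    using that
  proof (induction S rule: finite_induct)
    case (insert n S)
    then show ?case
      by (simp add: \<phi> A_sum A_scale zpow_in_A)
  qed (simp add: \<phi>_0)
  have "ev f * zpow (int N) = (\<Sum>n\<in>Poly_Mapping.keys f. sc (Poly_Mapping.lookup f n) (zpow (n + int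
      N)))"
    by (simp add: ev_def sum_distrib_right scale_mult_left zpow_add)
  then have "0 = \<phi> (\<Sum>n\<in>Poly_Mapping.keys f. sc (Poly_Mapping.lookup f n) (zpow (n + int N)))"
    using assms \<phi>_0 by simp
  also have "\<dots> = (\<Sum>n\<in>Poly_Mapping.keys f. if n = m then Poly_Mapping.lookup f m else 0)"
    unfolding \<phi>_sum[OF finite_keys] by (intro sum.cong) (auto simp: \<phi>_zpow)
  also have "\<dots> = Poly_Mapping.lookup f m"
    by (simp add: in_keys_iff)
  finally show "Poly_Mapping.lookup f m = Poly_Mapping.lookup 0 m"
    by simp
qed

lemma inj_ev: "inj ev"
proof (rule injI)
  fix f g assume "ev f = ev g"
  then have "f - g = 0"
    by (intro ev_eq_0) (simp add: ev_diff)
  then show "f = g"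
    by simp
qed

text \<open>Copies of \<open>c\<close> are split off the front. A closed rest shorter than
  \<open>c\<close> is a prefix of \<open>c\<close>; if it were nonempty, \<open>c\<close> would pass
  through \<open>v\<close> twice.\<close>

lemma closed_awalk_cpow: "awalk v p v \<Longrightarrow> \<exists>n. p = cpow n"
proof (induction "length p" arbitrary: p rule: less_induct)
  case less
  show ?case
  proof (cases "length c \<le> length p")
    case True
    then obtain r where r: "p = c @ r"
      using exit_free_awalk_prefix[OF cycle exit_free v_in_C closed less.prems] by auto
    then have "awalk v r v"
      using less.prems closed by auto
    then obtain n where "r = cpow n"
      using less.hyps[of r] r c_not_Nil by auto
    then show ?thesis
      using r cpow_Suc by metis
  next
    case False
    then obtain r where r: "c = p @ r"
      using exit_free_awalk_prefix[OF cycle exit_free v_in_C less.prems closed] by auto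
    have "r \<noteq> []"
      using False r by auto
    have "p = []"
    proof (rule ccontr)
      assume "p \<noteq> []"
      have "awalk v r v"
        using closed r less.prems by auto
      then have "tail E (hd r) = v" "tail E (hd p) = v"
        using less.prems \<open>p \<noteq> []\<close> \<open>r \<noteq> []\<close> by (cases r; cases p; auto simp: awalk_simps)+
      then have "\<not> distinct (map (tail E) c)"
        using r \<open>p \<noteq> []\<close> \<open>r \<noteq> []\<close> by (cases r; cases p) auto
      then show False
        using cycle_distinct_tails[OF cycle] by blast
    qed
    then show ?thesis
      using cpow_0 by metis
  qed
qed

text \<open>A walk \<open>s\<close> along the cycle leads from \<open>w\<close> back to
  \<open>v\<close>. Inserting \<open>w = s s\<^sup>*\<close> turns \<open>p q\<^sup>*\<close> into
  \<open>(p s) (q s)\<^sup>*\<close>, where \<open>p s\<close> and \<open>q s\<close> are closed and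
  hence powers of \<open>c\<close>.\<close>

lemma mon_in_range_ev:
  assumes p: "awalk v p w" and q: "awalk v q w"
  shows "mon v p v q \<in> range ev"
proof -
  have w: "w \<in> C"
    using exit_free_awalk_end[OF cycle exit_free p v_in_C] .
  obtain s where s: "awalk w s v"
    using cycle_vertices_connected[OF cycle w v_in_C] by auto
  obtain i j where ij: "p @ s = cpow i" "q @ s = cpow j"
    using closed_awalk_cpow awalk_appendI[OF p s] awalk_appendI[OF q s] by metis
  have "mon v p v q = pth v p * V w * gst v q"
    using p by (simp add: mon_def pth_mult_V)
  also have "\<dots> = pth v p * (pth w s * gst w s) * gst v q"
    using pth_mult_gst[OF s w] by simp
  also have "\<dots> = pth v (p @ s) * gst v (q @ s)"
    using pth_append[OF p s] gst_append[OF q s] by (simp add: mult.assoc)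
  also have "\<dots> = zpow (int i - int j)"
    using zpow_add[of "int i" "- int j"] by (simp only: ij zpow_of_nat zpow_minus_nat
        diff_conv_add_uminus)
  also have "\<dots> = ev (Poly_Mapping.single (int i - int j) 1)"
    by (simp add: ev_single)
  finally show ?thesis
    by blast
qed

lemma cent_in_range_ev:
  assumes "cent \<tau>"
  shows "\<tau> (V v) \<in> range ev"
proof -
  obtain P where P: "finite P" "\<forall>(p, q) \<in> P. \<exists>z. awalk v p z \<and> awalk v q z"
    "V v * \<tau> (V v) * V v \<in> span ((\<lambda>(p, q). mon v p v q) ` P)"
    using corner_span[OF cent_in[OF assms V_in_A[OF v_in_verts]] v_in_verts v_in_verts] .
  have "subspace (range ev)"
    by (rule subspaceI) (auto simp flip: ev_0 ev_add ev_scale)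
  moreover have "(\<lambda>(p, q). mon v p v q) ` P \<subseteq> range ev"
  proof clarify
    fix p q assume "(p, q) \<in> P"
    then obtain z where "awalk v p z" "awalk v q z"
      using P(2) by auto
    then show "mon v p v q \<in> range ev"
      by (rule mon_in_range_ev)
  qed
  ultimately have "span ((\<lambda>(p, q). mon v p v q) ` P) \<subseteq> range ev"
    by (intro span_minimal)
  then show ?thesis
    using P(3) assms by (auto simp: cent_corner v_in_verts)
qed

section \<open>The centroid of a comet\<close>

lemma cent_comp:
  assumes \<sigma>: "cent \<sigma>" and \<tau>: "cent \<tau>"
  shows "cent (compose A \<sigma> \<tau>)"
proof (rule centI)
  fix x y assume xy: "x \<in> A" "y \<in> A"
  show "compose A \<sigma> \<tau> (x * y) = compose A \<sigma> \<tau> x * y"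
    using xy by (simp add: compose_eq A_mult cent_mult_left[OF \<tau>] cent_mult_left[OF \<sigma>] cent_in[OF
        \<tau>])
  show "compose A \<sigma> \<tau> (x * y) = x * compose A \<sigma> \<tau> y"
    using xy by (simp add: compose_eq A_mult cent_mult_right[OF \<tau>] cent_mult_right[OF \<sigma>] cent_in[OF
        \<tau>])
qed (auto simp: compose_eq A_add A_scale cent_in cent_add cent_scale assms)

lemma cent_add_maps:
  assumes "cent \<sigma>" "cent \<tau>"
  shows "cent (\<lambda>x\<in>A. \<sigma> x + \<tau> x)"
proof (rule centI)
  fix x y assume xy: "x \<in> A" "y \<in> A"
  show "(\<lambda>x\<in>A. \<sigma> x + \<tau> x) (x * y) = (\<lambda>x\<in>A. \<sigma> x + \<tau> x) x * y"
    using xy by (simp add: A_mult cent_mult_left[OF assms(1)] cent_mult_left[OF assms(2)]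
        distrib_right)
  show "(\<lambda>x\<in>A. \<sigma> x + \<tau> x) (x * y) = x * (\<lambda>x\<in>A. \<sigma> x + \<tau> x) y"
    using xy by (simp add: A_mult cent_mult_right[OF assms(1)] cent_mult_right[OF assms(2)]
        distrib_left)
qed (auto simp: A_add A_scale cent_in cent_add cent_scale assms scale_right_distrib algebra_simps)

text \<open>Since \<open>\<tau> (V v) = V v * \<tau> (V v)\<close>, the outer map acts on the factor
  \<open>V v\<close> alone. Evaluation at \<open>v\<close> is therefore multiplicative.\<close>

lemma comp_at_v:
  assumes "cent \<sigma>" "cent \<tau>"
  shows "compose A \<sigma> \<tau> (V v) = \<sigma> (V v) * \<tau> (V v)"
proof -
  have V: "V v \<in> A"
    by (rule V_in_A[OF v_in_verts])
  have "V v * \<tau> (V v) = \<tau> (V v * V v)"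
    using cent_mult_right[OF assms(2) V V] by simp
  then have "\<tau> (V v) = V v * \<tau> (V v)"
    by (simp add: V_idem v_in_verts)
  then have "\<sigma> (\<tau> (V v)) = \<sigma> (V v) * \<tau> (V v)"
    using cent_mult_left[OF assms(1) V cent_in[OF assms(2) V]] by simp
  then show ?thesis
    using V by (simp add: compose_eq)
qed

lemma ev_cent_surj: "\<exists>\<tau>. cent \<tau> \<and> \<tau> (V v) = ev f"
proof (induction f rule: single_power_induct)
  case 1
  show ?case
  proof (intro exI conjI)
    show "cent (\<lambda>x\<in>A. sc 1 x)"
      by (rule cent_scalar)
  qed (simp add: ev_1 V_in_A v_in_verts)
next
  case 2
  have "zpow 1 = pth v c"
    using zpow_of_nat[of 1] by (simp add: cpow_Suc cpow_0)
  then show ?case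
    using cent_cycle by (simp add: ev_single)
next
  case 3
  have "zpow (-1) = gst v c"
    using zpow_minus_nat[of 1] by (simp add: cpow_Suc cpow_0)
  then show ?case
    using cent_cycle_inverse by (simp add: ev_single)
next
  case (4 f g)
  then obtain \<sigma> \<tau> where \<sigma>: "cent \<sigma>" "\<sigma> (V v) = ev f" and \<tau>: "cent \<tau>" "\<tau> (V v) = ev g"
    by auto
  show ?case
  proof (intro exI conjI)
    show "cent (\<lambda>x\<in>A. \<sigma> x + \<tau> x)"
      by (rule cent_add_maps[OF \<sigma>(1) \<tau>(1)])
  qed (simp add: ev_add \<sigma> \<tau> V_in_A v_in_verts)
next
  case (5 f g)
  then obtain \<sigma> \<tau> where "cent \<sigma>" "\<sigma> (V v) = ev f" "cent \<tau>" "\<tau> (V v) = ev g"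
    by auto
  then show ?case
    using cent_comp by (intro exI[of _ "compose A \<sigma> \<tau>"]) (simp add: ev_mult comp_at_v)
next
  case (6 k f)
  then obtain \<tau> where \<tau>: "cent \<tau>" "\<tau> (V v) = ev f"
    by auto
  have "compose A (\<lambda>x\<in>A. sc k x) \<tau> (V v) = sc k (ev f)"
    using \<tau> V_in_A[OF v_in_verts] by (simp add: compose_eq cent_in ev_in_A)
  then show ?case
    using \<tau> cent_comp[OF cent_scalar \<tau>(1), of k] by (auto simp: ev_scale)
qed

text \<open>Evaluation at \<open>v\<close> has range \<open>range ev\<close>, and primeness makes it
  injective; \<open>h\<close> is this evaluation followed by the inverse of
  \<open>ev\<close>.\<close>

theorem centroid_comet:
  fixes K :: "'k itself"
  assumes prime: "prime_algebra alg"
  shows "algebra_isomorphic (centroid alg) (laurent_polynomial_algebra K)"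
proof -
  have V: "V v \<in> A"
    by (rule V_in_A[OF v_in_verts])
  define h where "h \<tau> = inv_into UNIV ev (\<tau> (V v))" for \<tau>
  have ev_h: "ev (h \<tau>) = \<tau> (V v)" if "cent \<tau>" for \<tau>
    using cent_in_range_ev[OF that] by (simp add: h_def f_inv_into_f)
  have h: "h \<tau> = f" if "\<tau> (V v) = ev f" for \<tau> f
    using that by (simp add: h_def inv_into_f_f[OF inj_ev])
  have "bij_betw h (Collect cent) UNIV"
    unfolding bij_betw_def
  proof
    show "inj_on h (Collect cent)"
    proof (rule inj_onI)
      fix \<sigma> \<tau> assume "\<sigma> \<in> Collect cent" "\<tau> \<in> Collect cent" and eq: "h \<sigma> = h \<tau>"
      then have \<sigma>: "cent \<sigma>" and \<tau>: "cent \<tau>"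
        by auto
      have "\<sigma> (V v) = \<tau> (V v)"
        using ev_h[OF \<sigma>] ev_h[OF \<tau>] eq by simp
      then have "\<sigma> x = \<tau> x" if "x \<in> A" for x
        using prime_cent_eq_0[OF prime cent_diff[OF \<sigma> \<tau>] V V_neq_0[OF v_in_verts] _ that] that V
            by simp
      then show "\<sigma> = \<tau>"
        using \<sigma> \<tau> by (intro extensionalityI[of _ A]) (auto simp: cent_extensional)
    qed
    have "f \<in> h ` Collect cent" for f
      using ev_cent_surj[of f] h by (metis imageI mem_Collect_eq)
    then show "h ` Collect cent = UNIV"
      by auto
  qed
  moreover have "h (\<lambda>x\<in>A. \<sigma> x + \<tau> x) = h \<sigma> + h \<tau>" "h (compose A \<sigma> \<tau>) = h \<sigma> * h \<tau>"
    "h (\<lambda>x\<in>A. sc k (\<tau> x)) = Poly_Mapping.map ((*) k) (h \<tau>)"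
    if "cent \<sigma>" "cent \<tau>" for \<sigma> \<tau> k
    using that V by (auto intro!: h simp: comp_at_v ev_add ev_mult ev_scale ev_h)
  moreover have "h (\<lambda>x\<in>A. x) = 1"
    using V by (intro h) (simp add: ev_1)
  ultimately have "h \<in> ring_iso (centroid alg) (laurent_polynomial_algebra K) \<and>
    (\<forall>k. \<forall>x\<in>carrier (centroid alg). h (k \<odot>\<^bsub>centroid alg\<^esub> x)
        = k \<odot>\<^bsub>laurent_polynomial_algebra K\<^esub> h x)"
    unfolding ring_iso_def ring_hom_def carrier_centroid_alg
    by (simp add: laurent_polynomial_algebra_def centroid_def alg_def)
  then show ?thesis
    unfolding algebra_isomorphic_def by blast
qed

end

theorem (in leavitt) centroid_row_finite_comet:
  fixes K :: "'k itself"
  assumes prime: "prime_algebra alg" and comet: "row_finite E" "comet E"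
  shows "algebra_isomorphic (centroid alg) (laurent_polynomial_algebra K)"
proof -
  obtain c where c: "cycle c" "\<forall>c'. cycle c' \<longrightarrow> (\<exists>n. c' = rotate n c)"
    "\<forall>v\<in>verts E. tree E v \<inter> cycle_verts E c \<noteq> {}" "\<forall>f. infinite_path E f \<longrightarrow> ends_in_cycle f c"
    using comet by (auto simp: comet_def)
  obtain v where "awalk v c v"
    using c(1) by (auto simp: cycle_iff)
  then interpret leavitt_comet E sc G c v
    using comet c unique_cycle_exit_free[OF c(1-3)] by unfold_locales auto
  show ?thesis
    by (rule centroid_comet[OF prime])
qed

section \<open>Isomorphic algebras\<close>

text \<open>Primeness is carried from \<open>L\<close> to \<open>M\<close>, and the description of
  the centroid back from \<open>M\<close> to \<open>L\<close>. Closedness of \<open>M\<close> under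
  its operations is inherited through the bijection, which makes the notion symmetric.\<close>

locale nu_isomorphism =
  fixes L :: "('k, 'a) nu_algebra" and M :: "('k, 'b) nu_algebra" and f :: "'a \<Rightarrow> 'b"
  assumes bij: "bij_betw f (carrier L) (carrier M)"
    and zero_closed: "nu_zero L \<in> carrier L"
    and add_closed: "\<lbrakk>x \<in> carrier L; y \<in> carrier L\<rbrakk> \<Longrightarrow> nu_add L x y \<in> carrier L"
    and mult_closed: "\<lbrakk>x \<in> carrier L; y \<in> carrier L\<rbrakk> \<Longrightarrow> nu_mult L x y \<in> carrier L"
    and scale_closed: "x \<in> carrier L \<Longrightarrow> nu_scale L k x \<in> carrier L"
    and zero: "f (nu_zero L) = nu_zero M"
    and add: "\<lbrakk>x \<in> carrier L; y \<in> carrier L\<rbrakk> \<Longrightarrow> f (nu_add L x y) = nu_add M (f x) (f y)"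
    and mult: "\<lbrakk>x \<in> carrier L; y \<in> carrier L\<rbrakk> \<Longrightarrow> f (nu_mult L x y) = nu_mult M (f x) (f y)"
    and scale: "x \<in> carrier L \<Longrightarrow> f (nu_scale L k x) = nu_scale M k (f x)"
begin

lemma f_in: "x \<in> carrier L \<Longrightarrow> f x \<in> carrier M"
  using bij by (auto simp: bij_betw_def)

lemma f_eq_iff: "\<lbrakk>x \<in> carrier L; y \<in> carrier L\<rbrakk> \<Longrightarrow> f x = f y \<longleftrightarrow> x = y"
  using bij by (auto simp: bij_betw_def inj_on_def)

lemma carrier_M: "carrier M = f ` carrier L"
  using bij by (auto simp: bij_betw_def)

lemma ideal_preimage:
  assumes "nu_ideal M I"
  shows "nu_ideal L {x \<in> carrier L. f x \<in> I}"
  using assms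
  by (auto simp: nu_ideal_def zero_closed add_closed mult_closed scale_closed zero add mult scale
      f_in)

lemma ideal_preimage_zero:
  assumes "nu_ideal M I" "{x \<in> carrier L. f x \<in> I} = {nu_zero L}"
  shows "I = {nu_zero M}"
proof -
  have "I = f ` {x \<in> carrier L. f x \<in> I}"
    using assms(1) carrier_M by (auto simp: nu_ideal_def)
  then show ?thesis
    using assms(2) zero by simp
qed

lemma prime_transport:
  assumes prime: "prime_algebra L"
  shows "prime_algebra M"
  unfolding prime_algebra_def
proof (intro conjI allI impI)
  show "carrier M \<noteq> {nu_zero M}"
  proof
    assume M: "carrier M = {nu_zero M}"
    have "x = nu_zero L" if "x \<in> carrier L" for x
      using f_in[OF that] f_in[OF zero_closed] f_eq_iff[OF that zero_closed] M by simp
    then have "carrier L = {nu_zero L}"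
      using zero_closed by blast
    then show False
      using prime by (simp add: prime_algebra_def)
  qed
  fix I J
  assume I: "nu_ideal M I" and J: "nu_ideal M J" and IJ: "\<forall>x\<in>I. \<forall>y\<in>J. nu_mult M x y = nu_zero M"
  have "nu_mult L x y = nu_zero L" if "x \<in> carrier L" "f x \<in> I" "y \<in> carrier L" "f y \<in> J" for x y
    using f_eq_iff[OF mult_closed[OF that(1,3)] zero_closed] IJ that by (simp add: mult zero)
  then have "{x \<in> carrier L. f x \<in> I} = {nu_zero L} \<or> {x \<in> carrier L. f x \<in> J} = {nu_zero L}"
    using prime ideal_preimage[OF I] ideal_preimage[OF J] unfolding prime_algebra_def by blast
  then show "I = {nu_zero M} \<or> J = {nu_zero M}"
    using ideal_preimage_zero I J by blast
qed

definition f_inv :: "'b \<Rightarrow> 'a" where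
  "f_inv = inv_into (carrier L) f"

lemma f_inv_f: "x \<in> carrier L \<Longrightarrow> f_inv (f x) = x"
  using bij by (simp add: f_inv_def bij_betw_inv_into_left)

lemma inverse: "nu_isomorphism M L f_inv"
proof
  show "bij_betw f_inv (carrier M) (carrier L)"
    unfolding f_inv_def by (rule bij_betw_inv_into[OF bij])
  show "nu_zero M \<in> carrier M"
    using f_in[OF zero_closed] zero by simp
  show "f_inv (nu_zero M) = nu_zero L"
    using f_inv_f[OF zero_closed] zero by simp
qed (auto simp: carrier_M f_inv_f add_closed mult_closed scale_closed simp flip: add mult scale)

definition conj_map :: "('a \<Rightarrow> 'a) \<Rightarrow> 'b \<Rightarrow> 'b" where
  "conj_map \<tau> = (\<lambda>y\<in>carrier M. f (\<tau> (f_inv y)))"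

lemma conj_map_f: "x \<in> carrier L \<Longrightarrow> conj_map \<tau> (f x) = f (\<tau> x)"
  by (simp add: conj_map_def f_in f_inv_f)

lemma centroid_conj_map:
  assumes "\<tau> \<in> carrier (centroid L)"
  shows "conj_map \<tau> \<in> carrier (centroid M)"
proof -
  have \<tau>: "\<tau> x \<in> carrier L" if "x \<in> carrier L" for x
    using assms that by (auto simp: centroid_def)
  have \<tau>_add: "\<tau> (nu_add L x y) = nu_add L (\<tau> x) (\<tau> y)"
    and \<tau>_left: "\<tau> (nu_mult L x y) = nu_mult L (\<tau> x) y"
    and \<tau>_right: "\<tau> (nu_mult L x y) = nu_mult L x (\<tau> y)"
    if "x \<in> carrier L" "y \<in> carrier L" for x y
    using assms that unfolding centroid_def partial_object.simps mem_Collect_eq by blast+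
  have \<tau>_scale: "\<tau> (nu_scale L k x) = nu_scale L k (\<tau> x)" if "x \<in> carrier L" for k x
    using assms that by (auto simp: centroid_def)
  have add': "conj_map \<tau> (nu_add M a b) = nu_add M (conj_map \<tau> a) (conj_map \<tau> b)"
    and left': "conj_map \<tau> (nu_mult M a b) = nu_mult M (conj_map \<tau> a) b"
    and right': "conj_map \<tau> (nu_mult M a b) = nu_mult M a (conj_map \<tau> b)"
    if ab: "a \<in> carrier M" "b \<in> carrier M" for a b
  proof -
    obtain x y where xy: "a = f x" "b = f y" "x \<in> carrier L" "y \<in> carrier L"
      using ab by (auto simp: carrier_M)
    have "conj_map \<tau> (nu_add M a b) = f (\<tau> (nu_add L x y))"
      using xy by (simp add: conj_map_f add_closed flip: add)
    then show "conj_map \<tau> (nu_add M a b) = nu_add M (conj_map \<tau> a) (conj_map \<tau> b)"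
      using xy by (simp add: \<tau>_add \<tau> add conj_map_f)
    have *: "conj_map \<tau> (nu_mult M a b) = f (\<tau> (nu_mult L x y))"
      using xy by (simp add: conj_map_f mult_closed flip: mult)
    show "conj_map \<tau> (nu_mult M a b) = nu_mult M (conj_map \<tau> a) b"
      unfolding * \<tau>_left[OF xy(3,4)] using xy by (simp add: mult \<tau> conj_map_f)
    show "conj_map \<tau> (nu_mult M a b) = nu_mult M a (conj_map \<tau> b)"
      unfolding * \<tau>_right[OF xy(3,4)] using xy by (simp add: mult \<tau> conj_map_f)
  qed
  have scale': "conj_map \<tau> (nu_scale M k a) = nu_scale M k (conj_map \<tau> a)" if a: "a \<in> carrier M"
      for k a
  proof -
    obtain x where x: "a = f x" "x \<in> carrier L"
      using a by (auto simp: carrier_M)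
    have "conj_map \<tau> (nu_scale M k a) = f (\<tau> (nu_scale L k x))"
      using x by (simp add: conj_map_f scale_closed flip: scale)
    then show ?thesis
      using x by (simp add: \<tau>_scale scale \<tau> conj_map_f)
  qed
  have "conj_map \<tau> \<in> carrier M \<rightarrow>\<^sub>E carrier M"
    by (auto simp: conj_map_def carrier_M f_inv_f \<tau>)
  then show ?thesis
    using add' left' right' scale' unfolding centroid_def by simp
qed

end

lemma (in nu_isomorphism) centroid_transport:
  assumes "algebra_isomorphic (centroid M) N"
  shows "algebra_isomorphic (centroid L) N"
proof -
  interpret inv: nu_isomorphism M L f_inv
    by (rule inverse)
  obtain h where h: "h \<in> ring_iso (centroid M) N" and
    h_scale: "\<And>k x. x \<in> carrier (centroid M) \<Longrightarrow> h (k \<odot>\<^bsub>centroid M\<^esub> x) = k \<odot>\<^bsub>N\<^esub> h x"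
    using assms by (auto simp: algebra_isomorphic_def)
  have inv_g: "inv.f_inv x = f x" if "x \<in> carrier L" for x
    using inv.f_inv_f[OF f_in[OF that]] that by (simp add: f_inv_f)
  have conj_left: "inv.conj_map (conj_map \<tau>) = \<tau>" if "\<tau> \<in> carrier (centroid L)" for \<tau>
  proof (rule extensionalityI[of _ "carrier L"])
    show "\<tau> \<in> extensional (carrier L)"
      using that by (auto simp: centroid_def PiE_def)
    fix x assume "x \<in> carrier L"
    moreover from this have "\<tau> x \<in> carrier L"
      using that by (auto simp: centroid_def)
    ultimately show "inv.conj_map (conj_map \<tau>) x = \<tau> x"
      by (simp add: inv.conj_map_def inv_g conj_map_f f_inv_f)
  qed (simp add: inv.conj_map_def)
  have conj_right: "conj_map (inv.conj_map \<rho>) = \<rho>" if "\<rho> \<in> carrier (centroid M)" for \<rho>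
  proof (rule extensionalityI[of _ "carrier M"])
    show "\<rho> \<in> extensional (carrier M)"
      using that by (auto simp: centroid_def PiE_def)
    fix y assume y: "y \<in> carrier M"
    then have "\<rho> y \<in> carrier M"
      using that by (auto simp: centroid_def)
    then show "conj_map (inv.conj_map \<rho>) y = \<rho> y"
      using y by (simp add: conj_map_def inv.conj_map_f) (metis carrier_M f_inv_f imageE)
  qed (simp add: conj_map_def)
  have bij_conj: "bij_betw conj_map (carrier (centroid L)) (carrier (centroid M))"
    by (rule bij_betwI[where g = inv.conj_map])
      (auto intro: centroid_conj_map inv.centroid_conj_map conj_left conj_right)
  have ops: "conj_map (\<sigma> \<otimes>\<^bsub>centroid L\<^esub> \<tau>) = conj_map \<sigma> \<otimes>\<^bsub>centroid M\<^esub> conj_map \<tau>"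
    "conj_map (\<sigma> \<oplus>\<^bsub>centroid L\<^esub> \<tau>) = conj_map \<sigma> \<oplus>\<^bsub>centroid M\<^esub> conj_map \<tau>"
    "conj_map (k \<odot>\<^bsub>centroid L\<^esub> \<tau>) = k \<odot>\<^bsub>centroid M\<^esub> conj_map \<tau>"
    if "\<sigma> \<in> carrier (centroid L)" "\<tau> \<in> carrier (centroid L)" for \<sigma> \<tau> k
  proof -
    have mem: "\<sigma> x \<in> carrier L" "\<tau> x \<in> carrier L" if "x \<in> carrier L" for x
      using \<open>\<sigma> \<in> carrier (centroid L)\<close> \<open>\<tau> \<in> carrier (centroid L)\<close> that by (auto simp: centroid_def)
    show "conj_map (\<sigma> \<otimes>\<^bsub>centroid L\<^esub> \<tau>) = conj_map \<sigma> \<otimes>\<^bsub>centroid M\<^esub> conj_map \<tau>"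
      "conj_map (\<sigma> \<oplus>\<^bsub>centroid L\<^esub> \<tau>) = conj_map \<sigma> \<oplus>\<^bsub>centroid M\<^esub> conj_map \<tau>"
      "conj_map (k \<odot>\<^bsub>centroid L\<^esub> \<tau>) = k \<odot>\<^bsub>centroid M\<^esub> conj_map \<tau>"
      by (rule extensionalityI[of _ "carrier M"];
          auto simp: centroid_def compose_def conj_map_def carrier_M f_inv_f mem add scale)+
  qed
  have one: "conj_map \<one>\<^bsub>centroid L\<^esub> = \<one>\<^bsub>centroid M\<^esub>"
    by (rule extensionalityI[of _ "carrier M"])
      (auto simp: centroid_def conj_map_def carrier_M f_inv_f)
  have "h \<circ> conj_map \<in> ring_iso (centroid L) N"
    using h bij_conj unfolding ring_iso_def ring_hom_def
    by (auto simp: ops one centroid_conj_map Pi_iff intro: bij_betw_trans)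
  moreover have "(h \<circ> conj_map) (k \<odot>\<^bsub>centroid L\<^esub> x) = k \<odot>\<^bsub>N\<^esub> (h \<circ> conj_map) x"
    if "x \<in> carrier (centroid L)" for k x
    using that h_scale by (simp add: ops centroid_conj_map)
  ultimately show ?thesis
    unfolding algebra_isomorphic_def by blast
qed

section \<open>Ideals of the free algebra\<close>

abbreviation scl :: "'k :: field \<Rightarrow> ('g \<Rightarrow>\<^sub>0 'k) \<Rightarrow> ('g \<Rightarrow>\<^sub>0 'k)" where
  "scl k \<equiv> Poly_Mapping.map ((*) k)"

lemma lookup_scl: "Poly_Mapping.lookup (scl k p) x = k * Poly_Mapping.lookup p x"
  by (simp add: map.rep_eq when_def)

interpretation scl: vector_space scl
  by unfold_locales (rule poly_mapping_eqI; simp add: lookup_scl lookup_add algebra_simps)+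

lemma scl_mult_left: "scl k p * q = scl k (p * q)"
  and scl_mult_right: "p * scl k q = scl k (p * q)" for p q :: "'g :: monoid_add \<Rightarrow>\<^sub>0 'k :: field"
proof -
  show left: "scl k p * q = scl k (p * q)" for p q :: "'g \<Rightarrow>\<^sub>0 'k"
    by (simp add: mult_map_scale_conv_mult mult.assoc)
  \<comment> \<open>\<open>single 0 k\<close> is \<open>k\<close> times the unit of the monoid
    algebra, hence central even if the monoid is not commutative.\<close>
  have "p * Poly_Mapping.single 0 k = Poly_Mapping.single 0 k * p"
    by (induction p rule: poly_mapping_additive_induct)
      (simp_all add: distrib_left distrib_right mult_single mult.commute)
  then show "p * scl k q = scl k (p * q)"
    by (simp add: mult_map_scale_conv_mult flip: mult.assoc)
qed

lemma scl_minus_one: "scl (- 1) p = - p"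
  by (rule poly_mapping_eqI) (simp add: lookup_scl)

lemma carrier_free_algebra:
  "carrier (free_algebra X) = {p. Poly_Mapping.keys p \<subseteq> {Word w | w. w \<noteq> [] \<and> set w \<subseteq> X}}"
  by (simp add: free_algebra_def)

lemma nu_ideal_free_algebra_iff:
  "nu_ideal (free_algebra X) I \<longleftrightarrow> I \<subseteq> carrier (free_algebra X) \<and> 0 \<in> I \<and>
    (\<forall>x\<in>I. \<forall>y\<in>I. x + y \<in> I) \<and> (\<forall>k. \<forall>x\<in>I. scl k x \<in> I) \<and>
    (\<forall>a\<in>carrier (free_algebra X). \<forall>x\<in>I. a * x \<in> I \<and> x * a \<in> I)"
  by (simp add: nu_ideal_def free_algebra_def)

lemma free_algebra_closed:
  fixes p q :: "'g free_word \<Rightarrow>\<^sub>0 'k :: field"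
  assumes "p \<in> carrier (free_algebra X)"
  shows "scl k p \<in> carrier (free_algebra X)"
    "q \<in> carrier (free_algebra X) \<Longrightarrow> p + q \<in> carrier (free_algebra X)"
    "q \<in> carrier (free_algebra X) \<Longrightarrow> p - q \<in> carrier (free_algebra X)"
    "q \<in> carrier (free_algebra X) \<Longrightarrow> p * q \<in> carrier (free_algebra X)"
proof -
  have scl: "scl k p \<in> carrier (free_algebra X)" if "p \<in> carrier (free_algebra X)"
    for k and p :: "'g free_word \<Rightarrow>\<^sub>0 'k"
    using that by (auto simp: carrier_free_algebra in_keys_iff lookup_scl)
  then show "scl k p \<in> carrier (free_algebra X)"
    using assms .
  have add: "p + q \<in> carrier (free_algebra X)" if "q \<in> carrier (free_algebra X)" for q
    using assms that keys_add[of p q] by (auto simp: carrier_free_algebra)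
  then show "p + q \<in> carrier (free_algebra X)" if "q \<in> carrier (free_algebra X)"
    using that .
  show "p - q \<in> carrier (free_algebra X)" if "q \<in> carrier (free_algebra X)"
    using add[OF scl[OF that, of "- 1"]] by (simp add: scl_minus_one)
  show "p * q \<in> carrier (free_algebra X)" if "q \<in> carrier (free_algebra X)"
    using assms that keys_mult[of p q] unfolding carrier_free_algebra
        by (fastforce simp: subset_iff)
qed

section \<open>The quotient of the free algebra by an ideal\<close>

locale free_ideal =
  fixes X :: "'g set" and I :: "('g free_word \<Rightarrow>\<^sub>0 'k :: field) set"
  assumes ideal: "nu_ideal (free_algebra X) I"
begin

abbreviation C where "C \<equiv> carrier (free_algebra X :: ('k, 'g free_word \<Rightarrow>\<^sub>0 'k) nu_algebra)"

abbreviation Q where "Q \<equiv> nu_quotient (free_algebra X) I"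

definition coset where "coset = nu_coset (free_algebra X) I"

lemma I_subset: "x \<in> I \<Longrightarrow> x \<in> C" and I_0: "0 \<in> I" and I_add: "\<lbrakk>x \<in> I; y \<in> I\<rbrakk> \<Longrightarrow> x + y \<in> I"
  and I_scl: "x \<in> I \<Longrightarrow> scl k x \<in> I"
  and I_mult_left: "\<lbrakk>a \<in> C; x \<in> I\<rbrakk> \<Longrightarrow> a * x \<in> I" and I_mult_right: "\<lbrakk>a \<in> C; x \<in> I\<rbrakk> \<Longrightarrow> x * a \<in> I"
  using ideal by (auto simp: nu_ideal_free_algebra_iff)

lemma I_minus: "x \<in> I \<Longrightarrow> - x \<in> I"
  using I_scl[of x "- 1"] by (simp add: scl_minus_one)

lemma I_diff: "\<lbrakk>x \<in> I; y \<in> I\<rbrakk> \<Longrightarrow> x - y \<in> I"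
  using I_add[of x "- y"] I_minus[of y] by simp

lemma mem_coset: "x \<in> coset a \<longleftrightarrow> x - a \<in> I"
proof -
  have "x \<in> coset a \<longleftrightarrow> (\<exists>i\<in>I. x = a + i)"
    by (auto simp: coset_def nu_coset_def free_algebra_def)
  also have "\<dots> \<longleftrightarrow> x - a \<in> I"
    by (metis add_diff_cancel_left' add.commute diff_add_cancel)
  finally show ?thesis .
qed

lemma coset_eq: "a - b \<in> I \<Longrightarrow> coset a = coset b"
proof -
  assume ab: "a - b \<in> I"
  have "x - a \<in> I \<longleftrightarrow> x - b \<in> I" for x
    using I_add[OF _ ab, of "x - a"] I_diff[OF _ ab, of "x - b"] by auto
  then show ?thesis
    by (auto simp: mem_coset)
qed

lemma coset_self: "a \<in> coset a"
  by (simp add: mem_coset I_0)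

lemma carrier_Q: "carrier Q = coset ` C"
  by (simp add: nu_quotient_def coset_def)

lemma zero_Q: "nu_zero Q = coset 0"
  by (simp add: nu_quotient_def coset_def free_algebra_def)

text \<open>The union defining a quotient operation runs over a nonempty family of equal
  cosets.\<close>

lemma UN_coset:
  assumes "\<And>x y. \<lbrakk>x \<in> coset a; y \<in> coset b\<rbrakk> \<Longrightarrow> h x y - h a b \<in> I"
  shows "(\<Union>x\<in>coset a. \<Union>y\<in>coset b. coset (h x y)) = coset (h a b)"
proof -
  have "coset (h x y) = coset (h a b)" if "x \<in> coset a" "y \<in> coset b" for x y
    using assms[OF that] by (rule coset_eq)
  then show ?thesis
    using coset_self by blast
qed

lemma add_Q: "nu_add Q (coset a) (coset b) = coset (a + b)"
proof -
  have "nu_add Q (coset a) (coset b) = (\<Union>x\<in>coset a. \<Union>y\<in>coset b. coset (x + y))"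
    by (simp add: nu_quotient_def coset_def free_algebra_def)
  also have "\<dots> = coset (a + b)"
  proof (rule UN_coset)
    fix x y assume "x \<in> coset a" "y \<in> coset b"
    then have "(x - a) + (y - b) \<in> I"
      by (intro I_add) (simp_all add: mem_coset)
    then show "x + y - (a + b) \<in> I"
      by (simp add: algebra_simps)
  qed
  finally show ?thesis .
qed

lemma mult_Q:
  assumes "a \<in> C" "b \<in> C"
  shows "nu_mult Q (coset a) (coset b) = coset (a * b)"
proof -
  have "nu_mult Q (coset a) (coset b) = (\<Union>x\<in>coset a. \<Union>y\<in>coset b. coset (x * y))"
    by (simp add: nu_quotient_def coset_def free_algebra_def)
  also have "\<dots> = coset (a * b)"
  proof (rule UN_coset)
    fix x y assume "x \<in> coset a" "y \<in> coset b"
    then have x: "x - a \<in> I" and y: "y - b \<in> I"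
      by (simp_all add: mem_coset)
    \<comment> \<open>This is \<open>x * y - a * b\<close>, split so that each product has a factor
      in \<open>I\<close> and the other in \<open>C\<close>.\<close>
    have "(x - a) * (y - b) + (x - a) * b + a * (y - b) \<in> I"
      using assms x y by (intro I_add I_mult_left[OF I_subset[OF x]] I_mult_left I_mult_right)
    then show "x * y - a * b \<in> I"
      by (simp add: algebra_simps)
  qed
  finally show ?thesis .
qed

lemma scale_Q: "nu_scale Q k (coset a) = coset (scl k a)"
proof -
  have "nu_scale Q k (coset a) = (\<Union>x\<in>coset a. coset (scl k x))"
    by (simp add: nu_quotient_def coset_def free_algebra_def)
  also have "coset (scl k x) = coset (scl k a)" if "x \<in> coset a" for x
    using that I_scl[of "x - a" k] by (intro coset_eq) (simp add: mem_coset
        scl.scale_right_diff_distrib)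
  then have "(\<Union>x\<in>coset a. coset (scl k x)) = coset (scl k a)"
    using coset_self by blast
  finally show ?thesis .
qed

definition foreign :: "'g free_word set" where
  "foreign = {Word w | w. \<not> set w \<subseteq> X}"

text \<open>
  Letters outside \<^term>\<open>X\<close> have to be killed as well, since \<^term>\<open>I\<close> is an ideal of the free
  algebra on \<^term>\<open>X\<close> only.
\<close>

definition J :: "('g free_word \<Rightarrow>\<^sub>0 'k) set" where
  "J = {p. \<exists>i\<in>I. Poly_Mapping.keys (p - i) \<subseteq> foreign}"

lemma J_I: "x \<in> I \<Longrightarrow> x \<in> J"
  by (auto simp: J_def intro!: bexI[of _ x])

lemma J_0: "0 \<in> J"
  by (rule J_I[OF I_0])

lemma J_foreign: "Poly_Mapping.keys x \<subseteq> foreign \<Longrightarrow> x \<in> J"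
  by (auto simp: J_def I_0 intro!: bexI[of _ 0])

lemma J_add:
  assumes "x \<in> J" "y \<in> J"
  shows "x + y \<in> J"
proof -
  obtain i j where ij: "i \<in> I" "j \<in> I" "Poly_Mapping.keys (x - i) \<subseteq> foreign"
      "Poly_Mapping.keys (y - j) \<subseteq> foreign"
    using assms by (auto simp: J_def)
  have "Poly_Mapping.keys (x - i + (y - j)) \<subseteq> foreign"
    using keys_add[of "x - i" "y - j"] ij by blast
  then show ?thesis
    using I_add[OF ij(1,2)] unfolding J_def by (auto simp: algebra_simps intro!: bexI[of _ "i + j"])
qed

lemma J_scl:
  assumes "x \<in> J"
  shows "scl k x \<in> J"
proof -
  obtain i where i: "i \<in> I" "Poly_Mapping.keys (x - i) \<subseteq> foreign"
    using assms by (auto simp: J_def)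
  have "Poly_Mapping.keys (scl k (x - i)) \<subseteq> Poly_Mapping.keys (x - i)"
    by (auto simp: in_keys_iff lookup_scl)
  then show ?thesis
    using i I_scl unfolding J_def
    by (auto simp: scl.scale_right_diff_distrib intro!: bexI[of _ "scl k i"])
qed

lemma J_minus: "x \<in> J \<Longrightarrow> - x \<in> J"
  using J_scl[of x "- 1"] by (simp add: scl_minus_one)

lemma J_diff: "\<lbrakk>x \<in> J; y \<in> J\<rbrakk> \<Longrightarrow> x - y \<in> J"
  using J_add[of x "- y"] J_minus[of y] by simp

text \<open>Foreign words do not occur in elements of \<open>C\<close>, so passing from
  \<open>I\<close> to \<open>J\<close> identifies no further elements of the algebra.\<close>

lemma J_C:
  assumes "x \<in> J" "x \<in> C"
  shows "x \<in> I"
proof -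
  obtain i where i: "i \<in> I" "Poly_Mapping.keys (x - i) \<subseteq> foreign"
    using assms by (auto simp: J_def)
  have "x - i \<in> C"
    using assms i I_subset by (intro free_algebra_closed)
  then have "Poly_Mapping.keys (x - i) = {}"
    using i unfolding carrier_free_algebra foreign_def by fastforce
  then show ?thesis
    using i by simp
qed

lemma foreign_mult:
  fixes a x :: "'g free_word \<Rightarrow>\<^sub>0 'k"
  assumes "Poly_Mapping.keys x \<subseteq> foreign"
  shows "Poly_Mapping.keys (a * x) \<subseteq> foreign" "Poly_Mapping.keys (x * a) \<subseteq> foreign"
proof -
  have "u + w \<in> foreign" "w + u \<in> foreign" if "w \<in> foreign" for u w
    using that by (cases u; auto simp: foreign_def)+
  then show "Poly_Mapping.keys (a * x) \<subseteq> foreign" "Poly_Mapping.keys (x * a) \<subseteq> foreign"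
    using assms keys_mult[of a x] keys_mult[of x a] by blast+
qed

lemma J_mult_left:
  assumes "a \<in> C" "x \<in> J"
  shows "a * x \<in> J"
proof -
  obtain i where i: "i \<in> I" "Poly_Mapping.keys (x - i) \<subseteq> foreign"
    using assms by (auto simp: J_def)
  then have "a * i + a * (x - i) \<in> J"
    using assms by (intro J_add J_I[OF I_mult_left] J_foreign foreign_mult)
  then show ?thesis
    by (simp add: right_diff_distrib)
qed

text \<open>The right factor ranges over the whole type, because the operators below act on all of
  it. The empty word acts as the unit, a foreign word yields foreign words, and any other word lies
  in \<open>C\<close>.\<close>

lemma J_mult_right:
  assumes "x \<in> I"
  shows "x * a \<in> J"
proof (induction a rule: poly_mapping_additive_induct)
  case (single w k)
  obtain l where w: "w = Word l"
    by (cases w)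
  consider "l = []" | "\<not> set l \<subseteq> X" | "l \<noteq> []" "set l \<subseteq> X"
    by blast
  then show ?case
  proof cases
    case 1
    then have "x * Poly_Mapping.single w k = scl k (x * 1)"
      unfolding scl_mult_right[symmetric] by (simp add: w zero_free_word_def flip: single_one)
    then show ?thesis
      using assms J_I I_scl by simp
  next
    case 2
    then show ?thesis
      by (intro J_foreign foreign_mult) (auto simp: w foreign_def)
  next
    case 3
    then show ?thesis
      using assms by (intro J_I I_mult_right) (auto simp: w carrier_free_algebra)
  qed
qed (simp_all add: J_0 distrib_left J_add)

text \<open>A linear projection with kernel \<open>J\<close>: it kills a basis of \<open>J\<close>
  and fixes the vectors that extend it to a basis of the whole space. Its range is the complement
  that stands for the quotient by \<open>J\<close>.\<close>

definition reduce :: "('g free_word \<Rightarrow>\<^sub>0 'k) \<Rightarrow> ('g free_word \<Rightarrow>\<^sub>0 'k)" where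
  "reduce = (SOME r. Vector_Spaces.linear scl scl r \<and> (\<forall>x. r x - x \<in> J) \<and> (\<forall>x\<in>J. r x = 0))"

lemma reduce: "Vector_Spaces.linear scl scl reduce" "reduce x - x \<in> J" "x \<in> J \<Longrightarrow> reduce x = 0"
proof -
  interpret vector_space_pair "scl :: 'k \<Rightarrow> ('g free_word \<Rightarrow>\<^sub>0 'k) \<Rightarrow> _" scl
    by unfold_locales
  have subspace: "scl.subspace J"
    by (rule scl.subspaceI) (auto simp: J_0 J_add J_scl)
  obtain B0 where B0: "B0 \<subseteq> J" "scl.independent B0" "J \<subseteq> scl.span B0"
    using scl.maximal_independent_subset[of J] by metis
  define B1 where "B1 = scl.extend_basis B0"
  have B1: "scl.independent B1" "scl.span B1 = UNIV" "B0 \<subseteq> B1"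
    using B0(2) by (simp_all add: B1_def scl.independent_extend_basis scl.span_extend_basis
        scl.extend_basis_superset)
  obtain r where r: "Vector_Spaces.linear scl scl r" "\<And>x. x \<in> B1 \<Longrightarrow> r x = (if x \<in> B0 then 0 else x)"
    using linear_independent_extend[OF B1(1), of "\<lambda>x. if x \<in> B0 then 0 else x"] by metis
  interpret r: Vector_Spaces.linear scl scl r
    by (rule r(1))
  have "r x - x \<in> J" for x
  proof -
    have "x \<in> scl.span B1"
      using B1 by simp
    then show ?thesis
    proof (induction rule: scl.span_induct_alt)
      case (step k b y)
      have "r b - b \<in> J"
        using step r(2)[of b] B0(1) J_minus J_0 by auto
      then have "scl k (r b - b) + (r y - y) \<in> J"
        using step J_add J_scl by blast
      then show ?case
        by (simp add: r.add r.scale scl.scale_right_diff_distrib algebra_simps)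
    qed (simp add: r.zero J_0)
  qed
  moreover have "r x = 0" if "x \<in> J" for x
  proof -
    have "x \<in> scl.span B0"
      using that B0 by auto
    then show ?thesis
      by (induction rule: scl.span_induct_alt) (use r(2) B1(3) in \<open>auto simp: r.add r.scale r.zero\<close>)
  qed
  ultimately have "\<exists>r. Vector_Spaces.linear scl scl r \<and> (\<forall>x. r x - x \<in> J) \<and> (\<forall>x\<in>J. r x = 0)"
    using r(1) by blast
  from someI_ex[OF this] show "Vector_Spaces.linear scl scl reduce" "reduce x - x \<in> J"
      "x \<in> J \<Longrightarrow> reduce x = 0"
    unfolding reduce_def[symmetric] by auto
qed

end

text \<open>
  The Leavitt path algebra is realised inside a ring type, so that its elements can be
  calculated with by rewriting: it acts faithfully on a vector space complement of the ideal of
  relations, and thus embeds in the ring of linear operators on the free algebra.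
\<close>

typedef (overloaded) ('g, 'k :: field) operator =
  "{T :: ('g free_word \<Rightarrow>\<^sub>0 'k) \<Rightarrow> ('g free_word \<Rightarrow>\<^sub>0 'k).
     (\<forall>x y. T (x + y) = T x + T y) \<and> (\<forall>k x. T (scl k x) = scl k (T x))}"
  by (intro exI[of _ id]) simp

setup_lifting type_definition_operator

instantiation operator :: (type, field) ring
begin

lift_definition zero_operator :: "('a, 'b) operator" is "\<lambda>_. 0"
  by simp

lift_definition plus_operator :: "('a, 'b) operator \<Rightarrow> ('a, 'b) operator \<Rightarrow> ('a, 'b) operator"
  is "\<lambda>S T x. S x + T x"
  by (simp add: scl.scale_right_distrib)

lift_definition uminus_operator :: "('a, 'b) operator \<Rightarrow> ('a, 'b) operator" is "\<lambda>T x. - T x"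
  by (simp add: scl.scale_minus_right)

lift_definition minus_operator :: "('a, 'b) operator \<Rightarrow> ('a, 'b) operator \<Rightarrow> ('a, 'b) operator"
  is "\<lambda>S T x. S x - T x"
  by (simp add: scl.scale_right_diff_distrib)

lift_definition times_operator :: "('a, 'b) operator \<Rightarrow> ('a, 'b) operator \<Rightarrow> ('a, 'b) operator"
  is "\<lambda>S T x. S (T x)"
  by simp

instance
  by standard (transfer; simp add: fun_eq_iff algebra_simps)+

end

lift_definition operator_scale :: "'k :: field \<Rightarrow> ('g, 'k) operator \<Rightarrow> ('g, 'k) operator"
  is "\<lambda>k T x. scl k (T x)"
  by (simp add: scl.scale_right_distrib scl.scale_left_commute)

lemma vector_space_operator: "vector_space operator_scale"
  by unfold_locales
    (transfer; simp add: fun_eq_iff scl.scale_right_distrib scl.scale_left_distrib)+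

lemma operator_scale_mult_left: "operator_scale k S * T = operator_scale k (S * T)"
  and operator_scale_mult_right: "S * operator_scale k T = operator_scale k (S * T)"
  by (transfer; simp)+

section \<open>Left multiplication as a faithful action\<close>

context free_ideal
begin

interpretation reduce: Vector_Spaces.linear scl scl reduce
  by (rule reduce(1))

lemma reduce_cong: "x - y \<in> J \<Longrightarrow> reduce x = reduce y"
  using reduce(3)[of "x - y"] by (simp add: reduce.diff)

lift_definition \<Phi> :: "('g free_word \<Rightarrow>\<^sub>0 'k) \<Rightarrow> ('g, 'k) operator" is "\<lambda>a x. reduce (a * reduce x)"
  by (simp add: reduce.add reduce.scale distrib_left scl_mult_right)

lemma \<Phi>_add: "\<Phi> (a + b) = \<Phi> a + \<Phi> b"
  and \<Phi>_scl: "\<Phi> (scl k a) = operator_scale k (\<Phi> a)"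
  and \<Phi>_0: "\<Phi> 0 = 0"
  by (transfer; simp add: fun_eq_iff distrib_right reduce.add reduce.scale reduce.zero
      scl_mult_left)+

lemma \<Phi>_diff: "\<Phi> (a - b) = \<Phi> a - \<Phi> b"
  using \<Phi>_add[of "a - b" b] by simp

text \<open>The inner \<open>reduce\<close> changes the product by an element of
  \<open>a * J\<close>, and \<open>J\<close> is stable under left multiplication by
  \<open>C\<close>.\<close>

lemma \<Phi>_mult:
  assumes "a \<in> C" "b \<in> C"
  shows "\<Phi> (a * b) = \<Phi> a * \<Phi> b"
  using assms
proof (transfer, intro ext)
  fix a b x assume ab: "a \<in> C" "b \<in> C"
  have "reduce (reduce (b * reduce x)) = reduce (b * reduce x)"
    by (intro reduce_cong reduce(2))
  moreover have "a * (reduce (b * reduce x) - b * reduce x) \<in> J"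
    by (intro J_mult_left ab reduce(2))
  ultimately show "reduce (a * b * reduce x) = reduce (a * reduce (reduce (b * reduce x)))"
    using reduce_cong[of "a * reduce (b * reduce x)" "a * (b * reduce x)"]
    by (simp add: mult.assoc right_diff_distrib)
qed

text \<open>For faithfulness the operator is applied to 1, the empty word: the result is congruent
  to \<open>a\<close> modulo \<open>J\<close>. This is why the operators act on the free unital
  algebra, as \<open>C\<close> contains no unit.\<close>

lemma \<Phi>_eq_0_iff:
  assumes "a \<in> C"
  shows "\<Phi> a = 0 \<longleftrightarrow> a \<in> I"
  using assms
proof transfer
  fix a assume a: "a \<in> C"
  have 1: "a * reduce 1 - a \<in> J"
    using J_mult_left[OF a reduce(2)[of 1]] by (simp add: right_diff_distrib)
  have "reduce (a * reduce x) = 0" if "a \<in> I" for x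
  proof -
    have "a * (reduce x - x) \<in> J"
      by (intro J_mult_left a reduce(2))
    then have "reduce (a * reduce x) = reduce (a * x)"
      by (intro reduce_cong) (simp add: right_diff_distrib)
    also have "\<dots> = 0"
      by (intro reduce(3) J_mult_right that)
    finally show ?thesis .
  qed
  moreover have "a \<in> I" if "reduce (a * reduce 1) = 0"
  proof (rule J_C[OF _ a])
    have "a * reduce 1 \<in> J"
      using reduce(2)[of "a * reduce 1"] that J_minus by fastforce
    then show "a \<in> J"
      using J_diff[OF _ 1] by fastforce
  qed
  ultimately show "((\<lambda>x. reduce (a * reduce x)) = (\<lambda>_. 0)) \<longleftrightarrow> a \<in> I"
    by metis
qed

end

section \<open>A representation of the Leavitt path algebra\<close>

lemma nu_ideal_Inter:
  assumes "S \<noteq> {}" "\<And>I. I \<in> S \<Longrightarrow> nu_ideal A I"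
  shows "nu_ideal A (\<Inter>S)"
  unfolding nu_ideal_def
proof (intro conjI ballI allI)
  obtain I where "I \<in> S"
    using assms(1) by auto
  then show "\<Inter>S \<subseteq> carrier A"
    using assms(2)[of I] by (auto simp: nu_ideal_def)
qed (rule InterI; use assms(2) in \<open>auto simp: nu_ideal_def\<close>)+

lemma zero_in_free_algebra: "0 \<in> carrier (free_algebra X)"
  by (simp add: carrier_free_algebra)

context wf_digraph
begin

text \<open>
  A branching system in the sense of Goncalves and Royer: the set attached to a vertex that is not
  a sink is the disjoint union of copies of the sets attached to the ranges of its edges. Here all
  of these sets are copies of one set of a sufficiently large cardinality. The third
  component of a state records degrees and makes the representation graded.
\<close>

type_synonym ('v, 'e) state = "'v \<times> (nat + 'e) \<times> int"

definition branch :: "'a \<Rightarrow> 'b \<times> (nat + 'b) \<Rightarrow> nat + 'b" where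
  "branch v = (SOME b. bij_betw b (out_arcs G v \<times> UNIV) UNIV)"

definition unbranch :: "'a \<Rightarrow> nat + 'b \<Rightarrow> 'b \<times> (nat + 'b)" where
  "unbranch v = inv_into (out_arcs G v \<times> UNIV) (branch v)"

text \<open>The summand \<open>nat\<close> makes the set infinite and the summand \<open>'b\<close>
  makes it at least as large as the set of emitted edges; an infinite set absorbs a product with a
  nonempty set that is no larger.\<close>

lemma bij_branch:
  assumes "e \<in> out_arcs G v"
  shows "bij_betw (branch v) (out_arcs G v \<times> UNIV) UNIV"
proof -
  have "infinite (UNIV :: (nat + 'b) set)"
    by (simp add: finite_Plus_UNIV_iff)
  moreover have "(card_of (out_arcs G v), card_of (UNIV :: (nat + 'b) set)) \<in> ordLeq"
    by (rule card_of_ordLeq[THEN iffD1]) (auto intro!: exI[of _ Inr])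
  ultimately have "(card_of (out_arcs G v \<times> (UNIV :: (nat + 'b) set)), card_of (UNIV :: (nat + 'b)
      set)) \<in> ordIso"
    using assms by (intro card_of_Times_infinite_simps(3)) auto
  then have "\<exists>b. bij_betw b (out_arcs G v \<times> (UNIV :: (nat + 'b) set)) (UNIV :: (nat + 'b) set)"
    by (simp only: card_of_ordIso)
  from someI_ex[OF this] show ?thesis
    by (simp add: branch_def)
qed

lemma unbranch_branch: "e \<in> out_arcs G v \<Longrightarrow> unbranch v (branch v (e, t)) = (e, t)"
  unfolding unbranch_def using bij_branch by (intro bij_betw_inv_into_left) auto

lemma branch_unbranch: "e \<in> out_arcs G v \<Longrightarrow> branch v (unbranch v t) = t"
  unfolding unbranch_def by (rule bij_betw_inv_into_right[OF bij_branch]) auto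

lemma fst_unbranch: "e \<in> out_arcs G v \<Longrightarrow> fst (unbranch v t) \<in> out_arcs G v"
  using bij_betw_apply[OF bij_betw_inv_into[OF bij_branch], of e v t]
      by (simp add: unbranch_def mem_Times_iff)

text \<open>Generators act as partial injections on the states, \<open>None\<close> standing for 0.
  An edge and its ghost are mutually inverse and shift the degree by 1 and -1.\<close>

fun act1 :: "('a, 'b) generator \<Rightarrow> ('a, 'b) state \<Rightarrow> ('a, 'b) state option" where
  "act1 (Vertex u) (v, t, n) = (if u = v then Some (v, t, n) else None)"
| "act1 (Edge e) (v, t, n) = (if v = head G e then Some (tail G e, branch (tail G e) (e, t), n + 1)
    else None)"
| "act1 (Ghost e) (v, t, n) = (if v = tail G e \<and> fst (unbranch v t) = e
     then Some (head G e, snd (unbranch v t), n - 1) else None)"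

primrec act :: "('a, 'b) generator list \<Rightarrow> ('a, 'b) state \<Rightarrow> ('a, 'b) state option" where
  "act [] x = Some x"
| "act (g # w) x = Option.bind (act w x) (act1 g)"

lemma act_append: "act (u @ w) x = Option.bind (act w x) (act u)"
proof (induction u)
  case Nil
  show ?case
    by (cases "act w x") auto
next
  case (Cons g u)
  then show ?case
    by (cases "act w x") auto
qed

primrec letters :: "'g free_word \<Rightarrow> 'g list" where
  "letters (Word w) = w"

abbreviation ext :: "(('a, 'b) state \<Rightarrow> 'k::zero) \<Rightarrow> ('a, 'b) state option \<Rightarrow> 'k" where
  "ext f \<equiv> case_option 0 f"

text \<open>The action is on arbitrary functions of states, by precomposition, so that supports need
  no attention. Precomposition reverses the order of factors, as seen in
  \<open>rep_mult\<close>.\<close>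

definition rep :: "(('a, 'b) generator free_word \<Rightarrow>\<^sub>0 'k::field) \<Rightarrow> (('a, 'b) state \<Rightarrow> 'k) \<Rightarrow> ('a, 'b)
    state \<Rightarrow> 'k" where
  "rep p f x = (\<Sum>w\<in>Poly_Mapping.keys p. Poly_Mapping.lookup p w * ext f (act (letters w) x))"

lemma rep_0: "rep 0 f x = 0"
  by (simp add: rep_def)

lemma rep_single: "rep (Poly_Mapping.single (Word w) a) f x = a * ext f (act w x)"
  by (simp add: rep_def)

lemma rep_add: "rep (p + q) f x = rep p f x + rep q f x"
  unfolding rep_def by (rule setsum_keys_plus_distrib) (simp_all add: distrib_right)

lemma rep_diff: "rep (p - q) f x = rep p f x - rep q f x"
  using rep_add[of "p - q" q f x] by simp

lemma rep_sum: "rep (sum p S) f x = (\<Sum>i\<in>S. rep (p i) f x)"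
  by (induction S rule: infinite_finite_induct) (simp_all add: rep_0 rep_add)

lemma rep_zero_function: "rep q (\<lambda>_. 0) x = 0"
  unfolding rep_def by (rule sum.neutral) (auto split: option.split)

lemma rep_add_function: "rep q (\<lambda>y. f y + g y) x = rep q f x + rep q g x"
  unfolding rep_def sum.distrib[symmetric]
  by (rule sum.cong) (auto simp: distrib_left split: option.split)

lemma rep_mult: "rep (p * q) f x = rep q (rep p f) x"
proof (induction p rule: poly_mapping_additive_induct)
  case zero
  have "rep 0 f = (\<lambda>_. 0)"
    by (simp add: rep_0 fun_eq_iff)
  then show ?case
    by (simp add: rep_0 rep_zero_function)
next
  case (add p p')
  have "rep (p + p') f = (\<lambda>y. rep p f y + rep p' f y)"
    by (simp add: rep_add fun_eq_iff)
  then show ?case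
    using add by (simp add: rep_add rep_add_function distrib_right)
next
  case (single u a)
  obtain u' where u: "u = Word u'"
    by (cases u)
  show ?case
  proof (induction q rule: poly_mapping_additive_induct)
    case (single w b)
    obtain w' where w: "w = Word w'"
      by (cases w)
    show ?case
      by (cases "act w' x") (simp_all add: u w mult_single rep_single act_append)
  qed (simp_all add: rep_0 rep_add distrib_left)
qed

lemma rep_scl: "rep (scl k p) f x = k * rep p f x"
proof (induction p rule: poly_mapping_additive_induct)
  case (single w a)
  then show ?case
    by (cases w) (simp add: rep_single)
qed (simp_all add: rep_0 rep_add scl.scale_right_distrib distrib_left)

lemma rep_gen: "rep (gen g) f x = ext f (act1 g x)"
  by (simp add: gen_def rep_single)

lemma rep_gen2: "rep (gen g * gen h) f x = ext f (Option.bind (act1 h x) (act1 g))"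
  by (simp add: gen_def mult_single rep_single)

section \<open>The ideal of relations acts as zero\<close>

lemma leavitt_relators_carrier:
  "(leavitt_relators G :: (('a, 'b) generator free_word \<Rightarrow>\<^sub>0 'k::field) set) \<subseteq> carrier (free_algebra
      (generators G))"
  (is "_ \<subseteq> ?C")
proof -
  have gen: "gen g \<in> ?C" if "g \<in> generators G" for g
    using that by (auto simp: gen_def carrier_free_algebra)
  have gens: "Vertex v \<in> generators G \<longleftrightarrow> v \<in> verts G" "Edge e \<in> generators G \<longleftrightarrow> e \<in> arcs G"
    "Ghost e \<in> generators G \<longleftrightarrow> e \<in> arcs G" for v e
    by (auto simp: generators_def)
  have 0: "0 \<in> ?C"
    by (simp add: carrier_free_algebra)
  have sum: "(\<Sum>i\<in>S. h i) \<in> ?C"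
    if "\<And>i. i \<in> S \<Longrightarrow> h i \<in> ?C" for S :: "'b set" and h
    using that by (induction S rule: infinite_finite_induct) (auto simp: 0 intro:
        free_algebra_closed(2))
  show ?thesis
  proof
    fix r :: "('a, 'b) generator free_word \<Rightarrow>\<^sub>0 'k"
    assume "r \<in> leavitt_relators G"
    then show "r \<in> ?C"
      unfolding leavitt_relators_def
    proof (elim UnE CollectE exE conjE)
      fix v assume r: "r = gen (Vertex v) - (\<Sum>e\<in>out_arcs G v. gen (Edge e) * gen (Ghost e))"
          and "regular_vertex G v"
      then have "Vertex v \<in> generators G" "\<And>e. e \<in> out_arcs G v \<Longrightarrow>
          Edge e \<in> generators G \<and> Ghost e \<in> generators G"
        by (auto simp: generators_def regular_vertex_def)
      then show ?thesis
        unfolding r by (intro free_algebra_closed(3,4) sum gen) auto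
    next
      fix v w assume r: "r = gen (Vertex v) * gen (Vertex w) - (if v
          = w then gen (Vertex v) else 0)"
        and "v \<in> verts G" "w \<in> verts G"
      then show ?thesis
        unfolding r by (cases "v = w") (auto simp: gens intro!: free_algebra_closed(3,4) gen 0)
    next
      fix e f assume r: "r = gen (Ghost e) * gen (Edge f) - (if e
          = f then gen (Vertex (head G e)) else 0)"
        and "e \<in> arcs G" "f \<in> arcs G"
      then show ?thesis
        unfolding r by (cases "e = f") (auto simp: gens intro!: free_algebra_closed(3,4) gen 0)
    qed (simp, intro free_algebra_closed(3,4) gen; simp add: gens)+
  qed
qed

definition leavitt_ideal :: "(('a, 'b) generator free_word \<Rightarrow>\<^sub>0 'k::field) set" where
  "leavitt_ideal = nu_ideal_generated (free_algebra (generators G)) (leavitt_relators G)"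

lemma nu_ideal_leavitt_ideal: "nu_ideal (free_algebra (generators G)) leavitt_ideal"
  unfolding leavitt_ideal_def nu_ideal_generated_def
proof (rule nu_ideal_Inter)
  let ?C = "carrier (free_algebra (generators G))"
  have "nu_ideal (free_algebra (generators G)) ?C"
    unfolding nu_ideal_free_algebra_iff
    by (auto intro: free_algebra_closed simp: zero_in_free_algebra)
  then show "{I. nu_ideal (free_algebra (generators G)) I \<and> leavitt_relators G \<subseteq> I} \<noteq> {}"
    using leavitt_relators_carrier by auto
qed auto

lemma leavitt_relators_subset: "leavitt_relators G \<subseteq> leavitt_ideal"
  by (auto simp: leavitt_ideal_def nu_ideal_generated_def)

lemma rep_relator:
  assumes "r \<in> leavitt_relators G"
  shows "rep r f x = 0"
proof -
  obtain v t n where x: "x = (v, t, n)"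
    by (cases x)
  have out: "e \<in> out_arcs G (tail G e)" if "e \<in> arcs G" for e
    using that by (simp add: out_arcs_def)
  from assms show ?thesis
    unfolding leavitt_relators_def
  proof (elim UnE CollectE exE conjE)
    fix u assume r: "r = gen (Vertex u) - (\<Sum>e\<in>out_arcs G u. gen (Edge e) * gen (Ghost e))"
        and "regular_vertex G u"
    then have fin: "finite (out_arcs G u)" and "out_arcs G u \<noteq> {}"
      by (auto simp: regular_vertex_def sink_def infinite_emitter_def)
    then obtain e0 where e0: "e0 \<in> out_arcs G u"
      by blast
    \<comment> \<open>A state at \<open>u\<close> lies in the branch of exactly one edge, so exactly
      one summand acts, and it acts as the vertex does.\<close>
    have "rep (gen (Edge e) * gen (Ghost e)) f x = (if e
        = fst (unbranch u t) then ext f (act1 (Vertex u) x) else 0)"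
      if "e \<in> out_arcs G u" for e
      using that branch_unbranch[OF that, of t] fst_unbranch[OF that, of t]
      by (auto simp: rep_gen2 x out_arcs_def)
    then have "(\<Sum>e\<in>out_arcs G u. rep (gen (Edge e) * gen (Ghost e)) f x)
        = ext f (act1 (Vertex u) x)"
      using fin fst_unbranch[OF e0, of t] by simp
    then show ?thesis
      by (simp add: r rep_diff rep_sum rep_gen)
  qed (auto simp: rep_diff rep_gen rep_gen2 rep_0 x out unbranch_branch split: if_splits)
qed

lemma rep_leavitt_ideal:
  fixes p :: "('a, 'b) generator free_word \<Rightarrow>\<^sub>0 'k::field"
  assumes "p \<in> leavitt_ideal"
  shows "rep p f x = 0"
proof -
  let ?N = "{p \<in> carrier (free_algebra (generators G)). \<forall>(f :: _ \<Rightarrow> 'k) x. rep p f x = 0}"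
  have "nu_ideal (free_algebra (generators G)) ?N"
    unfolding nu_ideal_free_algebra_iff
  proof (intro conjI ballI allI)
    fix p q :: "('a, 'b) generator free_word \<Rightarrow>\<^sub>0 'k"
    assume p: "p \<in> carrier (free_algebra (generators G))" and q: "q \<in> ?N"
    then have "rep q f = (\<lambda>_. 0)" for f
      by auto
    then show "p * q \<in> ?N" "q * p \<in> ?N"
      using p q by (auto simp: rep_mult rep_zero_function intro: free_algebra_closed)
  qed (auto simp: rep_0 rep_add rep_scl free_algebra_closed zero_in_free_algebra)
  moreover have "leavitt_relators G \<subseteq> ?N"
    using leavitt_relators_carrier rep_relator by blast
  ultimately have "leavitt_ideal \<subseteq> ?N"
    by (auto simp: leavitt_ideal_def nu_ideal_generated_def)
  then have "p \<in> ?N"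
    using assms by (rule subsetD)
  then show ?thesis
    by blast
qed

text \<open>The degree of the resulting state records the length of the path; the unspecified
  component \<open>t'\<close> is never inspected.\<close>

lemma act_path:
  assumes "awalk u p v"
  shows "\<exists>t'. act (map Edge p @ [Vertex v]) (v, t, n) = Some (u, t', n + int (length p))"
  using assms
proof (induction p arbitrary: u)
  case (Cons e p)
  then obtain t' where "act (map Edge p @ [Vertex v]) (v, t, n)
      = Some (head G e, t', n + int (length p))"
    by (auto simp: awalk_simps)
  then show ?case
    using Cons.prems by (auto simp: awalk_simps)
qed (auto simp: awalk_simps)

end

section \<open>The Leavitt path algebra as an algebra of operators\<close>

locale leavitt_quotient = wf_digraph E + free_ideal "generators E"
    "leavitt_ideal :: (('v, 'e) generator free_word \<Rightarrow>\<^sub>0 'k :: field) set"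
  for E :: "('v, 'e) pre_digraph"
begin

abbreviation \<Gamma> :: "('v, 'e) generator \<Rightarrow> (('v, 'e) generator, 'k) operator" where
  "\<Gamma> g \<equiv> \<Phi> (gen g)"

lemma gen_in_C: "g \<in> generators E \<Longrightarrow> gen g \<in> C"
  by (auto simp: gen_def carrier_free_algebra)

lemma \<Phi>_relator: "r \<in> leavitt_relators E \<Longrightarrow> \<Phi> r = 0"
  using \<Phi>_eq_0_iff[of r] leavitt_relators_carrier leavitt_relators_subset by blast

sublocale L: leavitt_relations E operator_scale \<Gamma>
proof (intro leavitt_relations.intro leavitt_relations_axioms.intro wf_digraph_axioms
    vector_space_operator)
  have V: "gen (Vertex v) \<in> C" if "v \<in> verts E" for v
    by (rule gen_in_C) (use that in \<open>simp add: generators_def\<close>)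
  fix v w assume v: "v \<in> verts E" and w: "w \<in> verts E"
  have "\<Phi> (gen (Vertex v) * gen (Vertex w) - (if v = w then gen (Vertex v) else 0)) = 0"
    using v w by (intro \<Phi>_relator) (auto simp: leavitt_relators_def)
  then show "\<Gamma> (Vertex v) * \<Gamma> (Vertex w) = (if v = w then \<Gamma> (Vertex v) else 0)"
    using v w by (auto simp: \<Phi>_diff \<Phi>_mult \<Phi>_0 V)
next
  fix e assume e: "e \<in> arcs E"
  have "Vertex (tail E e) \<in> generators E" "Vertex (head E e) \<in> generators E" "Edge e \<in> generators E"
      "Ghost e \<in> generators E"
    using e by (auto simp: generators_def)
  note C = this[THEN gen_in_C]
  have "\<Phi> (gen (Vertex (tail E e)) * gen (Edge e) - gen (Edge e)) = 0"
    using e by (intro \<Phi>_relator) (auto simp: leavitt_relators_def)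
  then show "\<Gamma> (Vertex (tail E e)) * \<Gamma> (Edge e) = \<Gamma> (Edge e)"
    by (simp add: \<Phi>_diff \<Phi>_mult C)
  have "\<Phi> (gen (Edge e) * gen (Vertex (head E e)) - gen (Edge e)) = 0"
    using e by (intro \<Phi>_relator) (auto simp: leavitt_relators_def)
  then show "\<Gamma> (Edge e) * \<Gamma> (Vertex (head E e)) = \<Gamma> (Edge e)"
    by (simp add: \<Phi>_diff \<Phi>_mult C)
  have "\<Phi> (gen (Vertex (head E e)) * gen (Ghost e) - gen (Ghost e)) = 0"
    using e by (intro \<Phi>_relator) (auto simp: leavitt_relators_def)
  then show "\<Gamma> (Vertex (head E e)) * \<Gamma> (Ghost e) = \<Gamma> (Ghost e)"
    by (simp add: \<Phi>_diff \<Phi>_mult C)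
  have "\<Phi> (gen (Ghost e) * gen (Vertex (tail E e)) - gen (Ghost e)) = 0"
    using e by (intro \<Phi>_relator) (auto simp: leavitt_relators_def)
  then show "\<Gamma> (Ghost e) * \<Gamma> (Vertex (tail E e)) = \<Gamma> (Ghost e)"
    by (simp add: \<Phi>_diff \<Phi>_mult C)
next
  fix e e' assume e: "e \<in> arcs E" "e' \<in> arcs E"
  have "Vertex (head E e) \<in> generators E" "Edge e' \<in> generators E" "Ghost e \<in> generators E"
    using e by (auto simp: generators_def)
  note C = this[THEN gen_in_C]
  have "\<Phi> (gen (Ghost e) * gen (Edge e') - (if e = e' then gen (Vertex (head E e)) else 0)) = 0"
    using e by (intro \<Phi>_relator) (auto simp: leavitt_relators_def)
  then show "\<Gamma> (Ghost e) * \<Gamma> (Edge e') = (if e = e' then \<Gamma> (Vertex (head E e)) else 0)"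
    using C by (auto simp: \<Phi>_diff \<Phi>_mult \<Phi>_0)
next
  fix v assume v: "regular_vertex E v"
  have sum: "\<Phi> (\<Sum>i\<in>S. h i) = (\<Sum>i\<in>S. \<Phi> (h i))" for S :: "'e set" and h
    by (induction S rule: infinite_finite_induct) (simp_all add: \<Phi>_add \<Phi>_0)
  have "\<Phi> (gen (Vertex v) - (\<Sum>e\<in>out_arcs E v. gen (Edge e) * gen (Ghost e))) = 0"
    by (intro \<Phi>_relator, unfold leavitt_relators_def, rule UnI2) (use v in blast)
  moreover have "\<Phi> (gen (Edge e) * gen (Ghost e)) = \<Gamma> (Edge e) * \<Gamma> (Ghost e)"
      if "e \<in> out_arcs E v" for e
    using that by (intro \<Phi>_mult gen_in_C) (auto simp: generators_def out_arcs_def)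
  ultimately show "\<Gamma> (Vertex v) = (\<Sum>e\<in>out_arcs E v. \<Gamma> (Edge e) * \<Gamma> (Ghost e))"
    by (simp add: \<Phi>_diff sum)
qed (simp_all add: operator_scale_mult_left operator_scale_mult_right)

lemma L_word: "\<lbrakk>w \<noteq> []; set w \<subseteq> generators E\<rbrakk> \<Longrightarrow> L.word w = \<Phi> (Poly_Mapping.single (Word w) 1)"
proof (induction w rule: L.word.induct)
  case (2 g)
  show ?case
    by (subst L.word.simps(2)) (simp only: gen_def)
next
  case (3 g h w)
  have "Poly_Mapping.single (Word (g # h # w)) 1
      = (gen g * Poly_Mapping.single (Word (h # w)) 1 :: _ \<Rightarrow>\<^sub>0 'k)"
    by (simp add: gen_def mult_single)
  moreover have "Poly_Mapping.single (Word (h # w)) 1 \<in> C" "gen g \<in> C"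
    using 3 by (auto simp: carrier_free_algebra gen_def)
  ultimately show ?case
    using 3 by (simp add: \<Phi>_mult)
qed simp

lemma L_A: "L.A = \<Phi> ` C"
proof
  have "L.subspace (\<Phi> ` C)"
    by (rule L.subspaceI)
      (auto simp flip: \<Phi>_add \<Phi>_scl \<Phi>_0 simp: zero_in_free_algebra
        intro!: imageI free_algebra_closed)
  then show "L.A \<subseteq> \<Phi> ` C"
    unfolding L.A_def
    by (rule L.span_minimal[rotated]) (auto simp: L_word carrier_free_algebra intro!: imageI)
  have "\<Phi> p \<in> L.A" if "p \<in> C" for p
  proof -
    have *: "\<Phi> (\<Sum>w\<in>S. Poly_Mapping.single w (Poly_Mapping.lookup p w)) \<in> L.A"
      if "S \<subseteq> Poly_Mapping.keys p" "finite S" for S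
      using that(2,1)
    proof (induction S rule: finite_induct)
      case (insert x S)
      obtain w where w: "x = Word w" "w \<noteq> []" "set w \<subseteq> generators E"
        using insert \<open>p \<in> C\<close> by (auto simp: carrier_free_algebra)
      have "Poly_Mapping.single x (Poly_Mapping.lookup p x)
          = scl (Poly_Mapping.lookup p x) (Poly_Mapping.single x 1)"
        by simp
      then have "\<Phi> (Poly_Mapping.single x (Poly_Mapping.lookup p x))
          = operator_scale (Poly_Mapping.lookup p x) (L.word w)"
        using w by (simp only: \<Phi>_scl L_word[OF w(2,3)])
      then show ?case
        using insert w by (simp add: \<Phi>_add L.A_add L.A_scale L.word_in_A)
    qed (simp add: \<Phi>_0 L.A_0)
    show ?thesis
      using *[of "Poly_Mapping.keys p"] by (simp add: poly_mapping_sum_singles)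
  qed
  then show "\<Phi> ` C \<subseteq> L.A"
    by auto
qed

lemma L_pth: "awalk u p v \<Longrightarrow> L.pth u p = \<Phi> (Poly_Mapping.single (Word (map Edge p @ [Vertex v])) 1)"
proof -
  assume p: "awalk u p v"
  then have "L.pth u p = L.word (map Edge p @ [Vertex v])"
  proof (induction p arbitrary: u)
    case (Cons e p)
    moreover have "L.word (g # w) = \<Gamma> g * L.word w" if "w \<noteq> []" for g w
      using that by (cases w) auto
    ultimately show ?case
      by (auto simp: awalk_simps)
  qed (auto simp: awalk_simps)
  also have "\<dots> = \<Phi> (Poly_Mapping.single (Word (map Edge p @ [Vertex v])) 1)"
    using p awalk_last_in_verts[OF p] by (intro L_word) (auto simp: generators_def awalk_def)
  finally show ?thesis .
qed

sublocale L: leavitt E operator_scale \<Gamma>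
proof
  fix v m assume v: "v \<in> verts E"
  \<comment> \<open>The indicator function of degree \<open>m\<close>, evaluated at a state of
    degree 0 at \<open>v\<close>. A closed path moves that state to its own length;
    \<open>Inl 0\<close> is an arbitrary point.\<close>
  define F where "F p = rep p (\<lambda>(u, t, n). if n = int m then 1 else 0) (v, Inl 0, 0)"
    for p :: "('v, 'e) generator free_word \<Rightarrow>\<^sub>0 'k"
  \<comment> \<open>Independent of the preimage chosen: two preimages in \<open>C\<close> differ by
    an element of the ideal, which the representation annihilates.\<close>
  define \<phi> where "\<phi> T = F (SOME p. p \<in> C \<and> \<Phi> p = T)" for T
  have \<phi>: "\<phi> (\<Phi> p) = F p" if p: "p \<in> C" for p
  proof -
    let ?q = "SOME q. q \<in> C \<and> \<Phi> q = \<Phi> p"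
    have q: "?q \<in> C" "\<Phi> ?q = \<Phi> p"
      using someI[of "\<lambda>q. q \<in> C \<and> \<Phi> q = \<Phi> p" p] p by auto
    then have "?q - p \<in> leavitt_ideal"
      using p \<Phi>_eq_0_iff[of "?q - p"] free_algebra_closed(3)[OF q(1) p] by (simp add: \<Phi>_diff)
    then have "F ?q - F p = 0"
      unfolding F_def rep_diff[symmetric] by (rule rep_leavitt_ideal)
    then show ?thesis
      by (simp add: \<phi>_def)
  qed
  have "\<phi> (x + y) = \<phi> x + \<phi> y" if "x \<in> L.A" "y \<in> L.A" for x y
    using that unfolding L_A by (auto simp: \<phi> free_algebra_closed F_def rep_add simp flip: \<Phi>_add)
  moreover have "\<phi> (operator_scale k x) = k * \<phi> x" if "x \<in> L.A" for k x
    using that unfolding L_A by (auto simp: \<phi> free_algebra_closed F_def rep_scl simp flip: \<Phi>_scl)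
  moreover have "\<phi> (L.pth v p) = (if length p = m then 1 else 0)" if p: "awalk v p v" for p
  proof -
    have "Poly_Mapping.single (Word (map Edge p @ [Vertex v])) 1 \<in> C"
      using p by (auto simp: carrier_free_algebra generators_def awalk_def)
    then have "\<phi> (L.pth v p) = F (Poly_Mapping.single (Word (map Edge p @ [Vertex v])) 1)"
      using p by (simp add: L_pth \<phi>)
    also have "\<dots> = (if length p = m then 1 else 0)"
      using act_path[OF p, of "Inl 0" 0] by (auto simp: F_def rep_single)
    finally show ?thesis .
  qed
  ultimately show "\<exists>\<phi>. (\<forall>x\<in>L.A. \<forall>y\<in>L.A. \<phi> (x + y) = \<phi> x + \<phi> y) \<and>
      (\<forall>k. \<forall>x\<in>L.A. \<phi> (operator_scale k x) = k * \<phi> x) \<and>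
      (\<forall>p. awalk v p v \<longrightarrow> \<phi> (L.pth v p) = (if length p = m then 1 else 0))"
    by blast
qed

definition embed :: "(('v, 'e) generator free_word \<Rightarrow>\<^sub>0 'k) set \<Rightarrow> (('v, 'e) generator, 'k) operator"
    where
  "embed X = \<Phi> (SOME a. a \<in> X)"

text \<open>The representative chosen by \<open>embed\<close> differs from \<open>a\<close> by an
  element of the ideal, on which \<open>\<Phi>\<close> vanishes.\<close>

lemma embed_coset:
  assumes "a \<in> C"
  shows "embed (coset a) = \<Phi> a"
proof -
  have "(SOME x. x \<in> coset a) - a \<in> leavitt_ideal"
    using someI[of "\<lambda>x. x \<in> coset a", OF coset_self] by (simp add: mem_coset)
  then have "\<Phi> ((SOME x. x \<in> coset a) - a) = 0"
    using \<Phi>_eq_0_iff I_subset by blast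
  then show ?thesis
    by (simp add: embed_def \<Phi>_diff)
qed

sublocale embed: nu_isomorphism Q L.alg embed
proof
  have 0: "0 \<in> C"
    by (simp add: carrier_free_algebra)
  show "bij_betw embed (carrier Q) (carrier L.alg)"
    unfolding bij_betw_def
  proof
    show "inj_on embed (carrier Q)"
    proof (rule inj_onI)
      fix X Y assume "X \<in> carrier Q" "Y \<in> carrier Q" and eq: "embed X = embed Y"
      then obtain a b where ab: "a \<in> C" "b \<in> C" "X = coset a" "Y = coset b"
        by (auto simp: carrier_Q)
      then have "\<Phi> (a - b) = 0"
        using eq by (simp add: embed_coset \<Phi>_diff)
      then show "X = Y"
        using ab \<Phi>_eq_0_iff[OF free_algebra_closed(3)[OF ab(1,2)]] by (simp add: coset_eq)
    qed
    show "embed ` carrier Q = carrier L.alg"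
      by (auto simp: carrier_Q L.alg_def L_A embed_coset image_image)
  qed
  show "nu_zero Q \<in> carrier Q" "embed (nu_zero Q) = nu_zero L.alg"
    using 0 by (auto simp: zero_Q carrier_Q embed_coset \<Phi>_0 L.alg_def)
qed (auto simp: carrier_Q add_Q mult_Q scale_Q embed_coset free_algebra_closed \<Phi>_add \<Phi>_mult \<Phi>_scl
    L.alg_def)

end

theorem theorem6p2:
  fixes E :: "('v, 'e) pre_digraph" and K :: "'k :: field itself"
  assumes "wf_digraph E"
    and "prime_algebra (leavitt_path_algebra K E)"
  shows "(\<not> (row_finite E \<and> comet E) \<longrightarrow>
           algebra_isomorphic (centroid (leavitt_path_algebra K E)) (field_algebra K)) \<and>
         (row_finite E \<and> comet E \<longrightarrow>
           algebra_isomorphic (centroid (leavitt_path_algebra K E)) (laurent_polynomial_algebra K))"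
proof -
  interpret wf_digraph E
    by (rule assms(1))
  interpret leavitt_quotient E
    by unfold_locales (rule nu_ideal_leavitt_ideal)
  have Q: "leavitt_path_algebra K E = Q"
    by (simp add: leavitt_path_algebra_def leavitt_ideal_def)
  have prime: "prime_algebra L.alg"
    using assms(2) embed.prime_transport unfolding Q by blast
  show ?thesis
    unfolding Q
    by (intro conjI impI embed.centroid_transport)
      (auto intro: L.centroid_not_row_finite_comet[OF prime] L.centroid_row_finite_comet[OF prime])
qed

end
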